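(* For every integer $c \geq 2$, the problem Max-$c$-CSP Above Average can be solved in $O(2^{(c(c+1)/2)k}\cdot m)$ time, where $k$ is the parameter and $m$ is the number of constraints.
   Context: Max-$c$-CSP Above Average: the input is a set $V$ of variables, a collection of constraints $(f_1,S_1,w_1),\dots,(f_m,S_m,w_m)$ where each $f_i:\{-1,+1\}^{c'}\to\{0,1\}$ with $c'\le c$, each $S_i$ is an ordered tuple of $c'$ variables of $V$, and each $w_i$ is a positive integer, together with an integer $k\ge 0$ (the parameter). An assignment $\phi:V\to\{-1,+1\}$ satisfies constraint $i$ if $f_i(\phi(S_i))=1$; its weight is the total weight of satisfied constraints. With $W$ the total weight and $\rho$ the expected fraction of weight satisfied by a uniformly random assignment, the question is whether some assignment has weight at least $\rho W + k/2^c$. *)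

theory Defs
  imports "HOL-Probability.Probability"
begin

section \<open>Max-c-CSP Above Average\<close>

text \<open>The variables of an instance are numbered: \<open>V = {..<num_vars I}\<close>. A predicate \<open>f\<close> on
  \<open>{-1,+1}\<^sup>r\<close> is a function on integer lists, only its values on \<open>sign_vectors r\<close> matter.\<close>

record csp_constraint =
  predicate :: "int list \<Rightarrow> nat"
  scope :: "nat list"
  weight :: nat

record csp =
  num_vars :: nat
  constraints :: "csp_constraint list"

definition sign_vectors :: "nat \<Rightarrow> int list list" where
  "sign_vectors r = product_lists (replicate r [-1, 1])"

definition valid_constraint :: "nat \<Rightarrow> nat \<Rightarrow> csp_constraint \<Rightarrow> bool" where
  "valid_constraint c n C \<longleftrightarrow>
     length (scope C) \<le> c \<and>
     set (scope C) \<subseteq> {..<n} \<and>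
     (\<forall>x \<in> set (sign_vectors (length (scope C))). predicate C x \<in> {0, 1}) \<and>
     weight C > 0"

definition csp_instance :: "nat \<Rightarrow> csp \<Rightarrow> bool" where
  "csp_instance c I \<longleftrightarrow> (\<forall>C \<in> set (constraints I). valid_constraint c (num_vars I) C)"

definition num_constraints :: "csp \<Rightarrow> nat" where
  "num_constraints I = length (constraints I)"

definition assignments :: "csp \<Rightarrow> (nat \<Rightarrow> int) set" where
  "assignments I = {..<num_vars I} \<rightarrow>\<^sub>E {-1, 1}"

definition satisfies :: "(nat \<Rightarrow> int) \<Rightarrow> csp_constraint \<Rightarrow> bool" where
  "satisfies \<phi> C \<longleftrightarrow> predicate C (map \<phi> (scope C)) = 1"

definition assignment_weight :: "csp \<Rightarrow> (nat \<Rightarrow> int) \<Rightarrow> nat" where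
  "assignment_weight I \<phi> = (\<Sum>C \<leftarrow> filter (satisfies \<phi>) (constraints I). weight C)"

definition total_weight :: "csp \<Rightarrow> nat" where
  "total_weight I = (\<Sum>C \<leftarrow> constraints I. weight C)"

definition average_fraction :: "csp \<Rightarrow> real" where
  "average_fraction I =
     measure_pmf.expectation (pmf_of_set (assignments I))
       (\<lambda>\<phi>. real (assignment_weight I \<phi>) / real (total_weight I))"

definition above_average :: "nat \<Rightarrow> csp \<Rightarrow> nat \<Rightarrow> bool" where
  "above_average c I k \<longleftrightarrow>
     (\<exists>\<phi> \<in> assignments I.
        real (assignment_weight I \<phi>) \<ge> average_fraction I * real (total_weight I) + real k / 2 ^ c)"

text \<open>A predicate is given to the algorithm by its truth table.\<close>

definition encode_constraint :: "csp_constraint \<Rightarrow> int list" where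
  "encode_constraint C =
     int (length (scope C)) # map int (scope C) @
     map (\<lambda>x. int (predicate C x)) (sign_vectors (length (scope C))) @ [int (weight C)]"

definition encode_instance :: "csp \<Rightarrow> nat \<Rightarrow> int list" where
  "encode_instance I k =
     int (num_vars I) # int k # int (num_constraints I) #
     concat (map encode_constraint (constraints I))"


section \<open>Unit-cost random access machines\<close>

text \<open>The machine of Cook and Reckhow (1973): registers \<open>X 0, X 1, \<dots>\<close> hold integers and are
  initially zero; addition and subtraction are the only arithmetic operations; the input is a
  sequence of integers that is read one at a time. In \<open>Load i j\<close> and \<open>Store i j\<close> the indirect
  address is in register \<open>j\<close> and \<open>i\<close>, respectively; a negative address denotes register 0.
  \<open>Read\<close> yields 0 when the input is exhausted. The machine halts when the program counter
  leaves the program; its result is then in register 0.\<close>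

datatype ram_instr =
    Const nat int
  | Add nat nat nat
  | Sub nat nat nat
  | Load nat nat
  | Store nat nat
  | JumpPos nat nat
  | Read nat

type_synonym ram_config = "nat \<times> (nat \<Rightarrow> int) \<times> int list"

fun ram_exec :: "ram_instr \<Rightarrow> ram_config \<Rightarrow> ram_config" where
  "ram_exec (Const i a) (pc, X, inp) = (pc + 1, X(i := a), inp)"
| "ram_exec (Add i j l) (pc, X, inp) = (pc + 1, X(i := X j + X l), inp)"
| "ram_exec (Sub i j l) (pc, X, inp) = (pc + 1, X(i := X j - X l), inp)"
| "ram_exec (Load i j) (pc, X, inp) = (pc + 1, X(i := X (nat (X j))), inp)"
| "ram_exec (Store i j) (pc, X, inp) = (pc + 1, X(nat (X i) := X j), inp)"
| "ram_exec (JumpPos i l) (pc, X, inp) = (if X i > 0 then l else pc + 1, X, inp)"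
| "ram_exec (Read i) (pc, X, []) = (pc + 1, X(i := 0), [])"
| "ram_exec (Read i) (pc, X, a # inp) = (pc + 1, X(i := a), inp)"

definition ram_halted :: "ram_instr list \<Rightarrow> ram_config \<Rightarrow> bool" where
  "ram_halted P s \<longleftrightarrow> fst s \<ge> length P"

definition ram_step :: "ram_instr list \<Rightarrow> ram_config \<Rightarrow> ram_config" where
  "ram_step P s = (if ram_halted P s then s else ram_exec (P ! fst s) s)"

definition ram_run :: "ram_instr list \<Rightarrow> int list \<Rightarrow> nat \<Rightarrow> ram_config" where
  "ram_run P inp t = (ram_step P ^^ t) (0, (\<lambda>_. 0), inp)"

definition ram_terminates :: "ram_instr list \<Rightarrow> int list \<Rightarrow> bool" where
  "ram_terminates P inp \<longleftrightarrow> (\<exists>t. ram_halted P (ram_run P inp t))"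

definition ram_time :: "ram_instr list \<Rightarrow> int list \<Rightarrow> nat" where
  "ram_time P inp = (LEAST t. ram_halted P (ram_run P inp t))"

definition ram_result :: "ram_instr list \<Rightarrow> int list \<Rightarrow> int" where
  "ram_result P inp = fst (snd (ram_run P inp (ram_time P inp))) 0"

definition solves_above_average :: "nat \<Rightarrow> ram_instr list \<Rightarrow> bool" where
  "solves_above_average c P \<longleftrightarrow>
     (\<forall>I k. csp_instance c I \<longrightarrow>
        ram_terminates P (encode_instance I k) \<and>
        ram_result P (encode_instance I k) = (if above_average c I k then 1 else 0))"

end

theory Submission
  imports Defs "HOL-Library.Nat_Bijection"
begin

text \<open>Scaled by \<open>2 ^ c\<close>, the weight of an assignment \<open>x\<close> in \<open>{-1, 1}\<close> is a multilinear polynomial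
  of degree at most \<open>c\<close> with integer coefficients, whose constant term is the scaled average; the
  question is whether it can exceed its constant term by \<open>k\<close>.

  Starting from \<open>A = {}\<close>, go through \<open>s = c, \<dots>, 1\<close> and add to \<open>A\<close> every monomial \<open>S\<close> of nonzero
  coefficient with \<open>s\<close> variables outside \<open>A\<close>. All monomials then have fewer than \<open>s\<close> variables
  outside \<open>A\<close>, and the sets \<open>T = S - A\<close> (with \<open>A\<close> as before round \<open>s\<close>) of the added monomials are
  disjoint. If round \<open>s\<close> adds \<open>k\<close> monomials, the answer is yes: choose \<open>x\<close> on \<open>A\<close> uniformly and
  the rest with density \<open>\<Prod>(1 + sgn (q T x) * \<Prod>u\<in>T. x u)\<close>, where \<open>q T x\<close> is the coefficient
  of \<open>T\<close> once \<open>A\<close> is fixed. As no monomial contains two of the \<open>T\<close>, each \<open>T\<close> raises the expectation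
  by the mean of \<open>\<bar>q T x\<bar>\<close>, which is at least 1 since \<open>q T\<close> is a nonzero polynomial with integer
  coefficients. Otherwise \<open>A\<close> ends up with at most \<open>(k - 1) * (c + \<dots> + 1)\<close> variables and contains
  every monomial, so it suffices to try all assignments of \<open>A\<close>.

  The coefficients are collected in linear time by direct addressing: a set of variables is stored
  at an address that is a sum of powers of two, which costs nothing extra on a unit-cost machine.\<close>


section \<open>A structured language and its compilation\<close>

text \<open>The rounds run downwards in \<open>s\<close> because disjointness is obtained by
  counting: as long as every monomial has at most \<open>s\<close> variables outside
  \<open>A\<close>, one that still has \<open>s\<close> variables outside the enlarged set cannot
  meet a block taken earlier.

  The time bound shapes the rest. It allows one factor \<open>m\<close>, so neither a logarithmic
  factor for sorting monomials nor a factor \<open>k\<close> per assignment is affordable. Registers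
  start at zero, so the coefficient table needs no initialisation although its addresses are
  exponentially large. The set \<open>A\<close> is bounded twice: in terms of \<open>k\<close>, for
  the number of assignments tried, and in terms of the number of monomials, for the cost of each of
  them.

  The machine can neither multiply nor test anything but positivity. Whatever depends on
  \<open>c\<close> alone is therefore unrolled when the program is built; loops remain only over
  constraints, records, elements of \<open>A\<close> and assignments.\<close>

type_synonym st = "(nat \<Rightarrow> int) \<times> (nat \<Rightarrow> nat \<Rightarrow> int) \<times> int list"

datatype op =
    OConst nat int
  | OAdd nat nat nat
  | OSub nat nat nat
  | OLoad nat nat nat
  | OStore nat nat nat
  | ORead nat

datatype com =
    Skip
  | Op op
  | Seq com com (infixr \<open>;;\<close> 60)
  | IfPos nat com com
  | WhilePos nat com

fun op_ev :: "op \<Rightarrow> st \<Rightarrow> st" where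
  "op_ev (OConst i a) (X, H, inp) = (X(i := a), H, inp)"
| "op_ev (OAdd i j l) (X, H, inp) = (X(i := X j + X l), H, inp)"
| "op_ev (OSub i j l) (X, H, inp) = (X(i := X j - X l), H, inp)"
| "op_ev (OLoad i a j) (X, H, inp) = (X(i := H a (nat (X j))), H, inp)"
| "op_ev (OStore a j i) (X, H, inp) = (X, H(a := (H a)(nat (X j) := X i)), inp)"
| "op_ev (ORead i) (X, H, inp) = (X(i := (if inp = [] then 0 else hd inp)), H, tl inp)"

text \<open>Of the eleven instructions that compute an address ten are executed on either branch;
  the access itself makes 11, against a code length of 12 in \<open>op_size\<close>.\<close>

fun op_cost :: "op \<Rightarrow> nat" where
  "op_cost (OLoad i a j) = 11"
| "op_cost (OStore a j i) = 11"
| "op_cost _ = 1"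

text \<open>The costs are exact counts of machine steps. Every \<open>2\<close> is an unconditional
  jump, which takes two instructions: loading 1 into a scratch register and a \<open>JumpPos\<close>
  on it.\<close>

inductive big_step :: "com \<Rightarrow> st \<Rightarrow> nat \<Rightarrow> st \<Rightarrow> bool" where
  Skip: "big_step Skip s 0 s"
| Op: "big_step (Op a) s (op_cost a) (op_ev a s)"
| Seq: "big_step c1 s n1 s' \<Longrightarrow> big_step c2 s' n2 s'' \<Longrightarrow> big_step (c1 ;; c2) s (n1 + n2) s''"
| IfT: "fst s i > 0 \<Longrightarrow> big_step c1 s n s' \<Longrightarrow> big_step (IfPos i c1 c2) s (1 + n) s'"
| IfF: "\<not> fst s i > 0 \<Longrightarrow> big_step c2 s n s' \<Longrightarrow> big_step (IfPos i c1 c2) s (1 + (n + 2)) s'"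
| WhileT: "fst s i > 0 \<Longrightarrow> big_step c s n1 s' \<Longrightarrow> big_step (WhilePos i c) s' n2 s'' \<Longrightarrow>
    big_step (WhilePos i c) s (1 + (n1 + (2 + n2))) s''"
| WhileF: "\<not> fst s i > 0 \<Longrightarrow> big_step (WhilePos i c) s (1 + 2) s"

text \<open>Scalar \<open>i < 32\<close> lives in register \<open>i\<close>, entry \<open>e\<close> of array \<open>a < 16\<close> in register
  \<open>64 + 16 * e + a\<close>; registers 32 and 33 are scratch. The jumps clip a negative index to 0
  and take the same time on both branches.\<close>

definition addr_code :: "nat \<Rightarrow> nat \<Rightarrow> nat \<Rightarrow> ram_instr list" where
  "addr_code pc j a =
     [Const 33 1, Const 32 0, JumpPos j (pc + 4), JumpPos 33 (pc + 5), Add 32 32 j,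
      Add 32 32 32, Add 32 32 32, Add 32 32 32, Add 32 32 32, Const 33 (64 + int a), Add 32 32 33]"

fun op_comp :: "nat \<Rightarrow> op \<Rightarrow> ram_instr list" where
  "op_comp pc (OConst i a) = [Const i a]"
| "op_comp pc (OAdd i j l) = [Add i j l]"
| "op_comp pc (OSub i j l) = [Sub i j l]"
| "op_comp pc (OLoad i a j) = addr_code pc j a @ [Load i 32]"
| "op_comp pc (OStore a j i) = addr_code pc j a @ [Store 32 i]"
| "op_comp pc (ORead i) = [Read i]"

fun op_size :: "op \<Rightarrow> nat" where
  "op_size (OLoad i a j) = 12"
| "op_size (OStore a j i) = 12"
| "op_size _ = 1"

fun com_size :: "com \<Rightarrow> nat" where
  "com_size Skip = 0"
| "com_size (Op a) = op_size a"
| "com_size (c1 ;; c2) = com_size c1 + com_size c2"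
| "com_size (IfPos i c1 c2) = 3 + com_size c2 + com_size c1"
| "com_size (WhilePos i c) = 5 + com_size c"

fun comp_com :: "nat \<Rightarrow> com \<Rightarrow> ram_instr list" where
  "comp_com pc Skip = []"
| "comp_com pc (Op a) = op_comp pc a"
| "comp_com pc (c1 ;; c2) = comp_com pc c1 @ comp_com (pc + com_size c1) c2"
| "comp_com pc (IfPos i c1 c2) =
     JumpPos i (pc + 3 + com_size c2) # comp_com (pc + 1) c2 @
     [Const 33 1, JumpPos 33 (pc + 3 + com_size c2 + com_size c1)] @
     comp_com (pc + 3 + com_size c2) c1"
| "comp_com pc (WhilePos i c) =
     [JumpPos i (pc + 3), Const 33 1, JumpPos 33 (pc + 5 + com_size c)] @
     comp_com (pc + 3) c @ [Const 33 1, JumpPos 33 pc]"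

fun op_wf :: "op \<Rightarrow> bool" where
  "op_wf (OConst i a) \<longleftrightarrow> i < 32"
| "op_wf (OAdd i j l) \<longleftrightarrow> i < 32 \<and> j < 32 \<and> l < 32"
| "op_wf (OSub i j l) \<longleftrightarrow> i < 32 \<and> j < 32 \<and> l < 32"
| "op_wf (OLoad i a j) \<longleftrightarrow> i < 32 \<and> a < 16 \<and> j < 32"
| "op_wf (OStore a j i) \<longleftrightarrow> i < 32 \<and> a < 16 \<and> j < 32"
| "op_wf (ORead i) \<longleftrightarrow> i < 32"

fun com_wf :: "com \<Rightarrow> bool" where
  "com_wf Skip \<longleftrightarrow> True"
| "com_wf (Op a) \<longleftrightarrow> op_wf a"
| "com_wf (c1 ;; c2) \<longleftrightarrow> com_wf c1 \<and> com_wf c2"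
| "com_wf (IfPos i c1 c2) \<longleftrightarrow> i < 32 \<and> com_wf c1 \<and> com_wf c2"
| "com_wf (WhilePos i c) \<longleftrightarrow> i < 32 \<and> com_wf c"

section \<open>Correctness of the compiler\<close>

lemma length_addr_code [simp]: "length (addr_code pc j a) = 11"
  by (simp add: addr_code_def)

lemma length_op_comp [simp]: "length (op_comp pc a) = op_size a"
  by (cases a) auto

lemma length_comp_com [simp]: "length (comp_com pc c) = com_size c"
  by (induction c arbitrary: pc) auto

definition code_at :: "ram_instr list \<Rightarrow> nat \<Rightarrow> ram_instr list \<Rightarrow> bool" where
  "code_at P pc cs \<longleftrightarrow> (\<exists>pre post. P = pre @ cs @ post \<and> length pre = pc)"

lemma code_at_append [simp]:
  "code_at P pc (cs @ ds) \<longleftrightarrow> code_at P pc cs \<and> code_at P (pc + length cs) ds" (is "?l \<longleftrightarrow> ?r")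
proof
  assume ?l
  then obtain pre post where "P = pre @ (cs @ ds) @ post" "length pre = pc"
    unfolding code_at_def by blast
  then show ?r unfolding code_at_def
    by (metis append.assoc length_append)
next
  assume ?r
  then obtain pre post pre' post' where *: "P = pre @ cs @ post" "length pre = pc"
    "P = pre' @ ds @ post'" "length pre' = pc + length cs"
    unfolding code_at_def by blast
  then have "(pre @ cs) @ post = pre' @ (ds @ post')" "length (pre @ cs) = length pre'" by auto
  then have "pre' = pre @ cs" "post = ds @ post'" using append_eq_append_conv by blast+
  with * show ?l unfolding code_at_def by auto
qed

lemma code_at_Nil [simp]: "code_at P pc [] \<longleftrightarrow> pc \<le> length P"
proof
  assume "pc \<le> length P"
  then show "code_at P pc []" unfolding code_at_def
    by (intro exI[of _ "take pc P"] exI[of _ "drop pc P"]) auto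
qed (auto simp: code_at_def)

lemma code_at_Cons:
  "code_at P pc (x # cs) \<longleftrightarrow> pc < length P \<and> P ! pc = x \<and> code_at P (Suc pc) cs"
proof -
  have "code_at P pc [x] \<longleftrightarrow> pc < length P \<and> P ! pc = x"
  proof
    assume "code_at P pc [x]"
    then show "pc < length P \<and> P ! pc = x" unfolding code_at_def by (auto simp: nth_append)
  next
    assume "pc < length P \<and> P ! pc = x"
    then show "code_at P pc [x]" unfolding code_at_def
      by (intro exI[of _ "take pc P"] exI[of _ "drop (Suc pc) P"]) (auto simp: id_take_nth_drop)
  qed
  then show ?thesis using code_at_append[of P pc "[x]" cs] by auto
qed

definition steps :: "ram_instr list \<Rightarrow> ram_config \<Rightarrow> nat \<Rightarrow> ram_config \<Rightarrow> bool" where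
  "steps P a n b \<longleftrightarrow> (ram_step P ^^ n) a = b"

lemma steps_0: "steps P a 0 a"
  by (simp add: steps_def)

lemma steps_trans: "steps P a n b \<Longrightarrow> steps P b m d \<Longrightarrow> steps P a (n + m) d"
  using funpow_add[of m n "ram_step P"] by (simp add: steps_def add.commute)

lemma steps_Suc:
  "pc < length P \<Longrightarrow> steps P (ram_exec (P ! pc) (pc, X, inp)) n b \<Longrightarrow> steps P (pc, X, inp) (Suc n) b"
  by (simp add: steps_def funpow_Suc_right ram_step_def ram_halted_def del: funpow.simps)

definition rel :: "st \<Rightarrow> (nat \<Rightarrow> int) \<Rightarrow> bool" where
  "rel s Y \<longleftrightarrow> (\<forall>i<32. Y i = fst s i) \<and> (\<forall>a<16. \<forall>e. Y (64 + 16 * e + a) = fst (snd s) a e)"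

lemma rel_scratch [simp]: "rel s (Y(33 := v)) = rel s Y" "rel s (Y(32 := v)) = rel s Y"
  by (auto simp: rel_def)

lemma rel_scalar: "rel (X, H, inp) Y \<Longrightarrow> i < 32 \<Longrightarrow> rel (X(i := v), H, inp') (Y(i := v))"
  by (auto simp: rel_def)

lemma steps_addr_code:
  assumes "code_at P pc (addr_code pc j a)" "j < 32"
  shows "\<exists>v. steps P (pc, Y, inp) 10
    (pc + 11, Y(33 := v, 32 := 64 + 16 * int (nat (Y j)) + int a), inp)"
proof (cases "Y j > 0")
  case True
  with assms show ?thesis unfolding addr_code_def
    by (intro exI[of _ "64 + int a"])
      (auto simp: code_at_Cons eval_nat_numeral fun_upd_twist intro!: steps_Suc,
       simp add: steps_def fun_eq_iff)
next
  case False
  with assms show ?thesis unfolding addr_code_def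
    by (intro exI[of _ "64 + int a"])
      (auto simp: code_at_Cons eval_nat_numeral fun_upd_twist intro!: steps_Suc,
       simp add: steps_def fun_eq_iff)
qed

lemma nat_arr_address: "nat (64 + 16 * int e + int a) = 64 + 16 * e + a"
  by (simp add: nat_add_distrib nat_mult_distrib)

lemma arr_address_inj:
  assumes "a < 16" "b < 16"
  shows "(16 * e + a = 16 * d + b) \<longleftrightarrow> (e = d \<and> a = (b::nat))"
proof
  assume *: "16 * e + a = 16 * d + b"
  have "(16 * e + a) div 16 = e" "(16 * d + b) div 16 = d" using assms by auto
  with * show "e = d \<and> a = b" by simp
qed simp

lemma steps_op:
  assumes "code_at P pc (op_comp pc a)" "op_wf a" "rel (X, H, inp) Y"
    and "op_ev a (X, H, inp) = (X', H', inp')"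
  shows "\<exists>Y'. steps P (pc, Y, inp) (op_cost a) (pc + op_size a, Y', inp') \<and> rel (X', H', inp') Y'"
proof (cases a)
  case (OLoad i b j)
  with assms(1,2) have code: "code_at P pc (addr_code pc j b)" "code_at P (pc + 11) [Load i 32]"
    and wf: "i < 32" "b < 16" "j < 32"
    by auto
  from steps_addr_code[OF code(1) wf(3)] obtain v where
    st: "steps P (pc, Y, inp) 10 (pc + 11, Y(33 := v, 32 := 64 + 16 * int (nat (Y j)) + int b), inp)"
    (is "steps P _ _ (_, ?Y, _)") by blast
  have Yj: "Y j = X j" using assms(3) wf by (auto simp: rel_def)
  have "nat (?Y 32) = 64 + 16 * nat (X j) + b"
    by (simp only: fun_upd_same Yj nat_arr_address)
  then have val: "?Y (nat (?Y 32)) = H b (nat (X j))"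
    using assms(3) wf by (auto simp only: rel_def) (simp add: rel_def)
  have "steps P (pc + 11, ?Y, inp) 1 (pc + 12, ?Y(i := H b (nat (X j))), inp)"
    using code(2) val by (auto simp: code_at_Cons steps_def ram_step_def ram_halted_def)
  from steps_trans[OF st this] show ?thesis
    using OLoad assms(4) wf rel_scalar[of X H inp ?Y i] assms(3) by auto
next
  case (OStore b j i)
  with assms(1,2) have code: "code_at P pc (addr_code pc j b)" "code_at P (pc + 11) [Store 32 i]"
    and wf: "i < 32" "b < 16" "j < 32"
    by auto
  from steps_addr_code[OF code(1) wf(3)] obtain v where
    st: "steps P (pc, Y, inp) 10 (pc + 11, Y(33 := v, 32 := 64 + 16 * int (nat (Y j)) + int b), inp)"
    (is "steps P _ _ (_, ?Y, _)") by blast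
  have Yj: "Y j = X j" and vi: "?Y i = X i" using assms(3) wf by (auto simp: rel_def)
  have ad: "nat (?Y 32) = 64 + 16 * nat (X j) + b"
    by (simp only: fun_upd_same Yj nat_arr_address)
  have *: "steps P (pc + 11, ?Y, inp) 1 (pc + 12, ?Y(64 + 16 * nat (X j) + b := X i), inp)"
    using code(2) ad vi by (auto simp: code_at_Cons steps_def ram_step_def ram_halted_def)
  have "rel (X, H, inp) ?Y" using assms(3) by simp
  then have "rel (X, H(b := (H b)(nat (X j) := X i)), inp) (?Y(64 + 16 * nat (X j) + b := X i))"
    using wf unfolding rel_def by (auto simp: arr_address_inj)
  with steps_trans[OF st *] show ?thesis
    using OStore assms(4) by auto
next
  case (ORead i)
  with assms show ?thesis
    by (cases inp) (auto simp: code_at_Cons steps_def ram_step_def ram_halted_def intro: rel_scalar)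
qed (use assms in \<open>auto simp: code_at_Cons steps_def ram_step_def ram_halted_def rel_def\<close>)

lemma steps_jump:
  assumes "code_at P pc [Const 33 1, JumpPos 33 l]"
  shows "steps P (pc, Y, inp) 2 (l, Y(33 := 1), inp)"
  using assms by (auto simp: code_at_Cons steps_def ram_step_def ram_halted_def numeral_2_eq_2)

lemma steps_branch:
  assumes "code_at P pc [JumpPos i l]"
  shows "steps P (pc, Y, inp) 1 (if Y i > 0 then l else pc + 1, Y, inp)"
  using assms by (auto simp: code_at_Cons steps_def ram_step_def ram_halted_def)

text \<open>The induction follows the derivation, not the program, because one more round of a loop
  executes the same code at the same \<open>pc\<close> again; only the contents \<open>Y\<close> of
  the registers change.\<close>

lemma comp_com_correct:
  assumes "big_step c s n s'" "com_wf c" "code_at P pc (comp_com pc c)" "rel s Y"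
  shows "\<exists>Y'. steps P (pc, Y, snd (snd s)) n (pc + com_size c, Y', snd (snd s')) \<and> rel s' Y'"
  using assms
proof (induction c s n s' arbitrary: pc Y rule: big_step.induct)
  case (Skip s)
  then show ?case by (auto intro: steps_0)
next
  case (Op a s)
  then show ?case
    using steps_op[of P pc a "fst s" "fst (snd s)" "snd (snd s)" Y] 
    by (cases "op_ev a s") auto
next
  case (Seq c1 s n1 s' c2 n2 s'')
  then obtain Y' where "steps P (pc, Y, snd (snd s)) n1 (pc + com_size c1, Y', snd (snd s'))" "rel s' Y'"
    by fastforce
  moreover from Seq obtain Y'' where
    "steps P (pc + com_size c1, Y', snd (snd s')) n2 (pc + com_size c1 + com_size c2, Y'', snd (snd s''))"
    "rel s'' Y''" using calculation by fastforce
  ultimately show ?case using steps_trans by (metis add.assoc com_size.simps(3))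
next
  case (IfT s i c1 n s' c2)
  have code: "code_at P pc [JumpPos i (pc + 3 + com_size c2)]"
    "code_at P (pc + 3 + com_size c2) (comp_com (pc + 3 + com_size c2) c1)"
    using IfT.prems by (auto simp: code_at_Cons eval_nat_numeral)
  have "Y i > 0" using IfT.prems IfT.hyps by (auto simp: rel_def)
  with steps_branch[OF code(1)] have
    st: "steps P (pc, Y, snd (snd s)) 1 (pc + 3 + com_size c2, Y, snd (snd s))" by presburger
  obtain Y' where "steps P (pc + 3 + com_size c2, Y, snd (snd s)) n
      (pc + 3 + com_size c2 + com_size c1, Y', snd (snd s'))" "rel s' Y'"
    using IfT.IH[OF _ code(2)] IfT.prems by auto
  with steps_trans[OF st this(1)] show ?case by (auto simp: add.assoc)
next
  case (IfF s i c2 n s' c1)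
  have code: "code_at P pc [JumpPos i (pc + 3 + com_size c2)]"
    "code_at P (pc + 1) (comp_com (pc + 1) c2)"
    "code_at P (pc + 1 + com_size c2) [Const 33 1, JumpPos 33 (pc + 3 + com_size c2 + com_size c1)]"
    using IfF.prems by (auto simp: code_at_Cons eval_nat_numeral)
  have "\<not> Y i > 0" using IfF.prems IfF.hyps by (auto simp: rel_def)
  with steps_branch[OF code(1)] have
    st: "steps P (pc, Y, snd (snd s)) 1 (pc + 1, Y, snd (snd s))" by presburger
  obtain Y' where "steps P (pc + 1, Y, snd (snd s)) n
      (pc + 1 + com_size c2, Y', snd (snd s'))" "rel s' Y'"
    using IfF.IH[OF _ code(2)] IfF.prems by auto
  with steps_trans[OF st steps_trans[OF this(1) steps_jump[OF code(3)]]]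
  have "steps P (pc, Y, snd (snd s)) (1 + (n + 2))
      (pc + com_size (IfPos i c1 c2), Y'(33 := 1), snd (snd s'))" "rel s' (Y'(33 := 1))"
    by (simp_all add: add.assoc)
  then show ?case by blast
next
  case (WhileT s i c n1 s' n2 s'')
  have code: "code_at P pc [JumpPos i (pc + 3)]"
    "code_at P (pc + 3) (comp_com (pc + 3) c)"
    "code_at P (pc + 3 + com_size c) [Const 33 1, JumpPos 33 pc]"
    using WhileT.prems by (auto simp: code_at_Cons eval_nat_numeral)
  have "Y i > 0" using WhileT.prems WhileT.hyps by (auto simp: rel_def)
  with steps_branch[OF code(1)] have
    st: "steps P (pc, Y, snd (snd s)) 1 (pc + 3, Y, snd (snd s))" by presburger
  obtain Y' where Y': "steps P (pc + 3, Y, snd (snd s)) n1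
      (pc + 3 + com_size c, Y', snd (snd s'))" "rel s' Y'"
    using WhileT.IH(1)[OF _ code(2)] WhileT.prems by auto
  have "rel s' (Y'(33 := 1))" using Y' by simp
  from WhileT.IH(2)[OF WhileT.prems(1,2) this] obtain Y'' where
    Y'': "steps P (pc, Y'(33 := 1), snd (snd s')) n2
      (pc + com_size (WhilePos i c), Y'', snd (snd s''))" "rel s'' Y''"
    by blast
  from steps_trans[OF st steps_trans[OF Y'(1) steps_trans[OF steps_jump[OF code(3)] Y''(1)]]] Y''(2)
  show ?case by auto
next
  case (WhileF s i c)
  have code: "code_at P pc [JumpPos i (pc + 3)]"
    "code_at P (pc + 1) [Const 33 1, JumpPos 33 (pc + 5 + com_size c)]"
    using WhileF.prems by (auto simp: code_at_Cons eval_nat_numeral)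
  have "\<not> Y i > 0" using WhileF.prems WhileF.hyps by (auto simp: rel_def)
  with steps_branch[OF code(1)] have
    st: "steps P (pc, Y, snd (snd s)) 1 (pc + 1, Y, snd (snd s))" by presburger
  from steps_trans[OF st steps_jump[OF code(2)]] WhileF.prems(3)
  have "steps P (pc, Y, snd (snd s)) (1 + 2)
      (pc + com_size (WhilePos i c), Y(33 := 1), snd (snd s))" "rel s (Y(33 := 1))"
    by (simp_all add: add.assoc)
  then show ?case by blast
qed

lemma ram_step_halted: "ram_halted P s \<Longrightarrow> (ram_step P ^^ n) s = s"
  by (induction n) (auto simp: ram_step_def)

definition init_st :: "int list \<Rightarrow> st" where
  "init_st inp = ((\<lambda>_. 0), (\<lambda>_ _. 0), inp)"

theorem ram_of_big_step:
  assumes "big_step c (init_st inp) n s" "com_wf c"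
  shows "ram_terminates (comp_com 0 c) inp" "ram_time (comp_com 0 c) inp \<le> n"
    "ram_result (comp_com 0 c) inp = fst s 0"
proof -
  let ?P = "comp_com 0 c"
  have "code_at ?P 0 ?P" by (auto simp: code_at_def)
  moreover have "rel (init_st inp) (\<lambda>_. 0)" by (auto simp: rel_def init_st_def)
  ultimately obtain Y where Y: "steps ?P (0, \<lambda>_. 0, inp) n (com_size c, Y, snd (snd s))" "rel s Y"
    using comp_com_correct[OF assms, of ?P 0 "\<lambda>_. 0"] by (auto simp: init_st_def)
  then have run: "ram_run ?P inp n = (com_size c, Y, snd (snd s))"
    by (simp add: ram_run_def steps_def)
  then have h: "ram_halted ?P (ram_run ?P inp n)" by (simp add: ram_halted_def)
  then show "ram_terminates ?P inp" by (auto simp: ram_terminates_def)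
  show le: "ram_time ?P inp \<le> n" unfolding ram_time_def by (rule Least_le) (rule h)
  \<comment> \<open>The least halting time may be smaller than \<open>n\<close>, but a halted
    configuration is a fixed point, so the results at both times agree.\<close>
  have h2: "ram_halted ?P (ram_run ?P inp (ram_time ?P inp))"
    unfolding ram_time_def by (rule LeastI) (rule h)
  have "ram_run ?P inp n = (ram_step ?P ^^ (n - ram_time ?P inp)) (ram_run ?P inp (ram_time ?P inp))"
    using funpow_add[of "n - ram_time ?P inp" "ram_time ?P inp" "ram_step ?P"] le
    by (simp add: ram_run_def)
  then have "ram_run ?P inp n = ram_run ?P inp (ram_time ?P inp)"
    using ram_step_halted[OF h2] by simp
  with run Y(2) show "ram_result ?P inp = fst s 0"
    by (auto simp: ram_result_def rel_def)
qed

section \<open>Loop-free programs and timed triples\<close>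

fun straight :: "com \<Rightarrow> bool" where
  "straight (c1 ;; c2) \<longleftrightarrow> straight c1 \<and> straight c2"
| "straight (IfPos i c1 c2) \<longleftrightarrow> straight c1 \<and> straight c2"
| "straight (WhilePos i c) \<longleftrightarrow> False"
| "straight _ \<longleftrightarrow> True"

text \<open>The loop clause is a dummy value; \<open>ev\<close> is the semantics of
  \<open>straight\<close> programs, in a form that the simplifier can compute.\<close>

fun ev :: "com \<Rightarrow> st \<Rightarrow> st" where
  "ev Skip s = s"
| "ev (Op a) s = op_ev a s"
| "ev (c1 ;; c2) s = ev c2 (ev c1 s)"
| "ev (IfPos i c1 c2) s = (if fst s i > 0 then ev c1 s else ev c2 s)"
| "ev (WhilePos i c) s = s"

text \<open>Adding the times of both branches is a crude substitute for their maximum, good enough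
  since all these bounds are constants depending on \<open>c\<close>.\<close>

fun max_time :: "com \<Rightarrow> nat" where
  "max_time Skip = 0"
| "max_time (Op a) = op_cost a"
| "max_time (c1 ;; c2) = max_time c1 + max_time c2"
| "max_time (IfPos i c1 c2) = max_time c1 + max_time c2 + 3"
| "max_time (WhilePos i c) = 0"

lemma big_step_straight: "straight c \<Longrightarrow> \<exists>n\<le>max_time c. big_step c s n (ev c s)"
proof (induction c arbitrary: s)
  case (Seq c1 c2)
  then obtain n1 n2 where "n1 \<le> max_time c1" "big_step c1 s n1 (ev c1 s)"
    "n2 \<le> max_time c2" "big_step c2 (ev c1 s) n2 (ev c2 (ev c1 s))" by (meson straight.simps(1))
  then show ?case
    by (intro exI[of _ "n1 + n2"]) (auto intro: big_step.Seq)
next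
  case (IfPos i c1 c2)
  then obtain n1 n2 where *: "n1 \<le> max_time c1" "big_step c1 s n1 (ev c1 s)"
    "n2 \<le> max_time c2" "big_step c2 s n2 (ev c2 s)" by (meson straight.simps(2))
  show ?case
  proof (cases "fst s i > 0")
    case True
    with * show ?thesis by (intro exI[of _ "1 + n1"]) (auto simp: IfT[of s, simplified])
  next
    case False
    with * show ?thesis by (intro exI[of _ "1 + (n2 + 2)"]) (auto intro!: IfF[of s, simplified])
  qed
qed (auto intro: big_step.intros)

definition runs :: "com \<Rightarrow> st \<Rightarrow> nat \<Rightarrow> (st \<Rightarrow> bool) \<Rightarrow> bool" where
  "runs c s t Q \<longleftrightarrow> (\<exists>n s'. big_step c s n s' \<and> n \<le> t \<and> Q s')"

lemma runs_straight: "straight c \<Longrightarrow> Q (ev c s) \<Longrightarrow> max_time c \<le> t \<Longrightarrow> runs c s t Q"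
  unfolding runs_def using big_step_straight[of c s] le_trans by blast

lemma runs_mono: "runs c s t Q \<Longrightarrow> t \<le> t' \<Longrightarrow> (\<And>s'. Q s' \<Longrightarrow> Q' s') \<Longrightarrow> runs c s t' Q'"
  unfolding runs_def using le_trans by blast

lemma runs_Seq:
  assumes "runs c1 s t1 Q" "\<And>s'. Q s' \<Longrightarrow> runs c2 s' t2 R"
  shows "runs (c1 ;; c2) s (t1 + t2) R"
proof -
  from assms(1) obtain n1 s1 where 1: "big_step c1 s n1 s1" "n1 \<le> t1" "Q s1"
    unfolding runs_def by blast
  from assms(2)[OF 1(3)] obtain n2 s2 where 2: "big_step c2 s1 n2 s2" "n2 \<le> t2" "R s2"
    unfolding runs_def by blast
  from big_step.Seq[OF 1(1) 2(1)] 1(2) 2(2,3) show ?thesis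
    unfolding runs_def by (intro exI[of _ "n1 + n2"] exI[of _ s2]) auto
qed

lemma runs_Seq_straight:
  "straight c1 \<Longrightarrow> runs c2 (ev c1 s) t G \<Longrightarrow> runs (c1 ;; c2) s (max_time c1 + t) G"
  by (rule runs_Seq[OF runs_straight[where Q = "\<lambda>s'. s' = ev c1 s"]]) simp_all

lemma runs_IfPos:
  assumes "fst s i > 0 \<Longrightarrow> runs c1 s t Q" "\<not> fst s i > 0 \<Longrightarrow> runs c2 s t Q"
  shows "runs (IfPos i c1 c2) s (t + 3) Q"
proof (cases "fst s i > 0")
  case True
  with assms(1) obtain n s' where "big_step c1 s n s'" "n \<le> t" "Q s'" by (auto simp: runs_def)
  with IfT[OF True this(1)] show ?thesis unfolding runs_def
    by (intro exI[of _ "1 + n"] exI[of _ s']) auto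
next
  case False
  with assms(2) obtain n s' where "big_step c2 s n s'" "n \<le> t" "Q s'" by (auto simp: runs_def)
  with IfF[OF False this(1)] show ?thesis unfolding runs_def
    by (intro exI[of _ "1 + (n + 2)"] exI[of _ s']) auto
qed

text \<open>Here \<open>n\<close> is the exact number of iterations and \<open>I i\<close> the
  invariant after \<open>i\<close> of them. The overhead of 3 is one test and the two instructions
  of a jump.\<close>

lemma runs_WhilePos:
  assumes "\<And>i s. i < n \<Longrightarrow> I i s \<Longrightarrow> fst s x > 0 \<and> runs c s t (I (Suc i))"
    and "\<And>s. I n s \<Longrightarrow> \<not> fst s x > 0"
    and "I 0 s"
  shows "runs (WhilePos x c) s (n * (t + 3) + 3) (I n)"
proof -
  have "runs (WhilePos x c) s ((n - i) * (t + 3) + 3) (I n)" if "i \<le> n" "I i s" for i s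
    using that
  proof (induction "n - i" arbitrary: i s)
    case 0
    with assms(2) have "I n s" "\<not> fst s x > 0" by auto
    with WhileF[OF this(2)] show ?case using 0 unfolding runs_def
      by (intro exI[of _ "1 + 2"] exI[of _ s]) auto
  next
    case (Suc d)
    then have "i < n" by simp
    with assms(1) Suc.prems obtain n1 s1 where 1: "fst s x > 0" "big_step c s n1 s1" "n1 \<le> t" "I (Suc i) s1"
      unfolding runs_def by meson
    have d: "d = n - Suc i" using Suc.hyps(2) by simp
    from Suc.hyps(1)[OF d _ 1(4)] \<open>i < n\<close> obtain n2 s2 where
      2: "big_step (WhilePos x c) s1 n2 s2" "n2 \<le> (n - Suc i) * (t + 3) + 3" "I n s2"
      unfolding runs_def d by (auto simp del: split_paired_Ex)
    have "n - i = Suc (n - Suc i)" using \<open>i < n\<close> by simp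
    then have "1 + (n1 + (2 + n2)) \<le> (n - i) * (t + 3) + 3" using 1 2 by simp
    with WhileT[OF 1(1,2) 2(1)] 2(3) show ?case unfolding runs_def by blast
  qed
  from this[of 0 s] assms(3) show ?thesis by simp
qed

primrec seq_list :: "com list \<Rightarrow> com" where
  "seq_list [] = Skip"
| "seq_list (c # cs) = c ;; seq_list cs"

lemma straight_seq_list [simp]: "straight (seq_list cs) \<longleftrightarrow> (\<forall>c\<in>set cs. straight c)"
  by (induction cs) auto

lemma com_wf_seq_list [simp]: "com_wf (seq_list cs) \<longleftrightarrow> (\<forall>c\<in>set cs. com_wf c)"
  by (induction cs) auto

section \<open>Fourier analysis on the cube\<close>

definition chi :: "'a set \<Rightarrow> ('a \<Rightarrow> int) \<Rightarrow> int" where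
  "chi S x = (\<Prod>u\<in>S. x u)"

abbreviation cube :: "'a set \<Rightarrow> ('a \<Rightarrow> int) set" where
  "cube V \<equiv> V \<rightarrow>\<^sub>E {-1, 1}"

lemma finite_cube [simp]: "finite V \<Longrightarrow> finite (cube V)"
  by (simp add: finite_PiE)

lemma card_cube: "finite V \<Longrightarrow> card (cube V) = 2 ^ card V"
  by (simp add: card_PiE numeral_2_eq_2)

lemma cube_nonempty: "cube V \<noteq> {}"
  by (simp add: PiE_eq_empty_iff)

lemma cubeD: "x \<in> cube V \<Longrightarrow> u \<in> V \<Longrightarrow> x u = -1 \<or> x u = 1"
  by auto

text \<open>Flipping the value at \<open>v\<close> is an involution of the cube. Every cancellation
  in this section comes down to the choice of a suitable \<open>v\<close>.\<close>

lemma sum_cube_eq_0: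
  assumes "v \<in> V" "\<And>x. x \<in> cube V \<Longrightarrow> h (x(v := - x v)) = - h x"
  shows "(\<Sum>x\<in>cube V. h x) = (0::int)"
proof -
  have "bij_betw (\<lambda>x. x(v := - x v)) (cube V) (cube V)"
  proof (rule bij_betwI[where g = "\<lambda>x. x(v := - x v)"])
    show "(\<lambda>x. x(v := - x v)) \<in> cube V \<rightarrow> cube V"
      using assms(1) by (fastforce simp: PiE_iff extensional_def)
    then show "(\<lambda>x. x(v := - x v)) \<in> cube V \<rightarrow> cube V" .
  qed auto
  then have "(\<Sum>x\<in>cube V. h x) = (\<Sum>x\<in>cube V. h (x(v := - x v)))"
    by (rule sum.reindex_bij_betw[symmetric])
  also have "\<dots> = - (\<Sum>x\<in>cube V. h x)"
    by (simp add: assms(2) sum_negf)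
  finally show ?thesis by simp
qed

lemma chi_flip:
  assumes "finite S"
  shows "chi S (x(v := - x v)) = (if v \<in> S then - chi S x else chi S x)"
proof (cases "v \<in> S")
  case True
  have "(\<Prod>u\<in>S - {v}. (x(v := - x v)) u) = (\<Prod>u\<in>S - {v}. x u)" by (rule prod.cong) auto
  with True show ?thesis by (simp add: chi_def prod.remove[OF assms True])
next
  case False
  then show ?thesis by (auto simp: chi_def intro!: prod.cong)
qed

lemma chi_cube:
  assumes "S \<subseteq> V" "x \<in> cube V"
  shows "chi S x = -1 \<or> chi S x = 1"
proof (cases "finite S")
  case True
  then show ?thesis using assms
  proof (induction S)
    case (insert u S)
    then show ?case using cubeD[of x V u] by (auto simp: chi_def)
  qed (simp add: chi_def)
qed (simp add: chi_def)

lemma chi_sq: "S \<subseteq> V \<Longrightarrow> x \<in> cube V \<Longrightarrow> chi S x * chi S x = 1"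
  using chi_cube[of S V x] by auto

lemma chi_Un: "finite S \<Longrightarrow> finite T \<Longrightarrow> S \<inter> T = {} \<Longrightarrow> chi (S \<union> T) x = chi S x * chi T x"
  by (simp add: chi_def prod.union_disjoint)

lemma chi_depends: "(\<And>u. u \<in> S \<Longrightarrow> x u = y u) \<Longrightarrow> chi S x = chi S y"
  by (auto simp: chi_def intro: prod.cong)

lemma sum_chi_mult:
  assumes "finite V" "S \<subseteq> V" "T \<subseteq> V"
  shows "(\<Sum>x\<in>cube V. chi S x * chi T x) = (if S = T then 2 ^ card V else 0)"
proof (cases "S = T")
  case True
  then show ?thesis using assms by (simp add: chi_sq card_cube)
next
  case False
  have fin: "finite S" "finite T" using assms finite_subset by auto
  from False obtain v where v: "v \<in> V" "(v \<in> S) \<noteq> (v \<in> T)" using assms by auto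
  show ?thesis using False
    using v(2) by (auto intro!: sum_cube_eq_0[OF v(1)] simp: chi_flip fin)
qed

lemma sum_chi:
  assumes "finite V" "S \<subseteq> V"
  shows "(\<Sum>x\<in>cube V. chi S x) = (if S = {} then 2 ^ card V else 0)"
  using sum_chi_mult[OF assms, of "{}"] by (simp add: chi_def)

section \<open>The biased density and the expectation under it\<close>

locale fourier =
  fixes V :: "'a set" and F :: "'a set set" and ph :: "'a set \<Rightarrow> int" and A :: "'a set" and s :: nat
  assumes finV: "finite V" and FV: "\<And>S. S \<in> F \<Longrightarrow> S \<subseteq> V"
    and s_pos: "s > 0"
    and bounded: "\<And>S. S \<in> F \<Longrightarrow> ph S \<noteq> 0 \<Longrightarrow> card (S - A) \<le> s"
begin

definition P :: "('a \<Rightarrow> int) \<Rightarrow> int" where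
  "P x = (\<Sum>S\<in>F. ph S * chi S x)"

definition q :: "'a set \<Rightarrow> ('a \<Rightarrow> int) \<Rightarrow> int" where
  "q T x = (\<Sum>S\<in>{S\<in>F. S - A = T}. ph S * chi (S \<inter> A) x)"

definition block :: "'a set \<Rightarrow> bool" where
  "block T \<longleftrightarrow> card T = s \<and> T \<inter> A = {} \<and> (\<exists>S\<in>F. ph S \<noteq> 0 \<and> S - A = T)"

text \<open>Up to the factor \<open>2 ^ card V\<close>, the density that biases each block \<open>T\<close> towards the sign
  of its coefficient, once the variables in \<open>A\<close> are fixed.\<close>

fun density :: "'a set list \<Rightarrow> ('a \<Rightarrow> int) \<Rightarrow> int" where
  "density [] x = 1"
| "density (T # Ts) x = (1 + sgn (q T x) * chi T x) * density Ts x"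

lemma finF: "finite F"
  using finV FV by (meson Pow_iff finite_Pow_iff finite_subset subsetI)

lemma finS: "S \<in> F \<Longrightarrow> finite S"
  using finV FV finite_subset by blast

lemma q_flip: "v \<notin> A \<Longrightarrow> q T (x(v := - x v)) = q T x"
  by (auto simp: q_def chi_flip finS intro!: sum.cong)

lemma blockD:
  assumes "block T"
  shows "T \<subseteq> V" "finite T" "T \<noteq> {}" "T \<inter> A = {}"
  using assms FV finS s_pos by (auto simp: block_def)

lemma density_flip:
  assumes "v \<notin> A" "\<forall>T\<in>set Ts. block T \<and> v \<notin> T"
  shows "density Ts (x(v := - x v)) = density Ts x"
  using assms(2) by (induction Ts) (auto simp: q_flip assms(1) chi_flip blockD)

lemma density_nonneg: "x \<in> cube V \<Longrightarrow> \<forall>T\<in>set Ts. block T \<Longrightarrow> density Ts x \<ge> 0"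
proof (induction Ts)
  case (Cons T Ts)
  have "1 + sgn (q T x) * chi T x \<ge> 0"
    using chi_cube[of T V x] Cons.prems blockD(1)[of T] by (auto simp: sgn_if)
  with Cons show ?case by simp
qed simp

text \<open>The density leaves the variables in \<open>A\<close> uniformly distributed. The extra
  term of each factor vanishes by flipping a variable of its block: it lies outside \<open>A\<close>
  and in no other block, so only the character of the block changes sign.\<close>

lemma sum_density:
  assumes "\<forall>T\<in>set Ts. block T" "pairwise disjnt (set Ts)" "distinct Ts"
    and g: "\<And>x v. v \<notin> A \<Longrightarrow> g (x(v := - x v)) = g x"
  shows "(\<Sum>x\<in>cube V. g x * density Ts x) = (\<Sum>x\<in>cube V. g x)"
  using assms(1-3)
proof (induction Ts)
  case (Cons T Ts)
  from Cons.prems have bT: "block T" by simp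
  then obtain v where v: "v \<in> T" "v \<in> V" "v \<notin> A" using blockD[of T] by blast
  have "\<forall>T'\<in>set Ts. block T' \<and> v \<notin> T'"
    using Cons.prems v(1) by (auto simp: pairwise_def disjnt_def)
  note fl = density_flip[OF v(3) this]
  have "(\<Sum>x\<in>cube V. g x * (sgn (q T x) * chi T x) * density Ts x) = 0"
    using v bT by (intro sum_cube_eq_0[OF v(2)]) (simp add: g fl q_flip chi_flip blockD)
  moreover have "(\<Sum>x\<in>cube V. g x * density Ts x) = (\<Sum>x\<in>cube V. g x)"
    using Cons by (simp add: pairwise_insert)
  ultimately show ?case
    by (simp add: algebra_simps sum.distrib)
qed simp

text \<open>Correlating \<open>q T\<close> with the character of \<open>S \<inter> A\<close>, for
  one witness \<open>S\<close> of the block, extracts \<open>ph S\<close>, because different sets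
  with the same part outside \<open>A\<close> differ inside \<open>A\<close>. The correlation bounds
  the sum of absolute values from below, and a nonzero integer has modulus at least 1.\<close>

lemma sum_abs_q:
  assumes "block T"
  shows "(\<Sum>x\<in>cube V. \<bar>q T x\<bar>) \<ge> 2 ^ card V"
proof -
  from assms obtain S where S: "S \<in> F" "ph S \<noteq> 0" "S - A = T" by (auto simp: block_def)
  have sub: "S' \<inter> A \<subseteq> V" if "S' \<in> F" for S' using FV that by blast
  have "(\<Sum>x\<in>cube V. q T x * chi (S \<inter> A) x)
      = (\<Sum>S'\<in>{S\<in>F. S - A = T}. ph S' * (\<Sum>x\<in>cube V. chi (S' \<inter> A) x * chi (S \<inter> A) x))"
    unfolding q_def sum_distrib_right sum_distrib_left by (subst sum.swap) (simp add: mult_ac)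
  also have "\<dots> = (\<Sum>S'\<in>{S\<in>F. S - A = T}. if S' = S then ph S' * 2 ^ card V else 0)"
  proof (rule sum.cong[OF refl])
    fix S' assume "S' \<in> {S \<in> F. S - A = T}"
    then show "ph S' * (\<Sum>x\<in>cube V. chi (S' \<inter> A) x * chi (S \<inter> A) x)
        = (if S' = S then ph S' * 2 ^ card V else 0)"
      using sum_chi_mult[OF finV sub sub, of S' S] S by auto
  qed
  also have "\<dots> = ph S * 2 ^ card V"
    using S finF by (subst sum.delta) auto
  finally have "\<bar>ph S\<bar> * 2 ^ card V = \<bar>\<Sum>x\<in>cube V. q T x * chi (S \<inter> A) x\<bar>"
    by (simp add: abs_mult)
  also have "\<dots> \<le> (\<Sum>x\<in>cube V. \<bar>q T x * chi (S \<inter> A) x\<bar>)" by (rule sum_abs)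
  also have "\<dots> = (\<Sum>x\<in>cube V. \<bar>q T x\<bar>)"
  proof (rule sum.cong[OF refl])
    fix x assume "x \<in> cube V"
    then show "\<bar>q T x * chi (S \<inter> A) x\<bar> = \<bar>q T x\<bar>"
      using chi_cube[OF sub[OF S(1)], of x] by (auto simp: abs_mult)
  qed
  finally have "\<bar>ph S\<bar> * 2 ^ card V \<le> (\<Sum>x\<in>cube V. \<bar>q T x\<bar>)" .
  moreover have "1 * 2 ^ card V \<le> \<bar>ph S\<bar> * 2 ^ card V"
    using S(2) by (intro mult_right_mono) auto
  ultimately show ?thesis by linarith
qed

text \<open>In the extra term of the factor of \<open>T\<close>, a monomial survives only if it
  contains \<open>T\<close>; otherwise a variable of \<open>T\<close> that it misses can be flipped.
  The survivors are the monomials that make up \<open>q T\<close>, and the sign in the density turns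
  their sum into \<open>\<bar>q T x\<bar>\<close>.\<close>

lemma sum_P_density:
  assumes "\<forall>T\<in>set Ts. block T" "pairwise disjnt (set Ts)" "distinct Ts"
  shows "(\<Sum>x\<in>cube V. P x * density Ts x) = (\<Sum>x\<in>cube V. P x) + (\<Sum>T\<leftarrow>Ts. \<Sum>x\<in>cube V. \<bar>q T x\<bar>)"
  using assms
proof (induction Ts)
  case (Cons T Ts)
  from Cons.prems have bT: "block T" by simp
  have Ts: "\<forall>T\<in>set Ts. block T" "pairwise disjnt (set Ts)" "distinct Ts"
    using Cons.prems by (auto simp: pairwise_insert)
  have vD: "\<forall>T'\<in>set Ts. block T' \<and> v \<notin> T'" if "v \<in> T" for v
    using Cons.prems that by (auto simp: pairwise_def disjnt_def)
  have trm: "ph S * (\<Sum>x\<in>cube V. chi S x * (sgn (q T x) * chi T x) * density Ts x)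
      = (if S - A = T then ph S * (\<Sum>x\<in>cube V. chi (S \<inter> A) x * sgn (q T x)) else 0)"
    if S: "S \<in> F" for S
  proof (cases "ph S = 0 \<or> T \<subseteq> S")
    case False
    then obtain v where v: "v \<in> T" "v \<notin> S" by blast
    then have "v \<in> V" "v \<notin> A" using blockD[OF bT] by auto
    have "(\<Sum>x\<in>cube V. chi S x * (sgn (q T x) * chi T x) * density Ts x) = 0"
      using v bT S \<open>v \<notin> A\<close>
      by (intro sum_cube_eq_0[OF \<open>v \<in> V\<close>])
        (simp add: density_flip[OF \<open>v \<notin> A\<close> vD] q_flip chi_flip blockD finS)
    with v show ?thesis by auto
  next
    case True
    show ?thesis
    proof (cases "ph S = 0")
      case False
      then have "T \<subseteq> S - A" using True blockD[OF bT] by auto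
      \<comment> \<open>Here the bound \<open>s\<close> enters: a monomial that contains
        \<open>T\<close> has no variable outside \<open>A\<close> beyond \<open>T\<close>, hence
        meets no second block.\<close>
      moreover have "card (S - A) \<le> card T" using bounded[OF S False] bT by (simp add: block_def)
      ultimately have T: "S - A = T" using finS[OF S] card_seteq[of "S - A" T] by auto
      have split: "chi S x = chi (S \<inter> A) x * chi T x" for x
        using chi_Un[of "S \<inter> A" "S - A" x] finS[OF S] unfolding T[symmetric]
        by (metis Diff_Diff_Int Diff_disjoint Int_Diff_Un Int_commute finite_Diff finite_Int)
      have "(\<Sum>x\<in>cube V. chi S x * (sgn (q T x) * chi T x) * density Ts x)
          = (\<Sum>x\<in>cube V. (chi (S \<inter> A) x * sgn (q T x)) * density Ts x)"
      proof (rule sum.cong[OF refl])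
        fix x assume "x \<in> cube V"
        then have "chi T x * chi T x = 1" by (rule chi_sq[OF blockD(1)[OF bT]])
        then show "chi S x * (sgn (q T x) * chi T x) * density Ts x
            = (chi (S \<inter> A) x * sgn (q T x)) * density Ts x"
          unfolding split by (metis mult.assoc mult.commute mult_1)
      qed
      \<comment> \<open>The remaining integrand depends on the variables in \<open>A\<close> only,
        so the factors of the other blocks average out.\<close>
      also have "\<dots> = (\<Sum>x\<in>cube V. chi (S \<inter> A) x * sgn (q T x))"
        by (rule sum_density[OF Ts]) (auto simp: chi_flip finS[OF S] q_flip)
      finally show ?thesis using T by simp
    qed simp
  qed
  have "(\<Sum>x\<in>cube V. P x * (sgn (q T x) * chi T x) * density Ts x)
      = (\<Sum>S\<in>F. ph S * (\<Sum>x\<in>cube V. chi S x * (sgn (q T x) * chi T x) * density Ts x))"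
    unfolding P_def sum_distrib_right sum_distrib_left by (subst sum.swap) (simp add: mult_ac)
  also have "\<dots> = (\<Sum>S\<in>F. if S - A = T then ph S * (\<Sum>x\<in>cube V. chi (S \<inter> A) x * sgn (q T x)) else 0)"
    using trm by (intro sum.cong) auto
  also have "\<dots> = (\<Sum>S\<in>{S\<in>F. S - A = T}. ph S * (\<Sum>x\<in>cube V. chi (S \<inter> A) x * sgn (q T x)))"
    using finF by (simp add: sum.If_cases Int_def)
  also have "\<dots> = (\<Sum>x\<in>cube V. q T x * sgn (q T x))"
    unfolding q_def sum_distrib_right sum_distrib_left by (subst sum.swap) (simp add: mult_ac)
  also have "\<dots> = (\<Sum>x\<in>cube V. \<bar>q T x\<bar>)" by (simp add: abs_sgn)
  finally have "(\<Sum>x\<in>cube V. P x * (sgn (q T x) * chi T x) * density Ts x) = (\<Sum>x\<in>cube V. \<bar>q T x\<bar>)" .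
  then show ?case using Cons.IH[OF Ts]
    by (simp add: algebra_simps sum.distrib)
qed simp

text \<open>The density is nonnegative of total mass \<open>2 ^ card V\<close>, so some point
  reaches the weighted mean of \<open>P\<close>. Values are integers, so falling short of it means
  falling short by at least 1.\<close>

theorem exists_above_mean:
  assumes "\<forall>T\<in>set Ts. block T" "pairwise disjnt (set Ts)" "distinct Ts"
    and mean: "(\<Sum>x\<in>cube V. P x) = 2 ^ card V * m"
  shows "\<exists>x\<in>cube V. P x \<ge> m + int (length Ts)"
proof (rule ccontr)
  assume "\<not> ?thesis"
  then have lt: "P x \<le> m + int (length Ts) - 1" if "x \<in> cube V" for x using that by force
  have "2 ^ card V * int (length Ts) \<le> (\<Sum>T\<leftarrow>Ts. \<Sum>x\<in>cube V. \<bar>q T x\<bar>)"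
    using assms(1)
  proof (induction Ts)
    case (Cons T Ts)
    then show ?case using sum_abs_q[of T] by (simp add: algebra_simps)
  qed simp
  then have "2 ^ card V * (m + int (length Ts)) \<le> (\<Sum>x\<in>cube V. P x * density Ts x)"
    unfolding sum_P_density[OF assms(1-3)] mean by (simp add: algebra_simps)
  also have "\<dots> \<le> (\<Sum>x\<in>cube V. (m + int (length Ts) - 1) * density Ts x)"
    using lt density_nonneg assms(1) by (intro sum_mono mult_right_mono) auto
  also have "\<dots> = (m + int (length Ts) - 1) * 2 ^ card V"
    using sum_density[OF assms(1-3), of "\<lambda>_. 1"]
    by (simp add: card_cube finV flip: sum_distrib_left)
  finally show False by (simp add: algebra_simps)
qed

end

section \<open>The polynomial of an instance\<close>

fun chim :: "bool list \<Rightarrow> int list \<Rightarrow> int" where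
  "chim (b # Y) (a # x) = (if b then a else 1) * chim Y x"
| "chim _ _ = 1"

text \<open>A mask selects argument positions, not variables, since a scope may repeat a
  variable.\<close>

definition masks :: "nat \<Rightarrow> bool list list" where
  "masks r = product_lists (replicate r [False, True])"

lemma masks_simps [simp]:
  "masks 0 = [[]]"
  "masks (Suc r) = map ((#) False) (masks r) @ map ((#) True) (masks r)"
  by (simp_all add: masks_def)

lemma sign_vectors_simps [simp]:
  "sign_vectors 0 = [[]]"
  "sign_vectors (Suc r) = map ((#) (-1)) (sign_vectors r) @ map ((#) 1) (sign_vectors r)"
  by (simp_all add: sign_vectors_def)

lemma length_masks [simp]: "length (masks r) = 2 ^ r"
  by (induction r) auto

lemma length_in_masks: "Y \<in> set (masks r) \<Longrightarrow> length Y = r"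
  by (induction r arbitrary: Y) auto

lemma length_sign_vectors [simp]: "length (sign_vectors r) = 2 ^ r"
  by (induction r) auto

lemma distinct_sign_vectors: "distinct (sign_vectors r)"
  by (induction r) (auto simp: distinct_map)

lemma in_sign_vectors: "x \<in> set (sign_vectors r) \<longleftrightarrow> length x = r \<and> set x \<subseteq> {-1, 1}"
proof (induction r arbitrary: x)
  case (Suc r)
  then show ?case by (cases x) auto
qed auto

lemma chim_sign: "set x \<subseteq> {-1, 1} \<Longrightarrow> chim Y x = -1 \<or> chim Y x = 1"
  by (induction Y x rule: chim.induct) auto

text \<open>The dual form of orthogonality, summing over the characters at two fixed points, as
  inversion requires.\<close>

lemma chim_orthogonal:
  assumes "x \<in> set (sign_vectors r)" "z \<in> set (sign_vectors r)"
  shows "(\<Sum>Y\<leftarrow>masks r. chim Y x * chim Y z) = (if x = z then 2 ^ r else 0)"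
  using assms
proof (induction r arbitrary: x z)
  case (Suc r)
  then obtain a x' b z' where x: "x = a # x'" "z = b # z'"
    "x' \<in> set (sign_vectors r)" "z' \<in> set (sign_vectors r)" "a \<in> {-1, 1}" "b \<in> {-1, 1}"
    by auto
  have "(\<Sum>Y\<leftarrow>masks (Suc r). chim Y x * chim Y z)
      = (\<Sum>Y\<leftarrow>masks r. chim Y x' * chim Y z') + (\<Sum>Y\<leftarrow>masks r. (a * b) * (chim Y x' * chim Y z'))"
    by (simp add: x o_def mult_ac)
  also have "\<dots> = (1 + a * b) * (\<Sum>Y\<leftarrow>masks r. chim Y x' * chim Y z')"
    by (simp only: sum_list_const_mult) (simp add: algebra_simps)
  also have "\<dots> = (if x = z then 2 ^ Suc r else 0)"
    unfolding Suc.IH[OF x(3,4)] using x by auto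
  finally show ?case .
qed simp

lemma sum_list_swap:
  "(\<Sum>y\<leftarrow>ys. \<Sum>x\<leftarrow>xs. g x y) = (\<Sum>x\<leftarrow>xs. \<Sum>y\<leftarrow>ys. g x y :: int)"
  by (induction ys) (auto simp: sum_list_addf)

lemma sum_list_delta:
  assumes "distinct xs" "z \<in> set xs"
  shows "(\<Sum>x\<leftarrow>xs. f x * (if x = z then a else 0)) = f z * (a::int)"
proof -
  have "(\<Sum>x\<leftarrow>xs. f x * (if x = z then a else 0)) = (\<Sum>x\<in>set xs. f x * (if x = z then a else 0))"
    by (rule sum_list_distinct_conv_sum_set[OF assms(1)])
  also have "\<dots> = (\<Sum>x\<in>set xs. if x = z then f x * a else 0)"
    by (rule sum.cong) auto
  finally show ?thesis using assms(2) by simp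
qed

text \<open>The transform is left unnormalised, which keeps all coefficients integral at the price
  of the factor \<open>2 ^ r\<close>.\<close>

lemma fourier_inversion:
  assumes "z \<in> set (sign_vectors r)"
  shows "(\<Sum>Y\<leftarrow>masks r. (\<Sum>x\<leftarrow>sign_vectors r. f x * chim Y x) * chim Y z) = f z * 2 ^ r"
proof -
  have "(\<Sum>Y\<leftarrow>masks r. (\<Sum>x\<leftarrow>sign_vectors r. f x * chim Y x) * chim Y z)
      = (\<Sum>Y\<leftarrow>masks r. \<Sum>x\<leftarrow>sign_vectors r. f x * (chim Y x * chim Y z))"
    by (simp add: sum_list_mult_const[symmetric] mult.assoc)
  also have "\<dots> = (\<Sum>x\<leftarrow>sign_vectors r. f x * (\<Sum>Y\<leftarrow>masks r. chim Y x * chim Y z))"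
    by (subst sum_list_swap) (simp add: sum_list_const_mult)
  also have "\<dots> = (\<Sum>x\<leftarrow>sign_vectors r. f x * (if x = z then 2 ^ r else 0))"
    by (rule arg_cong[of _ _ sum_list], rule map_cong[OF refl]) (simp add: chim_orthogonal assms)
  also have "\<dots> = f z * 2 ^ r" by (rule sum_list_delta[OF distinct_sign_vectors assms])
  finally show ?thesis .
qed

section \<open>Repeated variables in a scope\<close>

primrec odds :: "nat list \<Rightarrow> nat set" where
  "odds [] = {}"
| "odds (u # us) = (if u \<in> odds us then odds us - {u} else insert u (odds us))"

lemma odds_subset: "odds us \<subseteq> set us"
  by (induction us) auto

lemma finite_odds [simp]: "finite (odds us)"
  by (induction us) auto

text \<open>Signs square to 1, so exactly the variables of odd multiplicity survive in the
  product.\<close>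

lemma prod_list_odds:
  assumes "\<And>u. u \<in> set us \<Longrightarrow> y u = -1 \<or> y u = (1::int)"
  shows "(\<Prod>u\<leftarrow>us. y u) = chi (odds us) y"
  using assms
proof (induction us)
  case (Cons u us)
  then have IH: "(\<Prod>u\<leftarrow>us. y u) = chi (odds us) y" by simp
  have yy: "y u * y u = 1" using Cons.prems[of u] by auto
  show ?case
  proof (cases "u \<in> odds us")
    case True
    have "chi (odds us) y = y u * chi (odds us - {u}) y"
      unfolding chi_def by (rule prod.remove) (use True in auto)
    then have "y u * chi (odds us) y = (y u * y u) * chi (odds us - {u}) y" by simp
    with True IH yy show ?thesis by simp
  next
    case False
    with IH show ?thesis by (simp add: chi_def)
  qed
qed (simp add: chi_def)

text \<open>Slots that are not selected, and slots cancelled by \<open>x * x = 1\<close>, hold the dummy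
  variable \<open>n\<close>, whose value is 1.\<close>

definition sel :: "nat \<Rightarrow> bool list \<Rightarrow> nat option list" where
  "sel c Y = map (\<lambda>i. if i < length Y \<and> Y ! i then Some i else None) [0..<c]"

definition raw :: "nat \<Rightarrow> nat list \<Rightarrow> nat option list \<Rightarrow> nat list" where
  "raw n vs = map (case_option n ((!) vs))"

definition mono_set :: "nat \<Rightarrow> nat \<Rightarrow> nat list \<Rightarrow> bool list \<Rightarrow> nat set" where
  "mono_set n c vs Y = odds (raw n vs (sel c Y)) - {n}"

text \<open>The factor \<open>2 ^ (c - r)\<close> complements the \<open>2 ^ r\<close> of the
  unnormalised transform, so that constraints of all arities share the scale \<open>2 ^ c\<close>
  without any division.\<close>

definition con_recs :: "nat \<Rightarrow> nat \<Rightarrow> csp_constraint \<Rightarrow> (nat set \<times> int) list" where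
  "con_recs n c C = (let r = length (scope C) in
     map (\<lambda>Y. (mono_set n c (scope C) Y,
       2 ^ (c - r) * int (weight C) * (\<Sum>x\<leftarrow>sign_vectors r. int (predicate C x) * chim Y x))) (masks r))"

definition recs :: "nat \<Rightarrow> csp \<Rightarrow> (nat set \<times> int) list" where
  "recs c I = concat (map (con_recs (num_vars I) c) (constraints I))"

lemma chim_prod:
  assumes "length Y \<le> length x"
  shows "chim Y x = (\<Prod>i\<leftarrow>[0..<length Y]. if Y ! i then x ! i else 1)"
  using assms
proof (induction Y x rule: chim.induct)
  case (1 b Y a x)
  have "[0..<length (b # Y)] = 0 # map Suc [0..<length Y]"
    using upt_conv_Cons[of 0 "Suc (length Y)"] by (simp add: map_Suc_upt del: upt_Suc)
  with 1 show ?case by (simp add: o_def del: upt_Suc cong: if_cong)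
qed auto

lemma chi_mono_set:
  assumes "length vs \<le> c" "length Y = length vs" "set vs \<subseteq> {..<n}" "\<phi> \<in> cube {..<n}"
  shows "chi (mono_set n c vs Y) \<phi> = chim Y (map \<phi> vs)"
proof -
  \<comment> \<open>An element of the cube is \<open>undefined\<close> at \<open>n\<close>;
    \<open>y\<close> gives the dummy variable the value 1 that makes its slots neutral.\<close>
  define y where "y = \<phi>(n := 1)"
  let ?raw = "raw n vs (sel c Y)"
  have set_raw: "u < n \<or> u = n" if "u \<in> set ?raw" for u
    using that assms(2,3) by (auto simp: raw_def sel_def subset_iff split: if_splits)
  have y: "y u = -1 \<or> y u = 1" if "u \<in> set ?raw" for u
    using set_raw[OF that] cubeD[OF assms(4), of u] by (auto simp: y_def)
  have "chi (mono_set n c vs Y) \<phi> = chi (mono_set n c vs Y) y"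
    by (rule chi_depends) (auto simp: y_def mono_set_def)
  also have "\<dots> = chi (odds ?raw) y"
  proof (cases "n \<in> odds ?raw")
    case True
    have "chi (odds ?raw) y = y n * chi (odds ?raw - {n}) y"
      unfolding chi_def by (rule prod.remove) (use True in auto)
    then show ?thesis by (simp add: mono_set_def y_def)
  qed (simp add: mono_set_def)
  also have "\<dots> = (\<Prod>u\<leftarrow>?raw. y u)" using prod_list_odds[of ?raw y] y by simp
  also have "\<dots> = (\<Prod>i\<leftarrow>[0..<c]. if i < length Y \<and> Y ! i then map \<phi> vs ! i else 1)"
  proof -
    have "y (case (if i < length Y \<and> Y ! i then Some i else None) of None \<Rightarrow> n | Some i \<Rightarrow> vs ! i)
      = (if i < length Y \<and> Y ! i then map \<phi> vs ! i else 1)" for i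
    proof (cases "i < length Y \<and> Y ! i")
      case True
      then have "vs ! i < n" using assms(2,3) by (simp add: subset_iff)
      with True show ?thesis using assms(2) by (simp add: y_def)
    qed (auto simp: y_def)
    then show ?thesis by (simp add: raw_def sel_def o_def)
  qed
  also have "[0..<c] = [0..<length Y] @ [length Y..<c]"
    using assms(1,2) upt_add_eq_append[of 0 "length Y" "c - length Y"] by simp
  also have "(\<Prod>i\<leftarrow>[0..<length Y] @ [length Y..<c]. if i < length Y \<and> Y ! i then map \<phi> vs ! i else 1)
      = (\<Prod>i\<leftarrow>[0..<length Y]. if Y ! i then map \<phi> vs ! i else 1)"
  proof -
    have 1: "map (\<lambda>i. if i < length Y \<and> Y ! i then map \<phi> vs ! i else 1) [0..<length Y]
      = map (\<lambda>i. if Y ! i then map \<phi> vs ! i else 1) [0..<length Y]" by (rule map_cong) auto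
    have 2: "map (\<lambda>i. if i < length Y \<and> Y ! i then map \<phi> vs ! i else 1) [length Y..<c]
      = map (\<lambda>i. 1) [length Y..<c]" by (rule map_cong) auto
    have 3: "prod_list (map (\<lambda>i. 1) xs) = (1::int)" for xs :: "nat list" by (induction xs) auto
    show ?thesis unfolding map_append prod_list.append 1 2 3 by simp
  qed
  also have "\<dots> = chim Y (map \<phi> vs)"
    using chim_prod[of Y "map \<phi> vs"] assms(2) by simp
  finally show ?thesis .
qed

section \<open>Collecting equal monomials\<close>

definition fpoly :: "(nat set \<times> int) list \<Rightarrow> (nat \<Rightarrow> int) \<Rightarrow> int" where
  "fpoly rs x = (\<Sum>(S, a)\<leftarrow>rs. a * chi S x)"

text \<open>A set may occur in many records, with contributions that can cancel; only their total is
  a Fourier coefficient.\<close>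

definition coef :: "(nat set \<times> int) list \<Rightarrow> nat set \<Rightarrow> int" where
  "coef rs S = (\<Sum>(T, a)\<leftarrow>rs. if T = S then a else 0)"

lemma fpoly_append [simp]: "fpoly (rs @ qs) x = fpoly rs x + fpoly qs x"
  by (simp add: fpoly_def)

lemma fpoly_con_recs:
  assumes "valid_constraint c n C" "\<phi> \<in> cube {..<n}"
  shows "fpoly (con_recs n c C) \<phi> = 2 ^ c * (if satisfies \<phi> C then int (weight C) else 0)"
proof -
  define r where "r = length (scope C)"
  let ?z = "map \<phi> (scope C)"
  from assms have r: "r \<le> c" "set (scope C) \<subseteq> {..<n}"
    "\<And>x. x \<in> set (sign_vectors r) \<Longrightarrow> predicate C x \<in> {0, 1}"
    by (auto simp: valid_constraint_def r_def)
  have z: "?z \<in> set (sign_vectors r)"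
    using r(2) cubeD[OF assms(2)] by (auto simp: in_sign_vectors r_def)
  have "fpoly (con_recs n c C) \<phi> = (\<Sum>Y\<leftarrow>masks r. 2 ^ (c - r) * int (weight C) *
      ((\<Sum>x\<leftarrow>sign_vectors r. int (predicate C x) * chim Y x) * chim Y ?z))"
    unfolding fpoly_def con_recs_def Let_def r_def[symmetric] map_map
    by (rule arg_cong[of _ _ sum_list], rule map_cong[OF refl])
      (use chi_mono_set[of "scope C" c _ n \<phi>] r assms(2) length_in_masks in \<open>simp add: r_def\<close>)
  also have "\<dots> = 2 ^ (c - r) * int (weight C) * (int (predicate C ?z) * 2 ^ r)"
    using fourier_inversion[OF z, of "\<lambda>x. int (predicate C x)"] by (simp add: sum_list_const_mult)
  also have "\<dots> = 2 ^ c * (int (predicate C ?z) * int (weight C))"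
    using r(1) by (simp flip: power_add)
  also have "int (predicate C ?z) * int (weight C) = (if satisfies \<phi> C then int (weight C) else 0)"
    using r(3)[OF z] by (auto simp: satisfies_def)
  finally show ?thesis .
qed

lemma fpoly_recs:
  assumes "csp_instance c I" "\<phi> \<in> assignments I"
  shows "fpoly (recs c I) \<phi> = 2 ^ c * int (assignment_weight I \<phi>)"
proof -
  have "fpoly (concat (map (con_recs (num_vars I) c) Cs)) \<phi>
      = 2 ^ c * int (\<Sum>C\<leftarrow>filter (satisfies \<phi>) Cs. weight C)"
    if "\<forall>C\<in>set Cs. valid_constraint c (num_vars I) C" for Cs
    using that
  proof (induction Cs)
    case (Cons C Cs)
    then show ?case using assms(2) fpoly_con_recs[of c "num_vars I" C \<phi>]
      by (auto simp: assignments_def algebra_simps)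
  qed (simp add: fpoly_def)
  then show ?thesis using assms(1) by (simp add: recs_def csp_instance_def assignment_weight_def)
qed

lemma mono_set_subset: "length Y = length vs \<Longrightarrow> mono_set n c vs Y \<subseteq> set vs"
  using odds_subset[of "raw n vs (sel c Y)"]
  by (force simp: mono_set_def raw_def sel_def split: if_splits)

lemma recs_subset:
  assumes "csp_instance c I" "(S, a) \<in> set (recs c I)"
  shows "S \<subseteq> {..<num_vars I}"
  using assms mono_set_subset length_in_masks
  by (fastforce simp: recs_def con_recs_def csp_instance_def valid_constraint_def Let_def)

lemma fpoly_eq_sum:
  "fpoly rs x = (\<Sum>S\<in>fst ` set rs. coef rs S * chi S x)"
proof -
  \<comment> \<open>Generalised to every finite superset \<open>F\<close>, because the natural index
    set changes along the induction.\<close>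
  have "fpoly rs x = (\<Sum>S\<in>F. coef rs S * chi S x)" if "finite F" "fst ` set rs \<subseteq> F" for F
    using that(2)
  proof (induction rs)
    case (Cons p rs)
    have "(\<Sum>S\<in>F. coef (p # rs) S * chi S x)
        = (\<Sum>S\<in>F. (if fst p = S then snd p * chi S x else 0)) + (\<Sum>S\<in>F. coef rs S * chi S x)"
      unfolding sum.distrib[symmetric]
      by (rule sum.cong) (auto simp: coef_def algebra_simps split: prod.splits)
    also have "\<dots> = snd p * chi (fst p) x + fpoly rs x"
      using Cons that(1) by simp
    finally show ?case by (simp add: fpoly_def split: prod.splits)
  qed (simp add: fpoly_def coef_def)
  then show ?thesis by blast
qed

lemma coef_eq_0: "S \<notin> fst ` set rs \<Longrightarrow> coef rs S = 0"
proof (induction rs)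
  case (Cons p rs)
  then have "fst p \<noteq> S" by auto
  with Cons show ?case by (simp add: coef_def split_beta)
qed (simp add: coef_def)

text \<open>Nonempty characters sum to zero, so the mean over the cube is the constant coefficient.
  This is what identifies the scaled average of an instance.\<close>

lemma sum_fpoly:
  assumes "finite V" "\<And>S. S \<in> fst ` set rs \<Longrightarrow> S \<subseteq> V"
  shows "(\<Sum>x\<in>cube V. fpoly rs x) = 2 ^ card V * coef rs {}"
proof -
  have "(\<Sum>x\<in>cube V. fpoly rs x) = (\<Sum>S\<in>fst ` set rs. coef rs S * (\<Sum>x\<in>cube V. chi S x))"
    unfolding fpoly_eq_sum sum_distrib_left by (rule sum.swap)
  also have "\<dots> = (\<Sum>S\<in>fst ` set rs. if S = {} then coef rs S * 2 ^ card V else 0)"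
    by (rule sum.cong) (auto simp: sum_chi[OF assms(1)] assms(2))
  also have "\<dots> = 2 ^ card V * coef rs {}"
    using coef_eq_0[of "{}" rs] by (simp add: sum.delta')
  finally show ?thesis .
qed

lemma above_average_iff:
  assumes "csp_instance c I"
  shows "above_average c I k \<longleftrightarrow>
    (\<exists>\<phi>\<in>assignments I. fpoly (recs c I) \<phi> \<ge> coef (recs c I) {} + int k)"
proof -
  let ?n = "num_vars I"
  have fin: "finite (assignments I)" and ne: "assignments I \<noteq> {}" and
    card: "card (assignments I) = 2 ^ ?n"
    using cube_nonempty[of "{..<?n}"] card_cube[of "{..<?n}"] by (auto simp: assignments_def)
  \<comment> \<open>With total weight 0 the quotient is 0 by the convention for division, and every
    assignment has weight 0 as well, so the identity persists.\<close>
  have W: "real (assignment_weight I \<phi>) / real (total_weight I) * real (total_weight I)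
      = real (assignment_weight I \<phi>)" for \<phi>
  proof (cases "total_weight I = 0")
    case True
    have "(\<Sum>C\<leftarrow>filter (satisfies \<phi>) Cs. weight C) \<le> (\<Sum>C\<leftarrow>Cs. weight C)" for Cs
      by (induction Cs) auto
    then have "assignment_weight I \<phi> \<le> total_weight I"
      unfolding assignment_weight_def total_weight_def .
    with True show ?thesis by simp
  qed simp
  have e1: "average_fraction I * real (total_weight I) = (\<Sum>\<phi>\<in>assignments I. real (assignment_weight I \<phi>)) / 2 ^ ?n"
  proof -
    have "average_fraction I * real (total_weight I)
        = (\<Sum>\<phi>\<in>assignments I. real (assignment_weight I \<phi>) / real (total_weight I)) / 2 ^ ?n
          * real (total_weight I)"
      unfolding average_fraction_def
      by (simp only: integral_pmf_of_set[OF ne fin] card of_nat_power of_nat_numeral)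
    also have "\<dots> = (\<Sum>\<phi>\<in>assignments I. real (assignment_weight I \<phi>) / real (total_weight I)
          * real (total_weight I)) / 2 ^ ?n"
      by (simp only: times_divide_eq_left sum_distrib_right)
    finally show ?thesis by (simp only: W)
  qed
  have e2: "2 ^ c * (\<Sum>\<phi>\<in>assignments I. real (assignment_weight I \<phi>)) = 2 ^ ?n * real_of_int (coef (recs c I) {})"
  proof -
    have "(\<Sum>\<phi>\<in>assignments I. fpoly (recs c I) \<phi>) = 2 ^ ?n * coef (recs c I) {}"
      using sum_fpoly[of "{..<?n}" "recs c I"] recs_subset[OF assms] by (force simp: assignments_def)
    moreover have "(\<Sum>\<phi>\<in>assignments I. fpoly (recs c I) \<phi>)
        = (\<Sum>\<phi>\<in>assignments I. 2 ^ c * int (assignment_weight I \<phi>))"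
      by (rule sum.cong) (auto simp: fpoly_recs[OF assms])
    ultimately have "real_of_int (\<Sum>\<phi>\<in>assignments I. 2 ^ c * int (assignment_weight I \<phi>))
        = real_of_int (2 ^ ?n * coef (recs c I) {})" by simp
    then show ?thesis by (simp add: sum_distrib_left)
  qed
  have "(\<Sum>\<phi>\<in>assignments I. real (assignment_weight I \<phi>)) = 2 ^ ?n * real_of_int (coef (recs c I) {}) / 2 ^ c"
    using e2 by (simp add: nonzero_eq_divide_eq mult.commute)
  then have avg: "average_fraction I * real (total_weight I) = real_of_int (coef (recs c I) {}) / 2 ^ c"
    unfolding e1 by simp
  have "(average_fraction I * real (total_weight I) + real k / 2 ^ c \<le> real (assignment_weight I \<phi>))
      \<longleftrightarrow> coef (recs c I) {} + int k \<le> fpoly (recs c I) \<phi>" if "\<phi> \<in> assignments I" for \<phi>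
  proof -
    have "(average_fraction I * real (total_weight I) + real k / 2 ^ c \<le> real (assignment_weight I \<phi>))
      \<longleftrightarrow> real_of_int (coef (recs c I) {} + int k) \<le> real_of_int (2 ^ c * int (assignment_weight I \<phi>))"
      unfolding avg by (simp add: field_simps)
    then show ?thesis unfolding of_int_le_iff fpoly_recs[OF assms that] .
  qed
  then show ?thesis unfolding above_average_def by auto
qed

section \<open>Recording one monomial\<close>

text \<open>Registers: \<open>rYES\<close> is the answer, \<open>rNV\<close>, \<open>rK\<close>, \<open>rM\<close> are read from the input, \<open>rNEXT\<close> is the next
  unused variable code, \<open>rP\<close> the first free slot, \<open>rN\<close> the number of records, \<open>rAN\<close> the size of the
  set \<open>A\<close>; \<open>rQ\<close>, \<open>rR\<close>, \<open>rJ\<close> scan slots and records, \<open>rJ\<close> counting down.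
  \<open>rZERO\<close> is never written.

  Arrays: \<open>aVARS\<close> and \<open>aTAB\<close> hold the current constraint. \<open>aDELTA v\<close> is the code of the variable
  \<open>v\<close>, a power of two assigned at its first occurrence, so that sets of variables have distinct
  sums of codes, and \<open>aCOEF\<close> maps such a sum to the coefficient of the set. Record \<open>i\<close> consists of \<open>c\<close>
  variables from \<open>aSLOT (c * i)\<close> on, the sum \<open>aKEYA i\<close> of their codes and its contribution \<open>aLC i\<close> to
  the coefficient. \<open>aINA\<close> is the indicator of \<open>A\<close> (and of the dummy variable), \<open>aAL\<close> enumerates
  \<open>A\<close>, and \<open>aVAL v > 0\<close> means that \<open>v\<close> has the value -1.\<close>

abbreviation (input) "rYES \<equiv> 0::nat"
abbreviation (input) "rONE \<equiv> 1::nat"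
abbreviation (input) "rK \<equiv> 2::nat"
abbreviation (input) "rM \<equiv> 3::nat"
abbreviation (input) "rNEXT \<equiv> 4::nat"
abbreviation (input) "rP \<equiv> 5::nat"
abbreviation (input) "rN \<equiv> 6::nat"
abbreviation (input) "rQ \<equiv> 7::nat"
abbreviation (input) "rT1 \<equiv> 8::nat"
abbreviation (input) "rT2 \<equiv> 9::nat"
abbreviation (input) "rT3 \<equiv> 10::nat"
abbreviation (input) "rCNT \<equiv> 11::nat"
abbreviation (input) "rR \<equiv> 12::nat"
abbreviation (input) "rAN \<equiv> 13::nat"
abbreviation (input) "rACC \<equiv> 14::nat"
abbreviation (input) "rW \<equiv> 15::nat"
abbreviation (input) "rKEY \<equiv> 16::nat"
abbreviation (input) "rGO \<equiv> 17::nat"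
abbreviation (input) "rJ \<equiv> 18::nat"
abbreviation (input) "rZERO \<equiv> 19::nat"
abbreviation (input) "rNV \<equiv> 20::nat"
abbreviation (input) "rTGT \<equiv> 21::nat"

abbreviation (input) "aVARS \<equiv> 0::nat"
abbreviation (input) "aTAB \<equiv> 1::nat"
abbreviation (input) "aDELTA \<equiv> 2::nat"
abbreviation (input) "aSLOT \<equiv> 3::nat"
abbreviation (input) "aCOEF \<equiv> 4::nat"
abbreviation (input) "aKEYA \<equiv> 5::nat"
abbreviation (input) "aLC \<equiv> 6::nat"
abbreviation (input) "aINA \<equiv> 7::nat"
abbreviation (input) "aAL \<equiv> 8::nat"
abbreviation (input) "aVAL \<equiv> 9::nat"

text \<open>Negating \<open>d u\<close> once for each occurrence of \<open>u\<close> leaves a negative code exactly at the variables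
  of odd multiplicity; \<open>dedup\<close> and \<open>untog\<close> keep the first occurrence of these and restore \<open>d\<close>.\<close>

primrec tog :: "(nat \<Rightarrow> int) \<Rightarrow> nat list \<Rightarrow> nat \<Rightarrow> int" where
  "tog d [] = d"
| "tog d (u # us) = tog (d(u := - d u)) us"

primrec ksum :: "(nat \<Rightarrow> int) \<Rightarrow> nat list \<Rightarrow> int" where
  "ksum d [] = 0"
| "ksum d (u # us) = d u + ksum (d(u := - d u)) us"

primrec write_list :: "(nat \<Rightarrow> int) \<Rightarrow> nat \<Rightarrow> nat list \<Rightarrow> nat \<Rightarrow> int" where
  "write_list f p [] = f"
| "write_list f p (u # us) = write_list (f(p := int u)) (Suc p) us"

primrec untog :: "(nat \<Rightarrow> int) \<Rightarrow> nat list \<Rightarrow> nat \<Rightarrow> int" where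
  "untog d [] = d"
| "untog d (u # us) = untog (if d u < 0 then d(u := - d u) else d) us"

primrec dedup :: "nat \<Rightarrow> (nat \<Rightarrow> int) \<Rightarrow> nat list \<Rightarrow> nat list" where
  "dedup n d [] = []"
| "dedup n d (u # us) = (if d u < 0 then u # dedup n (d(u := - d u)) us else n # dedup n d us)"

definition key :: "(nat \<Rightarrow> int) \<Rightarrow> nat set \<Rightarrow> int" where
  "key d S = (\<Sum>u\<in>S. d u)"

lemma tog_eq: "tog d us = (\<lambda>u. if u \<in> odds us then - d u else d u)"
  by (induction us arbitrary: d) (auto simp: fun_eq_iff)

lemma ksum_eq: "ksum d us = key d (odds us)"
proof (induction us arbitrary: d)
  case (Cons u us)
  show ?case
  proof (cases "u \<in> odds us")
    case True
    have "key (d(u := - d u)) (odds us) = - d u + key (d(u := - d u)) (odds us - {u})"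
      unfolding key_def using True by (subst sum.remove[of _ u]) auto
    moreover have "key (d(u := - d u)) (odds us - {u}) = key d (odds us - {u})"
      unfolding key_def by (rule sum.cong) auto
    ultimately show ?thesis using True by (simp add: Cons del: fun_upd_apply)
  next
    case False
    have "key (d(u := - d u)) (odds us) = key d (odds us)"
      unfolding key_def by (rule sum.cong) (use False in auto)
    moreover have "key d (insert u (odds us)) = d u + key d (odds us)"
      using False by (simp add: key_def)
    ultimately show ?thesis using False by (simp add: Cons del: fun_upd_apply)
  qed
qed (simp add: key_def)

lemma write_list_eq:
  "write_list f p us q = (if p \<le> q \<and> q < p + length us then int (us ! (q - p)) else f q)"
proof (induction us arbitrary: f p)
  case (Cons u us)
  show ?case
  proof (cases "q \<le> p")
    case False
    then have "q - p = Suc (q - Suc p)" by simp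
    with Cons False show ?thesis by auto
  qed (use Cons in auto)
qed simp

lemma untog_eq: "untog d us u = (if u \<in> set us then \<bar>d u\<bar> else d u)"
  by (induction us arbitrary: d) auto

lemma length_dedup [simp]: "length (dedup n d us) = length us"
  by (induction us arbitrary: d) auto

lemma set_dedup: "\<not> d n < 0 \<Longrightarrow> set (dedup n d us) - {n} = {u \<in> set us. d u < 0}"
proof (induction us arbitrary: d)
  case (Cons u us)
  show ?case
  proof (cases "d u < 0")
    case True
    have "set (dedup n (d(u := - d u)) us) - {n} = {v \<in> set us. (d(u := - d u)) v < 0}"
      by (rule Cons.IH) (use True Cons.prems in auto)
    also have "\<dots> = {v \<in> set us. v \<noteq> u \<and> d v < 0}" using True by auto
    finally have "insert u (set (dedup n (d(u := - d u)) us) - {n}) = {v \<in> set (u # us). d v < 0}"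
      using True by auto
    moreover have "u \<noteq> n" using True Cons.prems by auto
    ultimately show ?thesis using True by (simp add: insert_Diff_if del: fun_upd_apply)
  next
    case False
    with Cons show ?thesis by auto
  qed
qed simp

lemma distinct_dedup: "\<not> d n < 0 \<Longrightarrow> distinct (filter (\<lambda>u. u \<noteq> n) (dedup n d us))"
proof (induction us arbitrary: d)
  case (Cons u us)
  show ?case
  proof (cases "d u < 0")
    case True
    have "u \<notin> set (dedup n (d(u := - d u)) us) - {n}"
      by (subst set_dedup) (use True Cons.prems in auto)
    with True Cons show ?thesis by auto
  qed (use Cons in auto)
qed simp

section \<open>Programs that write one record\<close>

definition put_slot :: "nat option \<Rightarrow> com" where
  "put_slot z = (case z of None \<Rightarrow> Op (OAdd rT1 rNV rZERO)
      | Some i \<Rightarrow> Op (OConst rT2 (int i)) ;; Op (OLoad rT1 aVARS rT2)) ;;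
    Op (OStore aSLOT rP rT1) ;; Op (OAdd rP rP rONE) ;; Op (OLoad rT2 aDELTA rT1) ;;
    Op (OAdd rKEY rKEY rT2) ;; Op (OSub rT2 rZERO rT2) ;; Op (OStore aDELTA rT1 rT2)"

definition fix_slot :: com where
  "fix_slot = Op (OLoad rT1 aSLOT rQ) ;; Op (OLoad rT2 aDELTA rT1) ;; Op (OSub rT2 rZERO rT2) ;;
    IfPos rT2 (Op (OStore aDELTA rT1 rT2)) (Op (OStore aSLOT rQ rNV)) ;; Op (OAdd rQ rQ rONE)"

text \<open>Both \<open>Y\<close> and \<open>x\<close> are fixed when the program is built, so the
  sign is compiled into the choice between addition and subtraction.\<close>

definition add_coef :: "bool list \<Rightarrow> nat \<times> int list \<Rightarrow> com" where
  "add_coef Y = (\<lambda>(j, x). Op (OConst rT2 (int j)) ;; Op (OLoad rT1 aTAB rT2) ;;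
    IfPos rT1 (if chim Y x = 1 then Op (OAdd rACC rACC rW) else Op (OSub rACC rACC rW)) Skip)"

definition finish_rec :: com where
  "finish_rec = Op (OStore aKEYA rN rKEY) ;; Op (OStore aLC rN rACC) ;; Op (OLoad rT1 aCOEF rKEY) ;;
    Op (OAdd rT1 rT1 rACC) ;; Op (OStore aCOEF rKEY rT1) ;; Op (OAdd rN rN rONE)"

definition emit :: "nat \<Rightarrow> nat \<Rightarrow> bool list \<Rightarrow> com" where
  "emit c r Y = Op (OConst rACC 0) ;; seq_list (map (add_coef Y) (List.enumerate 0 (sign_vectors r))) ;;
    Op (OConst rKEY 0) ;; seq_list (map put_slot (sel c Y)) ;;
    Op (OConst rT1 (int c)) ;; Op (OSub rQ rP rT1) ;; seq_list (replicate c fix_slot) ;; finish_rec"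

lemma ev_put_slots:
  assumes "ev (seq_list (map put_slot zs)) (X, H, inp) = (X', H', inp')"
    and "X rONE = 1" "X rZERO = 0" "X rNV = int n" "X rP = int p"
    and "\<And>i. Some i \<in> set zs \<Longrightarrow> H aVARS i = int (vs ! i)"
  shows "inp' = inp" "X' rP = int (p + length zs)" "X' rKEY = X rKEY + ksum (H aDELTA) (raw n vs zs)"
    "\<forall>i. i \<notin> {rP, rKEY, rT1, rT2} \<longrightarrow> X' i = X i"
    "H' aSLOT = write_list (H aSLOT) p (raw n vs zs)" "H' aDELTA = tog (H aDELTA) (raw n vs zs)"
    "\<forall>a. a \<notin> {aSLOT, aDELTA} \<longrightarrow> H' a = H a"
proof -
  have "inp' = inp \<and> X' rP = int (p + length zs) \<and> X' rKEY = X rKEY + ksum (H aDELTA) (raw n vs zs) \<and>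
    (\<forall>i. i \<notin> {rP, rKEY, rT1, rT2} \<longrightarrow> X' i = X i) \<and>
    H' aSLOT = write_list (H aSLOT) p (raw n vs zs) \<and> H' aDELTA = tog (H aDELTA) (raw n vs zs) \<and>
    (\<forall>a. a \<notin> {aSLOT, aDELTA} \<longrightarrow> H' a = H a)"
    using assms
  proof (induction zs arbitrary: X H p)
    case (Cons z zs)
    define u where "u = (case z of None \<Rightarrow> n | Some i \<Rightarrow> vs ! i)"
    obtain X1 H1 inp1 where s1: "ev (put_slot z) (X, H, inp) = (X1, H1, inp1)" by (metis prod_cases3)
    have st: "inp1 = inp" "X1 rP = int (Suc p)" "X1 rKEY = X rKEY + H aDELTA u"
      "\<forall>i. i \<notin> {rP, rKEY, rT1, rT2} \<longrightarrow> X1 i = X i"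
      "H1 aSLOT = (H aSLOT)(p := int u)" "H1 aDELTA = (H aDELTA)(u := - H aDELTA u)"
      "\<forall>a. a \<notin> {aSLOT, aDELTA} \<longrightarrow> H1 a = H a"
      using s1 Cons.prems(2-) by (auto simp: put_slot_def u_def split: option.splits)
    have rest: "ev (seq_list (map put_slot zs)) (X1, H1, inp) = (X', H', inp')"
      using Cons.prems(1) s1 st(1) by simp
    have raw: "raw n vs (z # zs) = u # raw n vs zs" by (simp add: raw_def u_def)
    have "inp' = inp \<and> X' rP = int (Suc p + length zs) \<and>
      X' rKEY = X1 rKEY + ksum (H1 aDELTA) (raw n vs zs) \<and>
      (\<forall>i. i \<notin> {rP, rKEY, rT1, rT2} \<longrightarrow> X' i = X1 i) \<and>
      H' aSLOT = write_list (H1 aSLOT) (Suc p) (raw n vs zs) \<and> H' aDELTA = tog (H1 aDELTA) (raw n vs zs) \<and>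
      (\<forall>a. a \<notin> {aSLOT, aDELTA} \<longrightarrow> H' a = H1 a)"
      by (rule Cons.IH[OF rest]) (use st Cons.prems(2-) in \<open>simp_all\<close>)
    with st show ?case by (simp add: raw del: fun_upd_apply)
  qed (simp add: raw_def)
  then show "inp' = inp" "X' rP = int (p + length zs)" "X' rKEY = X rKEY + ksum (H aDELTA) (raw n vs zs)"
    "\<forall>i. i \<notin> {rP, rKEY, rT1, rT2} \<longrightarrow> X' i = X i"
    "H' aSLOT = write_list (H aSLOT) p (raw n vs zs)" "H' aDELTA = tog (H aDELTA) (raw n vs zs)"
    "\<forall>a. a \<notin> {aSLOT, aDELTA} \<longrightarrow> H' a = H a" by auto
qed

lemma ev_fix_slots:
  assumes "ev (seq_list (replicate (length us) fix_slot)) (X, H, inp) = (X', H', inp')"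
    and "X rONE = 1" "X rZERO = 0" "X rNV = int n" "X rQ = int q"
    and "\<And>j. j < length us \<Longrightarrow> H aSLOT (q + j) = int (us ! j)"
  shows "inp' = inp"
    "\<forall>i. i \<notin> {rQ, rT1, rT2} \<longrightarrow> X' i = X i"
    "H' aSLOT = write_list (H aSLOT) q (dedup n (H aDELTA) us)" "H' aDELTA = untog (H aDELTA) us"
    "\<forall>a. a \<notin> {aSLOT, aDELTA} \<longrightarrow> H' a = H a"
proof -
  have "inp' = inp \<and> (\<forall>i. i \<notin> {rQ, rT1, rT2} \<longrightarrow> X' i = X i) \<and>
    H' aSLOT = write_list (H aSLOT) q (dedup n (H aDELTA) us) \<and> H' aDELTA = untog (H aDELTA) us \<and>
    (\<forall>a. a \<notin> {aSLOT, aDELTA} \<longrightarrow> H' a = H a)"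
    using assms
  proof (induction us arbitrary: X H q)
    case (Cons u us)
    obtain X1 H1 inp1 where s1: "ev fix_slot (X, H, inp) = (X1, H1, inp1)" by (metis prod_cases3)
    have u: "H aSLOT q = int u" using Cons.prems(6)[of 0] by simp
    have us: "H aSLOT (Suc q + j) = int (us ! j)" if "j < length us" for j
      using Cons.prems(6)[of "Suc j"] that by simp
    have st: "inp1 = inp" "X1 rQ = int (Suc q)" "\<forall>i. i \<notin> {rQ, rT1, rT2} \<longrightarrow> X1 i = X i"
      "H1 aSLOT = (if H aDELTA u < 0 then H aSLOT else (H aSLOT)(q := int n))"
      "H1 aDELTA = (if H aDELTA u < 0 then (H aDELTA)(u := - H aDELTA u) else H aDELTA)"
      "\<forall>a. a \<notin> {aSLOT, aDELTA} \<longrightarrow> H1 a = H a"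
      using s1 Cons.prems(2-5) u by (auto simp: fix_slot_def split: if_splits)
    have wr: "write_list (H aSLOT) q (u # vs) = write_list (H aSLOT) (Suc q) vs" for vs
      using u by (simp add: fun_upd_idem)
    have rest: "ev (seq_list (replicate (length us) fix_slot)) (X1, H1, inp) = (X', H', inp')"
      using Cons.prems(1) s1 st(1) by simp
    have "inp' = inp \<and> (\<forall>i. i \<notin> {rQ, rT1, rT2} \<longrightarrow> X' i = X1 i) \<and>
      H' aSLOT = write_list (H1 aSLOT) (Suc q) (dedup n (H1 aDELTA) us) \<and> H' aDELTA = untog (H1 aDELTA) us \<and>
      (\<forall>a. a \<notin> {aSLOT, aDELTA} \<longrightarrow> H' a = H1 a)"
      by (rule Cons.IH[OF rest]) (use st us Cons.prems(2-5) in \<open>simp_all\<close>)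
    with st wr show ?case
      by (cases "H aDELTA u < 0") (simp_all del: fun_upd_apply write_list.simps(2), simp_all)
  qed simp
  then show "inp' = inp"
    "\<forall>i. i \<notin> {rQ, rT1, rT2} \<longrightarrow> X' i = X i"
    "H' aSLOT = write_list (H aSLOT) q (dedup n (H aDELTA) us)" "H' aDELTA = untog (H aDELTA) us"
    "\<forall>a. a \<notin> {aSLOT, aDELTA} \<longrightarrow> H' a = H a" by auto
qed

lemma ev_add_coefs:
  assumes "ev (seq_list (map (add_coef Y) jx)) (X, H, inp) = (X', H', inp')"
    and "\<And>j x. (j, x) \<in> set jx \<Longrightarrow> set x \<subseteq> {-1, 1}"
  shows "inp' = inp" "H' = H" "\<forall>i. i \<notin> {rACC, rT1, rT2} \<longrightarrow> X' i = X i"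
    "X' rACC = X rACC + X rW * (\<Sum>(j, x)\<leftarrow>jx. if H aTAB j > 0 then chim Y x else 0)"
proof -
  have "inp' = inp \<and> H' = H \<and> (\<forall>i. i \<notin> {rACC, rT1, rT2} \<longrightarrow> X' i = X i) \<and>
    X' rACC = X rACC + X rW * (\<Sum>(j, x)\<leftarrow>jx. if H aTAB j > 0 then chim Y x else 0)"
    using assms
  proof (induction jx arbitrary: X)
    case (Cons p jx)
    obtain j x where p: "p = (j, x)" by force
    obtain X1 H1 inp1 where s1: "ev (add_coef Y p) (X, H, inp) = (X1, H1, inp1)" by (metis prod_cases3)
    have st: "inp1 = inp" "H1 = H" "\<forall>i. i \<notin> {rACC, rT1, rT2} \<longrightarrow> X1 i = X i"
      "X1 rACC = X rACC + X rW * (if H aTAB j > 0 then chim Y x else 0)"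
      using s1 chim_sign[of x Y] Cons.prems(2)[of j x] by (auto simp: p add_coef_def split: if_splits)
    have rest: "ev (seq_list (map (add_coef Y) jx)) (X1, H, inp) = (X', H', inp')"
      using Cons.prems(1) s1 st by simp
    have "inp' = inp \<and> H' = H \<and> (\<forall>i. i \<notin> {rACC, rT1, rT2} \<longrightarrow> X' i = X1 i) \<and>
      X' rACC = X1 rACC + X1 rW * (\<Sum>(j, x)\<leftarrow>jx. if H aTAB j > 0 then chim Y x else 0)"
      by (rule Cons.IH[OF rest]) (use Cons.prems(2) in auto)
    with st show ?case by (simp add: p algebra_simps)
  qed simp
  then show "inp' = inp" "H' = H" "\<forall>i. i \<notin> {rACC, rT1, rT2} \<longrightarrow> X' i = X i"
    "X' rACC = X rACC + X rW * (\<Sum>(j, x)\<leftarrow>jx. if H aTAB j > 0 then chim Y x else 0)" by auto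
qed

text \<open>Code 0 marks a variable that has not been seen, as the initially zero memory provides.
  The dummy \<open>n\<close> is excluded by \<open>u < n\<close>, keeps code 0 and so never
  contributes to a key.\<close>

definition good_codes :: "nat \<Rightarrow> (nat \<Rightarrow> int) \<Rightarrow> int \<Rightarrow> bool" where
  "good_codes n d nx \<longleftrightarrow> (\<exists>idx t. nx = 2 ^ t \<and> inj_on idx {u. d u \<noteq> 0} \<and>
     (\<forall>u. d u \<noteq> 0 \<longrightarrow> u < n \<and> d u = 2 ^ idx u \<and> idx u < t))"

lemma good_codesD:
  assumes "good_codes n d nx"
  shows "d u \<ge> 0" "d u \<noteq> 0 \<Longrightarrow> u < n" "nx > 0"
proof -
  from assms obtain idx t where 0: "nx = 2 ^ t \<and> inj_on idx {u. d u \<noteq> 0} \<and>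
      (\<forall>u. d u \<noteq> 0 \<longrightarrow> u < n \<and> d u = 2 ^ idx u \<and> idx u < t)"
    unfolding good_codes_def by (elim exE)
  have *: "nx = 2 ^ t" "\<And>u. d u \<noteq> 0 \<Longrightarrow> u < n \<and> d u = 2 ^ idx u" using 0 by simp_all
  show "d u \<ge> 0" using *(2)[of u] by (cases "d u = 0") auto
  show "d u \<noteq> 0 \<Longrightarrow> u < n" using *(2)[of u] by simp
  show "nx > 0" using *(1) by simp
qed

text \<open>A key is the \<open>set_encode\<close> of the set of indices, so uniqueness of binary
  representation applies. The conversion \<open>nat\<close> appears because keys serve as
  addresses.\<close>

lemma key_inj:
  assumes "good_codes n d nx" "S \<subseteq> {u. d u \<noteq> 0}" "T \<subseteq> {u. d u \<noteq> 0}"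
    and "nat (key d S) = nat (key d T)"
  shows "S = T"
proof -
  from assms(1) obtain idx t where 0: "nx = 2 ^ t \<and> inj_on idx {u. d u \<noteq> 0} \<and>
      (\<forall>u. d u \<noteq> 0 \<longrightarrow> u < n \<and> d u = 2 ^ idx u \<and> idx u < t)"
    unfolding good_codes_def by (elim exE)
  have *: "inj_on idx {u. d u \<noteq> 0}" "\<And>u. d u \<noteq> 0 \<Longrightarrow> u < n \<and> d u = 2 ^ idx u"
    using 0 by simp_all
  have code: "finite S" "key d S = int (set_encode (idx ` S))" if "S \<subseteq> {u. d u \<noteq> 0}" for S
  proof -
    have "S \<subseteq> {..<n}" using that *(2) by auto
    then show "finite S" by (rule finite_subset) simp
    have "inj_on idx S" using *(1) that inj_on_subset by blast
    have "key d S = (\<Sum>u\<in>S. 2 ^ idx u)" unfolding key_def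
      by (rule sum.cong) (use that *(2) in auto)
    also have "\<dots> = int (set_encode (idx ` S))"
      unfolding set_encode_def by (simp add: sum.reindex[OF \<open>inj_on idx S\<close>])
    finally show "key d S = int (set_encode (idx ` S))" .
  qed
  from assms(4) have "set_encode (idx ` S) = set_encode (idx ` T)"
    unfolding code(2)[OF assms(2)] code(2)[OF assms(3)] by simp
  then have "idx ` S = idx ` T"
    using code(1) assms(2,3) by (simp add: set_encode_eq)
  with *(1) assms(2,3) show ?thesis by (simp add: inj_on_image_eq_iff)
qed

text \<open>Only the dummy may repeat, so counting over slots gives cardinalities and multiplying
  over slots gives characters.\<close>

definition slots_ok :: "nat \<Rightarrow> nat \<Rightarrow> (nat \<Rightarrow> int) \<Rightarrow> nat \<Rightarrow> nat set \<Rightarrow> bool" where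
  "slots_ok n c f p S \<longleftrightarrow> (\<exists>sl. length sl = c \<and> (\<forall>j<c. f (p + j) = int (sl ! j)) \<and>
     S = set sl - {n} \<and> distinct (filter (\<lambda>u. u \<noteq> n) sl))"

text \<open>The table \<open>aCOEF\<close> is described by addresses and not by sets, so that a new
  record is just one update; the injectivity of keys is brought in only by
  \<open>db_imp_rdb\<close>.\<close>

definition db :: "nat \<Rightarrow> nat \<Rightarrow> (nat set \<times> int) list \<Rightarrow> (nat \<Rightarrow> int) \<Rightarrow> (nat \<Rightarrow> nat \<Rightarrow> int) \<Rightarrow> bool" where
  "db n c rs X H \<longleftrightarrow> X rONE = 1 \<and> X rZERO = 0 \<and> X rNV = int n \<and> X rP = int (c * length rs) \<and>
     X rN = int (length rs) \<and> good_codes n (H aDELTA) (X rNEXT) \<and>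
     (\<forall>i<length rs. slots_ok n c (H aSLOT) (c * i) (fst (rs ! i)) \<and>
        H aKEYA i = key (H aDELTA) (fst (rs ! i)) \<and> H aLC i = snd (rs ! i) \<and>
        fst (rs ! i) \<subseteq> {u. H aDELTA u \<noteq> 0}) \<and>
     (\<forall>e. H aCOEF e = (\<Sum>(S, a)\<leftarrow>rs. if nat (key (H aDELTA) S) = e then a else 0))"

lemma slots_ok_cong: "(\<And>j. j < c \<Longrightarrow> f (p + j) = g (p + j)) \<Longrightarrow> slots_ok n c f p S = slots_ok n c g p S"
  by (simp add: slots_ok_def)

lemma emit_db:
  assumes ev: "ev (emit c r Y) (X, H, inp) = (X', H', inp')"
    and db: "db n c rs X H"
    and vs: "length vs = r" "length Y = r" "\<And>i. i < r \<Longrightarrow> H aVARS i = int (vs ! i)"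
      "\<And>u. u \<in> set vs \<Longrightarrow> H aDELTA u \<noteq> 0"
  shows "db n c (rs @ [(mono_set n c vs Y,
      X rW * (\<Sum>(j, x)\<leftarrow>List.enumerate 0 (sign_vectors r). if H aTAB j > 0 then chim Y x else 0))]) X' H'"
    and "inp' = inp" "H' aDELTA = H aDELTA"
    and "\<forall>i. i \<notin> {rACC, rT1, rT2, rKEY, rP, rQ, rN} \<longrightarrow> X' i = X i"
    and "\<forall>a. a \<notin> {aSLOT, aDELTA, aKEYA, aLC, aCOEF} \<longrightarrow> H' a = H a"
proof -
  let ?raw = "raw n vs (sel c Y)" and ?d = "H aDELTA" and ?p = "c * length rs"
  let ?co = "X rW * (\<Sum>(j, x)\<leftarrow>List.enumerate 0 (sign_vectors r). if H aTAB j > 0 then chim Y x else 0)"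
  note db' = db[unfolded db_def]
  obtain X1 H1 inp1 where e1: "ev (seq_list (map (add_coef Y) (List.enumerate 0 (sign_vectors r))))
      (X(rACC := 0), H, inp) = (X1, H1, inp1)" by (metis prod_cases3)
  have "set x \<subseteq> {-1, 1}" if "(j, x) \<in> set (List.enumerate 0 (sign_vectors r))" for j x
  proof -
    have "x \<in> set (sign_vectors r)" using that by (auto simp: in_set_enumerate_eq)
    then show ?thesis by (simp add: in_sign_vectors)
  qed
  note a = ev_add_coefs[OF e1 this]
  obtain X2 H2 inp2 where e2: "ev (seq_list (map put_slot (sel c Y)))
      (X1(rKEY := 0), H1, inp1) = (X2, H2, inp2)" by (metis prod_cases3)
  have vars: "H1 aVARS i = int (vs ! i)" if "Some i \<in> set (sel c Y)" for i
    using that vs a(2) by (auto simp: sel_def split: if_splits)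
  have pre: "(X1(rKEY := 0)) rONE = 1" "(X1(rKEY := 0)) rZERO = 0" "(X1(rKEY := 0)) rNV = int n"
    "(X1(rKEY := 0)) rP = int ?p"
    using a(3) db' by simp_all
  note b = ev_put_slots[OF e2 pre vars]
  have b': "inp2 = inp1" "X2 rP = int (?p + c)" "X2 rKEY = key ?d (odds ?raw)"
    "\<forall>i. i \<notin> {rP, rKEY, rT1, rT2} \<longrightarrow> X2 i = (X1(rKEY := 0)) i"
    "H2 aSLOT = write_list (H aSLOT) ?p ?raw" "H2 aDELTA = tog ?d ?raw"
    "\<forall>a. a \<notin> {aSLOT, aDELTA} \<longrightarrow> H2 a = H a"
    using b by (simp_all add: a(2) ksum_eq sel_def)
  have len: "length ?raw = c" by (simp add: raw_def sel_def)
  obtain X3 H3 inp3 where e3: "ev (seq_list (replicate c fix_slot))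
      (X2(rT1 := int c, rQ := X2 rP - int c), H2, inp2) = (X3, H3, inp3)" by (metis prod_cases3)
  have slot2: "H2 aSLOT (?p + j) = int (?raw ! j)" if "j < length ?raw" for j
    using that by (simp add: b' write_list_eq)
  have pre: "(X2(rT1 := int c, rQ := X2 rP - int c)) rONE = 1"
    "(X2(rT1 := int c, rQ := X2 rP - int c)) rZERO = 0"
    "(X2(rT1 := int c, rQ := X2 rP - int c)) rNV = int n"
    "(X2(rT1 := int c, rQ := X2 rP - int c)) rQ = int ?p"
    using a(3) b'(2,4) db' by simp_all
  have e3': "ev (seq_list (replicate (length ?raw) fix_slot))
      (X2(rT1 := int c, rQ := X2 rP - int c), H2, inp2) = (X3, H3, inp3)"
    using e3 by (simp only: len)
  note f = ev_fix_slots[OF e3' pre slot2]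
  let ?sl = "dedup n (tog ?d ?raw) ?raw"
  have f': "inp3 = inp2" "\<forall>i. i \<notin> {rQ, rT1, rT2} \<longrightarrow> X3 i = (X2(rT1 := int c, rQ := X2 rP - int c)) i"
    "H3 aSLOT = write_list (write_list (H aSLOT) ?p ?raw) ?p ?sl" "H3 aDELTA = untog (tog ?d ?raw) ?raw"
    "\<forall>a. a \<notin> {aSLOT, aDELTA} \<longrightarrow> H3 a = H a"
    using f b'(5-7) by simp_all
  have gc: "good_codes n ?d (X rNEXT)" using db' by simp
  \<comment> \<open>Toggling cannot make the code of the dummy negative, so it is never taken for a
    variable of odd multiplicity, and it adds nothing to the key.\<close>
  have dn: "?d n = 0" using good_codesD(2)[OF gc, of n] by auto
  have dnn: "?d u \<ge> 0" for u by (rule good_codesD(1)[OF gc])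
  have dpos: "?d u > 0" if "u \<in> set ?raw" "u \<noteq> n" for u
  proof -
    have "u \<in> set vs" using that vs(1,2) by (auto simp: raw_def sel_def split: if_splits)
    with vs(4) dnn show ?thesis by (simp add: less_le)
  qed
  \<comment> \<open>Codes are nonnegative, so taking absolute values at the toggled places restores
    them.\<close>
  have D3: "H3 aDELTA = ?d"
  proof
    fix u show "H3 aDELTA u = ?d u"
      using dnn[of u] odds_subset[of ?raw] by (auto simp: f' untog_eq tog_eq)
  qed
  have sl: "set ?sl - {n} = mono_set n c vs Y"
  proof -
    have "set ?sl - {n} = {u \<in> set ?raw. tog ?d ?raw u < 0}"
      by (rule set_dedup) (simp add: tog_eq dn)
    also have "\<dots> = mono_set n c vs Y"
    proof (rule set_eqI)
      fix u
      show "u \<in> {u \<in> set ?raw. tog ?d ?raw u < 0} \<longleftrightarrow> u \<in> mono_set n c vs Y"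
        using dpos[of u] dn dnn[of u] odds_subset[of ?raw]
        by (cases "u = n") (auto simp: tog_eq mono_set_def)
    qed
    finally show ?thesis .
  qed
  have sl2: "distinct (filter (\<lambda>u. u \<noteq> n) ?sl)"
    by (rule distinct_dedup) (simp add: tog_eq dn)
  have k: "key ?d (odds ?raw) = key ?d (mono_set n c vs Y)"
    unfolding key_def mono_set_def by (rule sum.mono_neutral_right) (auto simp: dn)
  have X3: "X3 i = X i" if "i \<notin> {rACC, rT1, rT2, rKEY, rP, rQ}" for i using that f' b' a by simp
  have X3': "X3 rP = int (?p + c)" "X3 rKEY = key ?d (mono_set n c vs Y)" "X3 rACC = ?co"
    using f' b' a k by simp_all
  have ev': "ev finish_rec (X3, H3, inp3) = (X', H', inp')"
    using ev e1 e2 e3 unfolding emit_def by simp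
  have recno: "X3 rN = int (length rs)" using X3 db' by simp
  have S: "mono_set n c vs Y \<subseteq> {u. ?d u \<noteq> 0}"
    using mono_set_subset[of Y vs n c] vs by auto
  show i: "inp' = inp" using ev' a b' f' by (auto simp: finish_rec_def)
  show D: "H' aDELTA = H aDELTA" using ev' D3 by (auto simp: finish_rec_def)
  show F: "\<forall>i. i \<notin> {rACC, rT1, rT2, rKEY, rP, rQ, rN} \<longrightarrow> X' i = X i"
    using ev' X3 by (auto simp: finish_rec_def)
  show "\<forall>a. a \<notin> {aSLOT, aDELTA, aKEYA, aLC, aCOEF} \<longrightarrow> H' a = H a"
    using ev' f' by (auto simp: finish_rec_def)
  have post: "X' rP = int (?p + c)" "X' rN = int (length rs) + 1"
    "H' aSLOT = write_list (write_list (H aSLOT) ?p ?raw) ?p ?sl"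
    "H' aKEYA = (H aKEYA)(length rs := key ?d (mono_set n c vs Y))"
    "H' aLC = (H aLC)(length rs := ?co)"
    "H' aCOEF = (H aCOEF)(nat (key ?d (mono_set n c vs Y)) := H aCOEF (nat (key ?d (mono_set n c vs Y))) + ?co)"
    using ev' X3' recno f' db' X3[of rONE] by (auto simp: finish_rec_def)
  have "slots_ok n c (H' aSLOT) (c * i) (fst (rs ! i))" if "i < length rs" for i
  proof -
    \<comment> \<open>The slots of an earlier record end before the new record begins, hence are not
      overwritten.\<close>
    have "c * Suc i \<le> c * length rs" using that by (intro mult_left_mono) auto
    then have "\<not> ?p \<le> c * i + j" if "j < c" for j using that by simp
    then have "slots_ok n c (H' aSLOT) (c * i) (fst (rs ! i)) = slots_ok n c (H aSLOT) (c * i) (fst (rs ! i))"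
      by (intro slots_ok_cong) (simp add: post write_list_eq)
    with db' that show ?thesis by simp
  qed
  moreover have "slots_ok n c (H' aSLOT) (c * length rs) (mono_set n c vs Y)"
    unfolding slots_ok_def
    by (rule exI[of _ ?sl]) (auto simp: len post write_list_eq sl sl2)
  ultimately show "db n c (rs @ [(mono_set n c vs Y, ?co)]) X' H'"
    using db' post D F S unfolding db_def by (auto simp: nth_append less_Suc_eq)
qed

section \<open>Reading the instance\<close>

primrec alloc_d :: "(nat \<Rightarrow> int) \<Rightarrow> int \<Rightarrow> nat list \<Rightarrow> nat \<Rightarrow> int" where
  "alloc_d d nx [] = d"
| "alloc_d d nx (v # vs) = (if d v > 0 then alloc_d d nx vs else alloc_d (d(v := nx)) (nx + nx) vs)"

primrec alloc_nx :: "(nat \<Rightarrow> int) \<Rightarrow> int \<Rightarrow> nat list \<Rightarrow> int" where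
  "alloc_nx d nx [] = nx"
| "alloc_nx d nx (v # vs) = (if d v > 0 then alloc_nx d nx vs else alloc_nx (d(v := nx)) (nx + nx) vs)"

lemma good_codes_upd:
  assumes "good_codes n d nx" "d v = 0" "v < n"
  shows "good_codes n (d(v := nx)) (nx + nx)"
proof -
  from assms(1) obtain idx t where 0: "nx = 2 ^ t \<and> inj_on idx {u. d u \<noteq> 0} \<and>
      (\<forall>u. d u \<noteq> 0 \<longrightarrow> u < n \<and> d u = 2 ^ idx u \<and> idx u < t)"
    unfolding good_codes_def by (elim exE)
  have set: "{u. (d(v := nx)) u \<noteq> 0} = insert v {u. d u \<noteq> 0}" using 0 by auto
  have "inj_on (idx(v := t)) (insert v {u. d u \<noteq> 0})"
  proof (rule inj_onI)
    fix x y assume xy: "x \<in> insert v {u. d u \<noteq> 0}" "y \<in> insert v {u. d u \<noteq> 0}"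
      "(idx(v := t)) x = (idx(v := t)) y"
    have ne: "idx u \<noteq> t" if "d u \<noteq> 0" for u using 0 that by (metis less_irrefl)
    have "idx x = idx y \<Longrightarrow> d x \<noteq> 0 \<Longrightarrow> d y \<noteq> 0 \<Longrightarrow> x = y" using 0 by (auto dest: inj_onD)
    with xy ne[of x] ne[of y] show "x = y" by (cases "x = v"; cases "y = v") auto
  qed
  moreover have "(d(v := nx)) u \<noteq> 0 \<longrightarrow> u < n \<and> (d(v := nx)) u = 2 ^ (idx(v := t)) u \<and> (idx(v := t)) u < Suc t" for u
    using 0 assms(3) by (auto simp: less_Suc_eq)
  ultimately show ?thesis
    unfolding good_codes_def set using 0
    by (intro exI[of _ "idx(v := t)"] exI[of _ "Suc t"] conjI allI) (simp_all del: fun_upd_apply)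
qed

lemma alloc:
  assumes "good_codes n d nx" "set vs \<subseteq> {..<n}"
  shows "good_codes n (alloc_d d nx vs) (alloc_nx d nx vs) \<and>
    (\<forall>u. d u \<noteq> 0 \<longrightarrow> alloc_d d nx vs u = d u) \<and> (\<forall>v\<in>set vs. alloc_d d nx vs v \<noteq> 0)"
  using assms
proof (induction vs arbitrary: d nx)
  case (Cons v vs)
  show ?case
  proof (cases "d v > 0")
    case True
    with Cons show ?thesis by auto
  next
    case False
    with good_codesD(1)[OF Cons.prems(1), of v] have 0: "d v = 0" by simp
    have gc: "good_codes n (d(v := nx)) (nx + nx)"
      by (rule good_codes_upd) (use Cons.prems 0 in auto)
    have nx: "nx > 0" by (rule good_codesD(3)[OF Cons.prems(1)])
    have IH: "good_codes n (alloc_d (d(v := nx)) (nx + nx) vs) (alloc_nx (d(v := nx)) (nx + nx) vs) \<and>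
      (\<forall>u. (d(v := nx)) u \<noteq> 0 \<longrightarrow> alloc_d (d(v := nx)) (nx + nx) vs u = (d(v := nx)) u) \<and>
      (\<forall>v'\<in>set vs. alloc_d (d(v := nx)) (nx + nx) vs v' \<noteq> 0)"
      by (rule Cons.IH[OF gc]) (use Cons.prems in auto)
    have eq: "alloc_d d nx (v # vs) = alloc_d (d(v := nx)) (nx + nx) vs"
      "alloc_nx d nx (v # vs) = alloc_nx (d(v := nx)) (nx + nx) vs" using False by simp_all
    have "alloc_d (d(v := nx)) (nx + nx) vs u = d u" if "d u \<noteq> 0" for u
    proof -
      have "u \<noteq> v" using 0 that by auto
      with IH that show ?thesis by simp
    qed
    moreover have "alloc_d (d(v := nx)) (nx + nx) vs v \<noteq> 0"
      using IH nx by simp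
    ultimately show ?thesis unfolding eq using IH by simp
  qed
qed simp

definition read_var :: "nat \<Rightarrow> com" where
  "read_var i = Op (ORead rT1) ;; Op (OConst rT2 (int i)) ;; Op (OStore aVARS rT2 rT1) ;;
    Op (OLoad rT3 aDELTA rT1) ;;
    IfPos rT3 Skip (Op (OStore aDELTA rT1 rNEXT) ;; Op (OAdd rNEXT rNEXT rNEXT))"

definition read_entry :: "nat \<Rightarrow> com" where
  "read_entry i = Op (ORead rT1) ;; Op (OConst rT2 (int i)) ;; Op (OStore aTAB rT2 rT1)"

text \<open>The reading order is that of \<open>encode_constraint\<close>. Doubling the weight
  \<open>c - r\<close> times produces the factor \<open>2 ^ (c - r)\<close> of
  \<open>con_recs\<close>.\<close>

definition con_prog :: "nat \<Rightarrow> nat \<Rightarrow> com" where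
  "con_prog c r = seq_list (map read_var [0..<r]) ;; seq_list (map read_entry [0..<2 ^ r]) ;;
    Op (ORead rW) ;; seq_list (replicate (c - r) (Op (OAdd rW rW rW))) ;;
    seq_list (map (emit c r) (masks r))"

text \<open>The arity is known only at run time, whereas the code for each arity is unrolled.
  Counting down selects among \<open>c + 1\<close> programs; with \<open>d\<close> tests left,
  \<open>rT1\<close> holds the arity minus \<open>c - d\<close>.\<close>

primrec dispatch :: "nat \<Rightarrow> nat \<Rightarrow> com" where
  "dispatch c 0 = con_prog c c"
| "dispatch c (Suc d) = IfPos rT1 (Op (OSub rT1 rT1 rONE) ;; dispatch c d) (con_prog c (c - Suc d))"

definition read_con :: "nat \<Rightarrow> com" where
  "read_con c = Op (ORead rT1) ;; dispatch c c ;; Op (OSub rM rM rONE)"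

lemma ev_read_vars:
  assumes "ev (seq_list (map read_var [i0..<i0 + length vs])) (X, H, map int vs @ rest) = (X', H', inp')"
  shows "inp' = rest" "X' rNEXT = alloc_nx (H aDELTA) (X rNEXT) vs"
    "\<forall>i. i \<notin> {rT1, rT2, rT3, rNEXT} \<longrightarrow> X' i = X i"
    "H' aDELTA = alloc_d (H aDELTA) (X rNEXT) vs" "H' aVARS = write_list (H aVARS) i0 vs"
    "\<forall>a. a \<notin> {aVARS, aDELTA} \<longrightarrow> H' a = H a"
proof -
  have "inp' = rest \<and> X' rNEXT = alloc_nx (H aDELTA) (X rNEXT) vs \<and>
    (\<forall>i. i \<notin> {rT1, rT2, rT3, rNEXT} \<longrightarrow> X' i = X i) \<and>
    H' aDELTA = alloc_d (H aDELTA) (X rNEXT) vs \<and> H' aVARS = write_list (H aVARS) i0 vs \<and>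
    (\<forall>a. a \<notin> {aVARS, aDELTA} \<longrightarrow> H' a = H a)"
    using assms
  proof (induction vs arbitrary: X H i0)
    case (Cons v vs)
    obtain X1 H1 inp1 where s1: "ev (read_var i0) (X, H, map int (v # vs) @ rest) = (X1, H1, inp1)"
      by (metis prod_cases3)
    have st: "inp1 = map int vs @ rest" "X1 rNEXT = (if H aDELTA v > 0 then X rNEXT else X rNEXT + X rNEXT)"
      "\<forall>i. i \<notin> {rT1, rT2, rT3, rNEXT} \<longrightarrow> X1 i = X i"
      "H1 aDELTA = (if H aDELTA v > 0 then H aDELTA else (H aDELTA)(v := X rNEXT))"
      "H1 aVARS = (H aVARS)(i0 := int v)"
      "\<forall>a. a \<notin> {aVARS, aDELTA} \<longrightarrow> H1 a = H a"
      using s1 by (auto simp: read_var_def split: if_splits)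
    have "[i0..<i0 + length (v # vs)] = i0 # [Suc i0..<Suc i0 + length vs]"
      by (simp add: upt_conv_Cons del: upt_Suc)
    then have rest: "ev (seq_list (map read_var [Suc i0..<Suc i0 + length vs])) (X1, H1, map int vs @ rest)
        = (X', H', inp')"
      using Cons.prems(1) s1 st(1) by simp
    have "inp' = rest \<and> X' rNEXT = alloc_nx (H1 aDELTA) (X1 rNEXT) vs \<and>
      (\<forall>i. i \<notin> {rT1, rT2, rT3, rNEXT} \<longrightarrow> X' i = X1 i) \<and>
      H' aDELTA = alloc_d (H1 aDELTA) (X1 rNEXT) vs \<and> H' aVARS = write_list (H1 aVARS) (Suc i0) vs \<and>
      (\<forall>a. a \<notin> {aVARS, aDELTA} \<longrightarrow> H' a = H1 a)"
      by (rule Cons.IH[OF rest])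
    with st show ?case by (cases "H aDELTA v > 0") (simp_all del: fun_upd_apply)
  qed simp
  then show "inp' = rest" "X' rNEXT = alloc_nx (H aDELTA) (X rNEXT) vs"
    "\<forall>i. i \<notin> {rT1, rT2, rT3, rNEXT} \<longrightarrow> X' i = X i"
    "H' aDELTA = alloc_d (H aDELTA) (X rNEXT) vs" "H' aVARS = write_list (H aVARS) i0 vs"
    "\<forall>a. a \<notin> {aVARS, aDELTA} \<longrightarrow> H' a = H a" by simp_all
qed

lemma ev_read_entries:
  assumes "ev (seq_list (map read_entry [i0..<i0 + length ts])) (X, H, map int ts @ rest) = (X', H', inp')"
  shows "inp' = rest" "\<forall>i. i \<notin> {rT1, rT2} \<longrightarrow> X' i = X i"
    "H' aTAB = write_list (H aTAB) i0 ts" "\<forall>a. a \<noteq> aTAB \<longrightarrow> H' a = H a"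
proof -
  have "inp' = rest \<and> (\<forall>i. i \<notin> {rT1, rT2} \<longrightarrow> X' i = X i) \<and>
    H' aTAB = write_list (H aTAB) i0 ts \<and> (\<forall>a. a \<noteq> aTAB \<longrightarrow> H' a = H a)"
    using assms
  proof (induction ts arbitrary: X H i0)
    case (Cons v ts)
    obtain X1 H1 inp1 where s1: "ev (read_entry i0) (X, H, map int (v # ts) @ rest) = (X1, H1, inp1)"
      by (metis prod_cases3)
    have st: "inp1 = map int ts @ rest" "\<forall>i. i \<notin> {rT1, rT2} \<longrightarrow> X1 i = X i"
      "H1 aTAB = (H aTAB)(i0 := int v)" "\<forall>a. a \<noteq> aTAB \<longrightarrow> H1 a = H a"
      using s1 by (auto simp: read_entry_def)
    have "[i0..<i0 + length (v # ts)] = i0 # [Suc i0..<Suc i0 + length ts]"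
      by (simp add: upt_conv_Cons del: upt_Suc)
    then have rest: "ev (seq_list (map read_entry [Suc i0..<Suc i0 + length ts])) (X1, H1, map int ts @ rest)
        = (X', H', inp')"
      using Cons.prems(1) s1 st(1) by simp
    have "inp' = rest \<and> (\<forall>i. i \<notin> {rT1, rT2} \<longrightarrow> X' i = X1 i) \<and>
      H' aTAB = write_list (H1 aTAB) (Suc i0) ts \<and> (\<forall>a. a \<noteq> aTAB \<longrightarrow> H' a = H1 a)"
      by (rule Cons.IH[OF rest])
    with st show ?case by (simp del: fun_upd_apply)
  qed simp
  then show "inp' = rest" "\<forall>i. i \<notin> {rT1, rT2} \<longrightarrow> X' i = X i"
    "H' aTAB = write_list (H aTAB) i0 ts" "\<forall>a. a \<noteq> aTAB \<longrightarrow> H' a = H a" by simp_all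
qed

lemma ev_doubling:
  "ev (seq_list (replicate m (Op (OAdd rW rW rW)))) (X, H, inp) = (X(rW := 2 ^ m * X rW), H, inp)"
  by (induction m arbitrary: X) (simp_all add: mult_ac)

text \<open>The codes may be extended to new variables: recorded sets consist of variables that
  already have a code, so their keys, and with them the table, stay valid.\<close>

lemma db_cong:
  assumes db: "db n c rs X H"
    and X: "X' rONE = X rONE" "X' rZERO = X rZERO" "X' rNV = X rNV" "X' rP = X rP" "X' rN = X rN"
    and H: "H' aSLOT = H aSLOT" "H' aKEYA = H aKEYA" "H' aLC = H aLC" "H' aCOEF = H aCOEF"
    and gc: "good_codes n (H' aDELTA) (X' rNEXT)" "\<And>u. H aDELTA u \<noteq> 0 \<Longrightarrow> H' aDELTA u = H aDELTA u"
  shows "db n c rs X' H'"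
proof -
  have key: "key (H' aDELTA) S = key (H aDELTA) S" if "S \<subseteq> {u. H aDELTA u \<noteq> 0}" for S
    unfolding key_def by (rule sum.cong) (use that gc(2) in auto)
  have sub: "fst (rs ! i) \<subseteq> {u. H aDELTA u \<noteq> 0}" if "i < length rs" for i
    using db that by (simp add: db_def)
  have coef_eq: "(\<Sum>(S, a)\<leftarrow>rs. if nat (key (H' aDELTA) S) = e then a else 0)
      = (\<Sum>(S, a)\<leftarrow>rs. if nat (key (H aDELTA) S) = e then a else 0)" for e
  proof (rule arg_cong[of _ _ sum_list], rule map_cong[OF refl])
    fix p assume "p \<in> set rs"
    then obtain i where "i < length rs" "p = rs ! i" by (auto simp: in_set_conv_nth)
    with sub[of i] key[of "fst p"] show "(case p of (S, a) \<Rightarrow> if nat (key (H' aDELTA) S) = e then a else 0)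
        = (case p of (S, a) \<Rightarrow> if nat (key (H aDELTA) S) = e then a else 0)"
      by (simp add: split_beta)
  qed
  have "fst (rs ! i) \<subseteq> {u. H' aDELTA u \<noteq> 0}" if "i < length rs" for i
    using sub[OF that] gc(2) by fastforce
  then show ?thesis using db X H gc(1) key[OF sub] unfolding db_def coef_eq by simp
qed

abbreviation (input) "scratch \<equiv> {rACC, rT1, rT2, rT3, rKEY, rP, rQ, rN, rNEXT, rW, rM}"
abbreviation (input) "work_arrays \<equiv> {aVARS, aTAB, aSLOT, aDELTA, aKEYA, aLC, aCOEF}"

lemma emits_db:
  assumes "ev (seq_list (map (emit c r) Ys)) (X, H, inp) = (X', H', inp')"
    and "db n c rs X H"
    and "length vs = r" "\<And>i. i < r \<Longrightarrow> H aVARS i = int (vs ! i)"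
      "\<And>u. u \<in> set vs \<Longrightarrow> H aDELTA u \<noteq> 0"
    and "\<And>Y. Y \<in> set Ys \<Longrightarrow> length Y = r"
  shows "db n c (rs @ map (\<lambda>Y. (mono_set n c vs Y,
      X rW * (\<Sum>(j, x)\<leftarrow>List.enumerate 0 (sign_vectors r). if H aTAB j > 0 then chim Y x else 0))) Ys) X' H' \<and>
    inp' = inp \<and> (\<forall>i. i \<notin> {rACC, rT1, rT2, rKEY, rP, rQ, rN} \<longrightarrow> X' i = X i) \<and>
    (\<forall>a. a \<notin> {aSLOT, aDELTA, aKEYA, aLC, aCOEF} \<longrightarrow> H' a = H a)"
  using assms
proof (induction Ys arbitrary: X H rs)
  case (Cons Y Ys)
  obtain X1 H1 inp1 where s1: "ev (emit c r Y) (X, H, inp) = (X1, H1, inp1)" by (metis prod_cases3)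
  note e = emit_db[OF s1 Cons.prems(2,3) Cons.prems(6)[OF list.set_intros(1)] Cons.prems(4,5)]
  have rest: "ev (seq_list (map (emit c r) Ys)) (X1, H1, inp) = (X', H', inp')"
    using Cons.prems(1) s1 e(2) by simp
  have "db n c ((rs @ [(mono_set n c vs Y,
      X rW * (\<Sum>(j, x)\<leftarrow>List.enumerate 0 (sign_vectors r). if H aTAB j > 0 then chim Y x else 0))]) @
      map (\<lambda>Y. (mono_set n c vs Y,
      X1 rW * (\<Sum>(j, x)\<leftarrow>List.enumerate 0 (sign_vectors r). if H1 aTAB j > 0 then chim Y x else 0))) Ys) X' H' \<and>
    inp' = inp \<and> (\<forall>i. i \<notin> {rACC, rT1, rT2, rKEY, rP, rQ, rN} \<longrightarrow> X' i = X1 i) \<and>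
    (\<forall>a. a \<notin> {aSLOT, aDELTA, aKEYA, aLC, aCOEF} \<longrightarrow> H' a = H1 a)"
    by (rule Cons.IH[OF rest e(1) Cons.prems(3)])
      (use e(3,5) Cons.prems(4-6) in simp_all)
  moreover have "X1 rW = X rW" "H1 aTAB = H aTAB" using e(4,5) by simp_all
  ultimately show ?case using e(4,5) by simp
qed simp

lemma con_prog_db:
  assumes ev: "ev (con_prog c r) (X, H, tl (encode_constraint C) @ rest) = (X', H', inp')"
    and db: "db n c rs X H" and C: "valid_constraint c n C" "r = length (scope C)"
  shows "db n c (rs @ con_recs n c C) X' H' \<and> inp' = rest \<and>
    (\<forall>i. i \<notin> scratch - {rM} \<longrightarrow> X' i = X i) \<and> (\<forall>a. a \<notin> work_arrays \<longrightarrow> H' a = H a)"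
proof -
  let ?vs = "scope C" and ?ts = "map (predicate C) (sign_vectors r)"
  have inp: "tl (encode_constraint C) @ rest = map int ?vs @ (map int ?ts @ int (weight C) # rest)"
    by (simp add: encode_constraint_def C(2) o_def)
  obtain X1 H1 inp1 where s1: "ev (seq_list (map read_var [0..<r])) (X, H, tl (encode_constraint C) @ rest)
      = (X1, H1, inp1)" by (metis prod_cases3)
  have "ev (seq_list (map read_var [0..<0 + length ?vs]))
      (X, H, map int ?vs @ (map int ?ts @ int (weight C) # rest)) = (X1, H1, inp1)"
    using s1 by (simp only: inp C(2) add_0)
  note a = ev_read_vars[OF this]
  obtain X2 H2 inp2 where s2: "ev (seq_list (map read_entry [0..<2 ^ r])) (X1, H1, inp1)
      = (X2, H2, inp2)" by (metis prod_cases3)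
  have "ev (seq_list (map read_entry [0..<0 + length ?ts]))
      (X1, H1, map int ?ts @ (int (weight C) # rest)) = (X2, H2, inp2)"
    using s2 a(1) by simp
  note b = ev_read_entries[OF this]
  let ?X3 = "X2(rW := 2 ^ (c - r) * int (weight C))"
  have ev': "ev (seq_list (map (emit c r) (masks r))) (?X3, H2, rest) = (X', H', inp')"
    using ev s1 s2 b(1) by (simp add: con_prog_def ev_doubling)
  have vs: "r \<le> c" "set ?vs \<subseteq> {..<n}" "\<And>x. x \<in> set (sign_vectors r) \<Longrightarrow> predicate C x \<in> {0, 1}"
    using C by (auto simp: valid_constraint_def)
  have gc: "good_codes n (H aDELTA) (X rNEXT)" using db by (simp add: db_def)
  note al = alloc[OF gc vs(2)]
  have db2: "db n c rs ?X3 H2"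
    by (rule db_cong[OF db]) (use a b al in simp_all)
  have H2: "H2 aVARS i = int (?vs ! i)" if "i < r" for i
    using a b that C(2) by (simp add: write_list_eq)
  have D2: "H2 aDELTA u \<noteq> 0" if "u \<in> set ?vs" for u
    using a b al that by simp
  note e = emits_db[OF ev' db2 C(2)[symmetric] H2 D2 length_in_masks]
  \<comment> \<open>Truth values are 0 or 1, so the positivity test of the program stands for a
    multiplication by the table entry.\<close>
  have sum: "(\<Sum>(j, x)\<leftarrow>List.enumerate 0 (sign_vectors r). if H2 aTAB j > 0 then chim Y x else 0)
      = (\<Sum>x\<leftarrow>sign_vectors r. int (predicate C x) * chim Y x)" for Y
  proof (rule arg_cong[of _ _ sum_list], rule nth_equalityI)
    fix i assume "i < length (map (\<lambda>(j, x). if H2 aTAB j > 0 then chim Y x else 0) (List.enumerate 0 (sign_vectors r)))"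
    then have i: "i < 2 ^ r" by simp
    have "predicate C (sign_vectors r ! i) \<in> {0, 1}" by (rule vs(3)) (simp add: i)
    then show "map (\<lambda>(j, x). if H2 aTAB j > 0 then chim Y x else 0) (List.enumerate 0 (sign_vectors r)) ! i
        = map (\<lambda>x. int (predicate C x) * chim Y x) (sign_vectors r) ! i"
      using i b(3) by (auto simp: nth_enumerate_eq write_list_eq)
  qed simp
  have "con_recs n c C = map (\<lambda>Y. (mono_set n c ?vs Y, ?X3 rW *
      (\<Sum>(j, x)\<leftarrow>List.enumerate 0 (sign_vectors r). if H2 aTAB j > 0 then chim Y x else 0))) (masks r)"
    unfolding sum by (simp add: con_recs_def Let_def C(2))
  with e a b show ?thesis by simp
qed

lemma ev_dispatch:
  assumes "d \<le> c" "c - d \<le> r" "r \<le> c" "X rT1 = int (r - (c - d))" "X rONE = 1"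
  shows "\<exists>v. ev (dispatch c d) (X, H, inp) = ev (con_prog c r) (X(rT1 := v), H, inp)"
  using assms
proof (induction d arbitrary: X)
  case 0
  then have "r = c" by simp
  then have "ev (dispatch c 0) (X, H, inp) = ev (con_prog c r) (X, H, inp)" by simp
  then show ?case by (metis fun_upd_triv)
next
  case (Suc d)
  show ?case
  proof (cases "r = c - Suc d")
    case True
    with Suc.prems have "ev (dispatch c (Suc d)) (X, H, inp) = ev (con_prog c r) (X, H, inp)" by simp
    then show ?thesis by (metis fun_upd_triv)
  next
    case False
    then have "\<exists>v. ev (dispatch c d) (X(rT1 := X rT1 - 1), H, inp)
        = ev (con_prog c r) (X(rT1 := X rT1 - 1, rT1 := v), H, inp)"
      using Suc.prems by (intro Suc.IH) auto
    then obtain v where "ev (dispatch c d) (X(rT1 := X rT1 - 1), H, inp)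
        = ev (con_prog c r) (X(rT1 := v), H, inp)" by auto
    moreover have "X rT1 > 0" using Suc.prems False by simp
    ultimately have "ev (dispatch c (Suc d)) (X, H, inp) = ev (con_prog c r) (X(rT1 := v), H, inp)"
      using Suc.prems(5) by simp
    then show ?thesis by blast
  qed
qed

lemma read_con_db:
  assumes ev: "ev (read_con c) (X, H, encode_constraint C @ rest) = (X', H', inp')"
    and db: "db n c rs X H" and C: "valid_constraint c n C"
  shows "db n c (rs @ con_recs n c C) X' H' \<and> inp' = rest \<and> X' rM = X rM - 1 \<and>
    (\<forall>i. i \<notin> scratch \<longrightarrow> X' i = X i) \<and> (\<forall>a. a \<notin> work_arrays \<longrightarrow> H' a = H a)"
proof -
  define r where "r = length (scope C)"
  have enc: "encode_constraint C = int r # tl (encode_constraint C)"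
    by (simp add: encode_constraint_def r_def)
  have one: "X rONE = 1" using db by (simp add: db_def)
  have r: "r \<le> c" using C by (simp add: valid_constraint_def r_def)
  obtain v where v: "ev (dispatch c c) (X(rT1 := int r), H, tl (encode_constraint C) @ rest)
      = ev (con_prog c r) (X(rT1 := int r, rT1 := v), H, tl (encode_constraint C) @ rest)"
    using ev_dispatch[of c c r "X(rT1 := int r)" H "tl (encode_constraint C) @ rest"] r one by auto
  obtain X1 H1 inp1 where s1: "ev (con_prog c r) (X(rT1 := int r, rT1 := v), H, tl (encode_constraint C) @ rest)
      = (X1, H1, inp1)" by (metis prod_cases3)
  have "db n c rs (X(rT1 := int r, rT1 := v)) H"
    by (rule db_cong[OF db]) (use db in \<open>simp_all add: db_def\<close>)
  note c = con_prog_db[OF s1 this C r_def]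
  have "ev (read_con c) (X, H, encode_constraint C @ rest) = ev (Op (OSub rM rM rONE)) (X1, H1, inp1)"
    using v s1 by (subst enc) (simp add: read_con_def)
  with ev have post: "X' = X1(rM := X1 rM - X1 rONE)" "H' = H1" "inp' = inp1" by simp_all
  have "X1 rONE = 1" "X1 rM = X rM" using c one by simp_all
  moreover have "db n c (rs @ con_recs n c C) X' H'"
    by (rule db_cong[OF conjunct1[OF c]]) (use c post in \<open>simp_all add: db_def\<close>)
  ultimately show ?thesis using c post by simp
qed

section \<open>The greedy passes\<close>

text \<open>What later stages need of \<open>db\<close>. The codes are gone: \<open>aKEYA\<close>
  leads from a record to the full coefficient of its set, and address 0, the empty sum of codes, to
  the constant term.\<close>

definition rdb :: "nat \<Rightarrow> nat \<Rightarrow> (nat set \<times> int) list \<Rightarrow> (nat \<Rightarrow> int) \<Rightarrow> (nat \<Rightarrow> nat \<Rightarrow> int) \<Rightarrow> bool" where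
  "rdb n c rs X H \<longleftrightarrow> X rONE = 1 \<and> X rZERO = 0 \<and> X rN = int (length rs) \<and>
     (\<forall>i<length rs. slots_ok n c (H aSLOT) (c * i) (fst (rs ! i)) \<and> H aLC i = snd (rs ! i) \<and>
        H aCOEF (nat (H aKEYA i)) = coef rs (fst (rs ! i))) \<and>
     H aCOEF 0 = coef rs {}"

lemma rdb_cong:
  assumes "rdb n c rs X H" "X' rONE = X rONE" "X' rZERO = X rZERO" "X' rN = X rN"
    and "H' aSLOT = H aSLOT" "H' aLC = H aLC" "H' aCOEF = H aCOEF" "H' aKEYA = H aKEYA"
  shows "rdb n c rs X' H'"
  using assms by (simp add: rdb_def)

lemma db_imp_rdb:
  assumes db: "db n c rs X H"
  shows "rdb n c rs X H"
proof -
  have gc: "good_codes n (H aDELTA) (X rNEXT)" using db by (simp add: db_def)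
  have sub: "fst p \<subseteq> {u. H aDELTA u \<noteq> 0}" if "p \<in> set rs" for p
    using db that by (auto simp: db_def in_set_conv_nth)
  have eq: "H aCOEF (nat (key (H aDELTA) S)) = coef rs S" if S: "S \<subseteq> {u. H aDELTA u \<noteq> 0}" for S
  proof -
    have "H aCOEF (nat (key (H aDELTA) S))
        = (\<Sum>(T, a)\<leftarrow>rs. if nat (key (H aDELTA) T) = nat (key (H aDELTA) S) then a else 0)"
      using db unfolding db_def by meson
    also have "\<dots> = coef rs S" unfolding coef_def
    proof (rule arg_cong[of _ _ sum_list], rule map_cong[OF refl])
      fix p assume "p \<in> set rs"
      from key_inj[OF gc sub[OF this] S]
      show "(case p of (T, a) \<Rightarrow> if nat (key (H aDELTA) T) = nat (key (H aDELTA) S) then a else 0)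
          = (case p of (T, a) \<Rightarrow> if T = S then a else 0)"
        by (auto simp: split_beta)
    qed
    finally show ?thesis .
  qed
  have "H aCOEF (nat (H aKEYA i)) = coef rs (fst (rs ! i))" if "i < length rs" for i
  proof -
    have "H aKEYA i = key (H aDELTA) (fst (rs ! i))" using db that by (simp add: db_def)
    with eq[OF sub[OF nth_mem[OF that]]] show ?thesis by simp
  qed
  moreover have "H aCOEF 0 = coef rs {}" using eq[of "{}"] by (simp add: key_def)
  ultimately show ?thesis using db by (simp add: rdb_def db_def)
qed

text \<open>The dummy counts as a member, so its slots are neither counted as variables outside
  \<open>A\<close> nor added to it.\<close>

definition ainv :: "nat \<Rightarrow> nat list \<Rightarrow> (nat \<Rightarrow> int) \<Rightarrow> (nat \<Rightarrow> nat \<Rightarrow> int) \<Rightarrow> bool" where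
  "ainv n al X H \<longleftrightarrow> X rAN = int (length al) \<and> (\<forall>i<length al. H aAL i = int (al ! i)) \<and>
     distinct al \<and> n \<notin> set al \<and> (\<forall>u. H aINA u > 0 \<longleftrightarrow> u \<in> set al \<or> u = n)"

primrec add_new :: "nat \<Rightarrow> nat list \<Rightarrow> nat list \<Rightarrow> nat list" where
  "add_new n al [] = al"
| "add_new n al (u # us) = add_new n (if u \<in> set al \<or> u = n then al else al @ [u]) us"

lemma set_add_new: "set (add_new n al us) = set al \<union> (set us - {n})"
  by (induction us arbitrary: al) auto

definition count_slot :: com where
  "count_slot = Op (OLoad rT1 aSLOT rQ) ;; Op (OLoad rT2 aINA rT1) ;; IfPos rT2 Skip (Op (OAdd rT3 rT3 rONE)) ;;
    Op (OAdd rQ rQ rONE)"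

definition mark_slot :: com where
  "mark_slot = Op (OLoad rT1 aSLOT rQ) ;; Op (OLoad rT2 aINA rT1) ;;
    IfPos rT2 Skip (Op (OStore aINA rT1 rONE) ;; Op (OStore aAL rAN rT1) ;; Op (OAdd rAN rAN rONE)) ;;
    Op (OAdd rQ rQ rONE)"

text \<open>Everything is phrased as positivity: a coefficient is nonzero if its absolute value is
  positive, a count is at least \<open>s\<close> if it exceeds \<open>s - 1\<close>. Counting leaves
  \<open>rQ\<close> behind the record, so marking first steps back by \<open>c\<close>.\<close>

definition pass_body :: "nat \<Rightarrow> nat \<Rightarrow> com" where
  "pass_body c s = Op (OConst rT3 0) ;; seq_list (replicate c count_slot) ;;
    Op (OLoad rT1 aKEYA rR) ;; Op (OLoad rT1 aCOEF rT1) ;; IfPos rT1 Skip (Op (OSub rT1 rZERO rT1)) ;;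
    Op (OConst rT2 (int s - 1)) ;; Op (OSub rT3 rT3 rT2) ;;
    IfPos rT1 (IfPos rT3 (Op (OConst rT2 (int c)) ;; Op (OSub rQ rQ rT2) ;;
      seq_list (replicate c mark_slot) ;; Op (OAdd rCNT rCNT rONE)) Skip) Skip ;;
    Op (OAdd rR rR rONE) ;; Op (OSub rJ rJ rONE)"

definition scan :: "com \<Rightarrow> com" where
  "scan body = Op (OConst rQ 0) ;; Op (OConst rR 0) ;; Op (OAdd rJ rN rZERO) ;; WhilePos rJ body"

text \<open>A round can only raise \<open>rYES\<close>; later rounds are executed even after a
  positive answer, and only the search is skipped.\<close>

definition pass :: "nat \<Rightarrow> nat \<Rightarrow> com" where
  "pass c s = Op (OConst rCNT 0) ;; scan (pass_body c s) ;;
    Op (OSub rT1 rK rCNT) ;; IfPos rT1 Skip (Op (OConst rYES 1))"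

primrec passes :: "nat \<Rightarrow> nat \<Rightarrow> com" where
  "passes c 0 = Skip"
| "passes c (Suc s) = pass c (Suc s) ;; passes c s"

lemma ev_count_slots:
  assumes "ev (seq_list (replicate (length us) count_slot)) (X, H, inp) = (X', H', inp')"
    and "X rONE = 1" "X rQ = int q" "\<And>j. j < length us \<Longrightarrow> H aSLOT (q + j) = int (us ! j)"
  shows "inp' = inp \<and> H' = H \<and> X' rQ = int (q + length us) \<and>
    X' rT3 = X rT3 + int (length (filter (\<lambda>u. \<not> H aINA u > 0) us)) \<and>
    (\<forall>i. i \<notin> {rQ, rT1, rT2, rT3} \<longrightarrow> X' i = X i)"
  using assms
proof (induction us arbitrary: X q)
  case (Cons u us)
  obtain X1 H1 inp1 where s1: "ev count_slot (X, H, inp) = (X1, H1, inp1)" by (metis prod_cases3)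
  have u: "H aSLOT q = int u" using Cons.prems(4)[of 0] by simp
  have us: "H aSLOT (Suc q + j) = int (us ! j)" if "j < length us" for j
    using Cons.prems(4)[of "Suc j"] that by simp
  have st: "inp1 = inp" "H1 = H" "X1 rQ = int (Suc q)" "\<forall>i. i \<notin> {rQ, rT1, rT2, rT3} \<longrightarrow> X1 i = X i"
    "X1 rT3 = X rT3 + (if H aINA u > 0 then 0 else 1)"
    using s1 Cons.prems(2,3) u by (auto simp: count_slot_def split: if_splits)
  have rest: "ev (seq_list (replicate (length us) count_slot)) (X1, H, inp) = (X', H', inp')"
    using Cons.prems(1) s1 st by simp
  have "inp' = inp \<and> H' = H \<and> X' rQ = int (Suc q + length us) \<and>
    X' rT3 = X1 rT3 + int (length (filter (\<lambda>u. \<not> H aINA u > 0) us)) \<and>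
    (\<forall>i. i \<notin> {rQ, rT1, rT2, rT3} \<longrightarrow> X' i = X1 i)"
    by (rule Cons.IH[OF rest]) (use st us Cons.prems(2) in simp_all)
  with st show ?case by simp
qed simp

lemma ev_mark_slots:
  assumes "ev (seq_list (replicate (length us) mark_slot)) (X, H, inp) = (X', H', inp')"
    and "X rONE = 1" "X rQ = int q" "\<And>j. j < length us \<Longrightarrow> H aSLOT (q + j) = int (us ! j)"
    and "ainv n al X H"
  shows "inp' = inp \<and> X' rQ = int (q + length us) \<and> ainv n (add_new n al us) X' H' \<and>
    (\<forall>i. i \<notin> {rQ, rT1, rT2, rAN} \<longrightarrow> X' i = X i) \<and> (\<forall>a. a \<notin> {aINA, aAL} \<longrightarrow> H' a = H a)"
  using assms
proof (induction us arbitrary: X H q al)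
  case (Cons u us)
  obtain X1 H1 inp1 where s1: "ev mark_slot (X, H, inp) = (X1, H1, inp1)" by (metis prod_cases3)
  have u: "H aSLOT q = int u" using Cons.prems(4)[of 0] by simp
  have us: "H aSLOT (Suc q + j) = int (us ! j)" if "j < length us" for j
    using Cons.prems(4)[of "Suc j"] that by simp
  let ?al = "if u \<in> set al \<or> u = n then al else al @ [u]"
  have st: "inp1 = inp" "X1 rQ = int (Suc q)" "\<forall>i. i \<notin> {rQ, rT1, rT2, rAN} \<longrightarrow> X1 i = X i"
    "\<forall>a. a \<notin> {aINA, aAL} \<longrightarrow> H1 a = H a"
    using s1 Cons.prems(2,3) u by (auto simp: mark_slot_def split: if_splits)
  have a: "ainv n ?al X1 H1"
  proof (cases "u \<in> set al \<or> u = n")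
    case True
    then have "H aINA u > 0" using Cons.prems(5) by (simp add: ainv_def)
    with s1 u Cons.prems(2,3,5) True show ?thesis by (auto simp: mark_slot_def ainv_def)
  next
    case False
    then have "\<not> H aINA u > 0" using Cons.prems(5) by (simp add: ainv_def)
    with s1 u Cons.prems(2,3,5) False show ?thesis
      by (auto simp: mark_slot_def ainv_def nth_append less_Suc_eq)
  qed
  have rest: "ev (seq_list (replicate (length us) mark_slot)) (X1, H1, inp) = (X', H', inp')"
    using Cons.prems(1) s1 st by simp
  have "inp' = inp \<and> X' rQ = int (Suc q + length us) \<and> ainv n (add_new n ?al us) X' H' \<and>
    (\<forall>i. i \<notin> {rQ, rT1, rT2, rAN} \<longrightarrow> X' i = X1 i) \<and> (\<forall>a. a \<notin> {aINA, aAL} \<longrightarrow> H' a = H1 a)"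
    by (rule Cons.IH[OF rest _ _ _ a]) (use st us Cons.prems(2) in simp_all)
  with st show ?case by simp
qed simp

definition gst :: "nat \<Rightarrow> nat \<Rightarrow> nat \<Rightarrow> (nat set \<times> int) list \<Rightarrow> nat list \<Rightarrow> int \<Rightarrow> st \<Rightarrow> bool" where
  "gst n c k rs al y = (\<lambda>(X, H, inp). rdb n c rs X H \<and> ainv n al X H \<and> X rK = int k \<and> X rYES = y \<and>
     H aVAL = (\<lambda>_. 0))"

definition pst :: "nat \<Rightarrow> nat \<Rightarrow> nat \<Rightarrow> (nat set \<times> int) list \<Rightarrow> int \<Rightarrow> nat \<Rightarrow> nat list \<Rightarrow> nat \<Rightarrow> st \<Rightarrow> bool" where
  "pst n c k rs y i al cnt s \<longleftrightarrow> gst n c k rs al y s \<and> fst s rQ = int (c * i) \<and> fst s rR = int i \<and>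
     fst s rJ = int (length rs) - int i \<and> fst s rCNT = int cnt"

lemma slots_count:
  assumes "ainv n al X H" "distinct (filter (\<lambda>u. u \<noteq> n) sl)"
  shows "length (filter (\<lambda>u. \<not> H aINA u > 0) sl) = card (set sl - {n} - set al)"
proof -
  have "filter (\<lambda>u. \<not> H aINA u > 0) sl = filter (\<lambda>u. \<not> H aINA u > 0) (filter (\<lambda>u. u \<noteq> n) sl)"
    using assms(1) by (auto simp: ainv_def intro: filter_cong)
  then have "distinct (filter (\<lambda>u. \<not> H aINA u > 0) sl)" using assms(2) by (metis distinct_filter)
  moreover have "set (filter (\<lambda>u. \<not> H aINA u > 0) sl) = set sl - {n} - set al"
    using assms(1) by (auto simp: ainv_def)
  ultimately show ?thesis by (metis distinct_card)
qed

lemma pass_body_step: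
  assumes pst: "pst n c k rs y i al cnt (X, H, inp)" and i: "i < length rs" and s: "s > 0"
  shows "\<exists>al'. pst n c k rs y (Suc i) al'
      (if coef rs (fst (rs ! i)) \<noteq> 0 \<and> card (fst (rs ! i) - set al) \<ge> s then Suc cnt else cnt)
      (ev (pass_body c s) (X, H, inp)) \<and>
    set al' = (if coef rs (fst (rs ! i)) \<noteq> 0 \<and> card (fst (rs ! i) - set al) \<ge> s
      then set al \<union> fst (rs ! i) else set al)"
proof -
  let ?S = "fst (rs ! i)"
  have r: "rdb n c rs X H" and a: "ainv n al X H" and X: "X rK = int k" "X rYES = y" "H aVAL = (\<lambda>_. 0)"
    "X rQ = int (c * i)" "X rR = int i" "X rJ = int (length rs) - int i" "X rCNT = int cnt"
    using pst by (auto simp: pst_def gst_def)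
  have X1: "X rONE = 1" "X rZERO = 0" "X rN = int (length rs)" using r by (auto simp: rdb_def)
  have co: "H aCOEF (nat (H aKEYA i)) = coef rs ?S" using r i by (simp add: rdb_def)
  from r i have "slots_ok n c (H aSLOT) (c * i) ?S" by (simp add: rdb_def)
  then obtain sl where sl: "length sl = c" "\<And>j. j < c \<Longrightarrow> H aSLOT (c * i + j) = int (sl ! j)"
    "?S = set sl - {n}" "distinct (filter (\<lambda>u. u \<noteq> n) sl)" unfolding slots_ok_def by auto
  obtain X1 H1 inp1 where e1: "ev (seq_list (replicate c count_slot)) (X(rT3 := 0), H, inp) = (X1, H1, inp1)"
    by (metis prod_cases3)
  have "inp1 = inp \<and> H1 = H \<and> X1 rQ = int (c * i + length sl) \<and>
    X1 rT3 = (X(rT3 := 0)) rT3 + int (length (filter (\<lambda>u. \<not> H aINA u > 0) sl)) \<and>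
    (\<forall>j. j \<notin> {rQ, rT1, rT2, rT3} \<longrightarrow> X1 j = (X(rT3 := 0)) j)"
    by (rule ev_count_slots[OF e1[folded sl(1)]]) (use sl X X1 in simp_all)
  then have c1: "inp1 = inp" "H1 = H" "X1 rQ = int (c * i + c)" "X1 rT3 = int (card (?S - set al))"
    "\<forall>j. j \<notin> {rQ, rT1, rT2, rT3} \<longrightarrow> X1 j = X j"
    by (simp_all add: slots_count[OF a sl(4)] sl(1,3))
  let ?t = "if coef rs ?S > 0 then coef rs ?S else - coef rs ?S"
  let ?X2 = "X1(rT1 := ?t, rT2 := int s - 1, rT3 := int (card (?S - set al)) - (int s - 1))"
  define mark where "mark = IfPos rT1 (IfPos rT3 (Op (OConst rT2 (int c)) ;; Op (OSub rQ rQ rT2) ;;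
      seq_list (replicate c mark_slot) ;; Op (OAdd rCNT rCNT rONE)) Skip) Skip"
  have two: "ev (Op (OLoad rT1 aKEYA rR) ;; Op (OLoad rT1 aCOEF rT1) ;; IfPos rT1 Skip (Op (OSub rT1 rZERO rT1)) ;;
    Op (OConst rT2 (int s - 1)) ;; Op (OSub rT3 rT3 rT2)) (X1, H, inp) = (?X2, H, inp)"
    using c1 X X1 co by (simp add: fun_eq_iff)
  obtain X3 H3 inp3 where e3: "ev mark (?X2, H, inp) = (X3, H3, inp3)" by (metis prod_cases3)
  have final: "ev (pass_body c s) (X, H, inp) = (X3(rR := X3 rR + X3 rONE, rJ := X3 rJ - X3 rONE), H3, inp3)"
  proof -
    have "ev (pass_body c s) (X, H, inp) = ev (Op (OAdd rR rR rONE) ;; Op (OSub rJ rJ rONE)) (ev mark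
      (ev (Op (OLoad rT1 aKEYA rR) ;; Op (OLoad rT1 aCOEF rT1) ;; IfPos rT1 Skip (Op (OSub rT1 rZERO rT1)) ;;
      Op (OConst rT2 (int s - 1)) ;; Op (OSub rT3 rT3 rT2)) (X1, H, inp)))"
      unfolding pass_body_def mark_def[symmetric] using e1 c1(1,2)
      by (simp del: op_ev.simps(4) fun_upd_apply)
    then show ?thesis unfolding two e3 by simp
  qed
  show ?thesis
  proof (cases "coef rs ?S \<noteq> 0 \<and> card (?S - set al) \<ge> s")
    case True
    obtain X4 H4 inp4 where e4: "ev (seq_list (replicate c mark_slot))
        (?X2(rT2 := int c, rQ := int (c * i)), H, inp) = (X4, H4, inp4)" by (metis prod_cases3)
    have e4': "ev (seq_list (replicate (length sl) mark_slot))
        (?X2(rT2 := int c, rQ := int (c * i)), H, inp) = (X4, H4, inp4)"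
      using e4 by (simp only: sl(1))
    have "inp4 = inp \<and> X4 rQ = int (c * i + length sl) \<and> ainv n (add_new n al sl) X4 H4 \<and>
      (\<forall>j. j \<notin> {rQ, rT1, rT2, rAN} \<longrightarrow> X4 j = (?X2(rT2 := int c, rQ := int (c * i))) j) \<and>
      (\<forall>a. a \<notin> {aINA, aAL} \<longrightarrow> H4 a = H a)"
      by (rule ev_mark_slots[OF e4']) (use sl X1 X c1 a in \<open>simp_all add: ainv_def\<close>)
    then have m: "inp4 = inp" "X4 rQ = int (c * i + c)" "ainv n (add_new n al sl) X4 H4"
      "\<forall>j. j \<notin> {rQ, rT1, rT2, rT3, rAN} \<longrightarrow> X4 j = X j" "\<forall>a. a \<notin> {aINA, aAL} \<longrightarrow> H4 a = H a"
      using c1 sl(1) by simp_all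
    have "ev mark (?X2, H, inp) = (X4(rCNT := X4 rCNT + X4 rONE), H4, inp4)"
      using True s c1(3) e4 unfolding mark_def by (simp add: fun_upd_twist)
    with e3 have 3: "X3 = X4(rCNT := X4 rCNT + X4 rONE)" "H3 = H4" "inp3 = inp4" by simp_all
    have "pst n c k rs y (Suc i) (add_new n al sl) (Suc cnt) (ev (pass_body c s) (X, H, inp))"
      unfolding final 3 pst_def gst_def using m X X1
      by (auto simp: ainv_def intro!: rdb_cong[OF r])
    with True show ?thesis by (auto simp: set_add_new sl(3))
  next
    case False
    then have "ev mark (?X2, H, inp) = (?X2, H, inp)" using s unfolding mark_def by auto
    with e3 have 3: "X3 = ?X2" "H3 = H" "inp3 = inp" by simp_all
    have "pst n c k rs y (Suc i) al cnt (ev (pass_body c s) (X, H, inp))"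
      unfolding final 3 pst_def gst_def using c1 X X1 a
      by (auto simp: ainv_def intro!: rdb_cong[OF r])
    with False show ?thesis by auto
  qed
qed

section \<open>From the marked monomials of a round to disjoint blocks\<close>

definition bounded_out :: "(nat set \<times> int) list \<Rightarrow> nat set \<Rightarrow> nat \<Rightarrow> bool" where
  "bounded_out rs A s \<longleftrightarrow> (\<forall>p\<in>set rs. coef rs (fst p) \<noteq> 0 \<longrightarrow> card (fst p - A) \<le> s)"

definition above :: "nat \<Rightarrow> (nat set \<times> int) list \<Rightarrow> nat \<Rightarrow> bool" where
  "above n rs k \<longleftrightarrow> (\<exists>\<phi>\<in>cube {..<n}. fpoly rs \<phi> \<ge> coef rs {} + int k)"

definition blocks :: "(nat set \<times> int) list \<Rightarrow> nat \<Rightarrow> nat set \<Rightarrow> nat set list \<Rightarrow> bool" where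
  "blocks rs s A Ts \<longleftrightarrow> distinct Ts \<and> pairwise disjnt (set Ts) \<and>
     (\<forall>T\<in>set Ts. card T = s \<and> T \<inter> A = {} \<and> (\<exists>S\<in>fst ` set rs. coef rs S \<noteq> 0 \<and> S - A = T))"

lemma blocks_above:
  assumes "\<forall>p\<in>set rs. fst p \<subseteq> {..<n}" "s > 0" "bounded_out rs A s"
    and "blocks rs s A Ts" "k \<le> length Ts"
  shows "above n rs k"
proof -
  interpret f: fourier "{..<n}" "fst ` set rs" "coef rs" A s
    using assms(1-3) by unfold_locales (auto simp: bounded_out_def)
  have P: "f.P = fpoly rs" by (rule ext) (simp add: f.P_def fpoly_eq_sum)
  have "\<forall>T\<in>set Ts. f.block T" "pairwise disjnt (set Ts)" "distinct Ts"
    using assms(4) by (auto simp: blocks_def f.block_def)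
  moreover have "(\<Sum>x\<in>cube {..<n}. f.P x) = 2 ^ card {..<n} * coef rs {}"
    unfolding P by (rule sum_fpoly) (use assms(1) in auto)
  ultimately have "\<exists>x\<in>cube {..<n}. f.P x \<ge> coef rs {} + int (length Ts)"
    by (rule f.exists_above_mean)
  then obtain x where x: "x \<in> cube {..<n}" "coef rs {} + int (length Ts) \<le> fpoly rs x"
    unfolding P ..
  then have "coef rs {} + int k \<le> fpoly rs x" using assms(5) by linarith
  with x(1) show ?thesis by (auto simp: above_def simp del: PiE_iff)
qed

lemma runs_scan:
  assumes "straight body"
    and "\<And>i X H inp. i < m \<Longrightarrow> I i (X, H, inp) \<Longrightarrow> X rJ > 0 \<and> I (Suc i) (ev body (X, H, inp))"
    and "\<And>X H inp. I m (X, H, inp) \<Longrightarrow> \<not> X rJ > 0"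
    and "I 0 (X(rQ := 0, rR := 0, rJ := X rN + X rZERO), H, inp)"
  shows "runs (scan body) (X, H, inp) (m * (max_time body + 3) + 6) (I m)"
proof -
  have loop: "runs (WhilePos rJ body) s (m * (max_time body + 3) + 3) (I m)" if "I 0 s" for s
  proof (rule runs_WhilePos)
    show "I 0 s" by (rule that)
    show "fst s rJ > 0 \<and> runs body s (max_time body) (I (Suc i))" if "i < m" "I i s" for i s
      using assms(2)[of i "fst s" "fst (snd s)" "snd (snd s)"] that runs_straight[OF assms(1)] by simp
    show "\<not> fst s rJ > 0" if "I m s" for s
      using assms(3)[of "fst s" "fst (snd s)" "snd (snd s)"] that by simp
  qed
  have "runs (scan body) (X, H, inp) (max_time (Op (OConst rQ 0)) + (max_time (Op (OConst rR 0)) +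
      (max_time (Op (OAdd rJ rN rZERO)) + (m * (max_time body + 3) + 3)))) (I m)"
    unfolding scan_def using loop[OF assms(4)] by (intro runs_Seq_straight) simp_all
  then show ?thesis by (rule runs_mono) simp_all
qed

lemma straight_pass_body: "straight (pass_body c s)"
  by (simp add: pass_body_def count_slot_def mark_slot_def)

text \<open>The monomial has at most \<open>s\<close> variables outside \<open>A\<close>. If at
  least \<open>s\<close> remain outside the larger set \<open>B\<close>, they are all of them, so it
  avoids the earlier blocks. Records repeating a marked set have nothing left outside and are not
  taken again.\<close>

lemma blocks_step:
  assumes V: "\<forall>p\<in>set rs. fst p \<subseteq> {..<n}" and s: "s > 0" and b: "bounded_out rs A s"
    and bl: "blocks rs s A Ts" and p: "p \<in> set rs" "coef rs (fst p) \<noteq> 0"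
    and B: "B = A \<union> \<Union> (set Ts)" and big: "card (fst p - B) \<ge> s"
  shows "blocks rs s A (Ts @ [fst p - B])" "B \<union> fst p = A \<union> \<Union> (set (Ts @ [fst p - B]))"
    "card (fst p - B) = s"
proof -
  have fin: "finite (fst p)" using V p(1) finite_subset[of "fst p" "{..<n}"] by simp
  have sub: "fst p - B \<subseteq> fst p - A" using B by auto
  have le: "card (fst p - A) \<le> s" using b p by (auto simp: bounded_out_def)
  have eq: "fst p - B = fst p - A"
    by (rule card_subset_eq[OF _ sub]) (use fin le big card_mono[OF _ sub] in auto)
  show c: "card (fst p - B) = s" using le big unfolding eq by simp
  have ne: "fst p - B \<noteq> {}" using c s by (metis card.empty less_irrefl)
  have disj: "\<forall>T\<in>set Ts. disjnt T (fst p - B)" using B by (auto simp: disjnt_def)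
  have "fst p - B \<notin> set Ts"
  proof
    assume "fst p - B \<in> set Ts"
    with disj have "disjnt (fst p - B) (fst p - B)" by blast
    with ne show False by (simp add: disjnt_def)
  qed
  moreover have "pairwise disjnt (set (Ts @ [fst p - B]))"
    using bl disj by (auto simp: blocks_def pairwise_insert disjnt_sym)
  moreover have "\<forall>T\<in>set (Ts @ [fst p - B]). card T = s \<and> T \<inter> A = {} \<and>
      (\<exists>S\<in>fst ` set rs. coef rs S \<noteq> 0 \<and> S - A = T)"
    using bl c p eq B unfolding blocks_def by auto
  ultimately show "blocks rs s A (Ts @ [fst p - B])" using bl unfolding blocks_def by simp
  show "B \<union> fst p = A \<union> \<Union> (set (Ts @ [fst p - B]))" using B by auto
qed

text \<open>The clause \<open>length Ts \<le> i\<close> yields a bound on \<open>A\<close> in terms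
  of the number of records, independent of \<open>k\<close>; the cost of a single assignment in the
  search relies on it.\<close>

definition pass_inv :: "nat \<Rightarrow> nat \<Rightarrow> nat \<Rightarrow> (nat set \<times> int) list \<Rightarrow> int \<Rightarrow> nat \<Rightarrow> nat list \<Rightarrow> nat \<Rightarrow> st \<Rightarrow> bool" where
  "pass_inv n c k rs y s al0 i st \<longleftrightarrow> (\<exists>al Ts. pst n c k rs y i al (length Ts) st \<and>
     blocks rs s (set al0) Ts \<and> set al = set al0 \<union> \<Union> (set Ts) \<and>
     card (set al) = card (set al0) + s * length Ts \<and> length Ts \<le> i \<and>
     (\<forall>j<i. coef rs (fst (rs ! j)) \<noteq> 0 \<longrightarrow> card (fst (rs ! j) - set al) < s))"

lemma pass_inv_step:
  assumes V: "\<forall>p\<in>set rs. fst p \<subseteq> {..<n}" and s: "s > 0"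
    and b: "bounded_out rs (set al0) s"
    and i: "i < length rs" and inv: "pass_inv n c k rs y s al0 i (X, H, inp)"
  shows "X rJ > 0 \<and> pass_inv n c k rs y s al0 (Suc i) (ev (pass_body c s) (X, H, inp))"
proof -
  let ?S = "fst (rs ! i)"
  from inv obtain al Ts where *: "pst n c k rs y i al (length Ts) (X, H, inp)"
    "blocks rs s (set al0) Ts" "set al = set al0 \<union> \<Union> (set Ts)"
    "card (set al) = card (set al0) + s * length Ts" "length Ts \<le> i"
    "\<forall>j<i. coef rs (fst (rs ! j)) \<noteq> 0 \<longrightarrow> card (fst (rs ! j) - set al) < s"
    unfolding pass_inv_def by blast
  have mem: "rs ! i \<in> set rs" using i by simp
  have fin: "finite (fst (rs ! j))" if "j < length rs" for j
    using V nth_mem[OF that] finite_subset[of "fst (rs ! j)" "{..<n}"] by simp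
  have "X rJ > 0" using *(1) i by (simp add: pst_def)
  obtain al' where al': "pst n c k rs y (Suc i) al'
      (if coef rs ?S \<noteq> 0 \<and> card (?S - set al) \<ge> s then Suc (length Ts) else length Ts)
      (ev (pass_body c s) (X, H, inp))"
    "set al' = (if coef rs ?S \<noteq> 0 \<and> card (?S - set al) \<ge> s then set al \<union> ?S else set al)"
    using pass_body_step[OF *(1) i s] by blast
  have "pass_inv n c k rs y s al0 (Suc i) (ev (pass_body c s) (X, H, inp))"
  proof (cases "coef rs ?S \<noteq> 0 \<and> card (?S - set al) \<ge> s")
    case True
    note st = blocks_step[OF V s b *(2) mem conjunct1[OF True] *(3) conjunct2[OF True]]
    have set': "set al' = set al \<union> ?S" using al'(2) True by simp
    have "card (set al') = card (set al) + card (?S - set al)"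
    proof -
      have "card (set al \<union> (?S - set al)) = card (set al) + card (?S - set al)"
        by (rule card_Un_disjoint) (use fin[OF i] in auto)
      then show ?thesis unfolding set' by simp
    qed
    then have card: "card (set al') = card (set al0) + s * length (Ts @ [?S - set al])"
      using *(4) st(3) by simp
    have small: "card (fst (rs ! j) - set al') < s" if "j < Suc i" "coef rs (fst (rs ! j)) \<noteq> 0" for j
    proof (cases "j = i")
      case True
      then have "fst (rs ! j) - set al' = {}" unfolding set' by auto
      then show ?thesis using s by (metis card.empty)
    next
      case False
      then have "j < i" using that by simp
      have "card (fst (rs ! j) - set al') \<le> card (fst (rs ! j) - set al)"
        by (rule card_mono) (use fin[of j] \<open>j < i\<close> i set' in auto)
      also have "\<dots> < s" using *(6) \<open>j < i\<close> that by simp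
      finally show ?thesis .
    qed
    show ?thesis unfolding pass_inv_def
      by (rule exI[of _ al'], rule exI[of _ "Ts @ [?S - set al]"])
        (use al'(1) True st set' card small *(5) in simp)
  next
    case False
    have "set al' = set al" by (subst al'(2)) (rule if_not_P[OF False])
    moreover have "card (?S - set al) < s" if "coef rs ?S \<noteq> 0" using False that by simp
    ultimately show ?thesis unfolding pass_inv_def
      by (intro exI[of _ al'] exI[of _ Ts]) (use al'(1) False * in \<open>auto simp: less_Suc_eq\<close>)
  qed
  with \<open>X rJ > 0\<close> show ?thesis by simp
qed

lemma runs_pass:
  assumes V: "\<forall>p\<in>set rs. fst p \<subseteq> {..<n}" and s: "s > 0"
    and b: "bounded_out rs (set al) s" and g: "gst n c k rs al y st"
  shows "runs (pass c s) st (length rs * (max_time (pass_body c s) + 3) + 12)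
    (\<lambda>st'. \<exists>al' cnt. gst n c k rs al' (if k \<le> cnt then 1 else y) st' \<and> bounded_out rs (set al') (s - 1) \<and>
       length al' = length al + s * cnt \<and> cnt \<le> length rs \<and> (k \<le> cnt \<longrightarrow> above n rs k))"
    (is "runs _ _ _ ?Q")
proof -
  obtain X H inp where st: "st = (X, H, inp)" by (metis prod_cases3)
  have r: "rdb n c rs X H" and a: "ainv n al X H" using g by (auto simp: st gst_def)
  have 0: "pass_inv n c k rs y s al 0 (X(rCNT := 0, rQ := 0, rR := 0, rJ := X rN + X rZERO), H, inp)"
    unfolding pass_inv_def
  proof (rule exI[of _ al], rule exI[of _ "[]"], intro conjI)
    show "pst n c k rs y 0 al (length []) (X(rCNT := 0, rQ := 0, rR := 0, rJ := X rN + X rZERO), H, inp)"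
      using g r unfolding pst_def gst_def st
      by (auto simp: ainv_def rdb_def)
  qed (auto simp: blocks_def)
  have scan: "runs (scan (pass_body c s)) (X(rCNT := 0), H, inp)
      (length rs * (max_time (pass_body c s) + 3) + 6) (pass_inv n c k rs y s al (length rs))"
  proof (rule runs_scan[OF straight_pass_body])
    show "X rJ > 0 \<and> pass_inv n c k rs y s al (Suc i) (ev (pass_body c s) (X, H, inp))"
      if "i < length rs" "pass_inv n c k rs y s al i (X, H, inp)" for i X H inp
      by (rule pass_inv_step[OF V s b that])
    show "\<not> X rJ > 0" if "pass_inv n c k rs y s al (length rs) (X, H, inp)" for X H inp
      using that unfolding pass_inv_def pst_def by force
    have eq: "(X(rCNT := 0)) rN + (X(rCNT := 0)) rZERO = X rN + X rZERO" by simp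
    show "pass_inv n c k rs y s al 0
      ((X(rCNT := 0))(rQ := 0, rR := 0, rJ := (X(rCNT := 0)) rN + (X(rCNT := 0)) rZERO), H, inp)"
      unfolding eq by (rule 0)
  qed
  have fin: "runs (Op (OSub rT1 rK rCNT) ;; IfPos rT1 Skip (Op (OConst rYES 1))) st' 5 ?Q"
    if inv: "pass_inv n c k rs y s al (length rs) st'" for st'
  proof -
    obtain X H inp where st': "st' = (X, H, inp)" by (metis prod_cases3)
    from inv obtain al' Ts where *: "pst n c k rs y (length rs) al' (length Ts) (X, H, inp)"
      "blocks rs s (set al) Ts" "set al' = set al \<union> \<Union> (set Ts)"
      "card (set al') = card (set al) + s * length Ts" "length Ts \<le> length rs"
      "\<forall>j<length rs. coef rs (fst (rs ! j)) \<noteq> 0 \<longrightarrow> card (fst (rs ! j) - set al') < s"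
      unfolding pass_inv_def st' by blast
    have a': "ainv n al' X H" using *(1) by (simp add: pst_def gst_def)
    have len: "length al' = length al + s * length Ts"
      using *(4) a a' by (simp add: ainv_def distinct_card)
    have bd: "bounded_out rs (set al') (s - 1)"
      using *(6) unfolding bounded_out_def by (fastforce simp: in_set_conv_nth)
    have "k \<le> length Ts \<longrightarrow> above n rs k" using blocks_above[OF V s b *(2)] by blast
    moreover have "gst n c k rs al' (if k \<le> length Ts then 1 else y)
        (ev (Op (OSub rT1 rK rCNT) ;; IfPos rT1 Skip (Op (OConst rYES 1))) st')"
      using *(1) unfolding st' by (auto simp: pst_def gst_def ainv_def rdb_def)
    ultimately have "?Q (ev (Op (OSub rT1 rK rCNT) ;; IfPos rT1 Skip (Op (OConst rYES 1))) st')"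
      using len bd *(5) by blast
    then show ?thesis by (intro runs_straight) simp_all
  qed
  have "runs (scan (pass_body c s) ;; Op (OSub rT1 rK rCNT) ;; IfPos rT1 Skip (Op (OConst rYES 1)))
      (X(rCNT := 0), H, inp) ((length rs * (max_time (pass_body c s) + 3) + 6) + 5) ?Q"
    by (rule runs_Seq[OF scan fin])
  then have "runs (pass c s) st (max_time (Op (OConst rCNT 0)) +
      ((length rs * (max_time (pass_body c s) + 3) + 6) + 5)) ?Q"
    unfolding pass_def st by (intro runs_Seq_straight) simp_all
  then show ?thesis by (rule runs_mono) simp_all
qed

primrec pass_time :: "nat \<Rightarrow> nat \<Rightarrow> nat" where
  "pass_time c 0 = 0"
| "pass_time c (Suc s) = max_time (pass_body c (Suc s)) + 15 + pass_time c s"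

text \<open>A negative outcome means that each round marked at most \<open>k - 1\<close> monomials,
  and round \<open>s\<close> adds \<open>s\<close> variables for each of them. The bound by
  \<open>length rs\<close> holds whatever the outcome.\<close>

lemma runs_passes:
  assumes V: "\<forall>p\<in>set rs. fst p \<subseteq> {..<n}" and k: "k > 0"
    and "bounded_out rs (set al) s" "gst n c k rs al y st" "y \<in> {0, 1}"
  shows "runs (passes c s) st ((length rs + 1) * pass_time c s)
    (\<lambda>st'. \<exists>al' y'. gst n c k rs al' y' st' \<and> bounded_out rs (set al') 0 \<and> y' \<in> {0, 1} \<and>
       (y' = 1 \<longrightarrow> y = 1 \<or> above n rs k) \<and>
       (y' = 0 \<longrightarrow> y = 0 \<and> length al' \<le> length al + (\<Sum>{..s}) * (k - 1)) \<and>
       length al' \<le> length al + (\<Sum>{..s}) * length rs)"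
  using assms(3-)
proof (induction s arbitrary: al y st)
  case 0
  then show ?case by (intro runs_straight) auto
next
  case (Suc s)
  have le: "length rs * (max_time (pass_body c (Suc s)) + 3) + 12
      \<le> (length rs + 1) * (max_time (pass_body c (Suc s)) + 15)"
    by (simp add: algebra_simps)
  have "runs (passes c (Suc s)) st
      ((length rs + 1) * (max_time (pass_body c (Suc s)) + 15) + (length rs + 1) * pass_time c s)
    (\<lambda>st'. \<exists>al' y'. gst n c k rs al' y' st' \<and> bounded_out rs (set al') 0 \<and> y' \<in> {0, 1} \<and>
       (y' = 1 \<longrightarrow> y = 1 \<or> above n rs k) \<and>
       (y' = 0 \<longrightarrow> y = 0 \<and> length al' \<le> length al + (\<Sum>{..Suc s}) * (k - 1)) \<and>
       length al' \<le> length al + (\<Sum>{..Suc s}) * length rs)"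
    unfolding passes.simps
  proof (rule runs_Seq[OF runs_mono[OF runs_pass[OF V zero_less_Suc Suc.prems(1,2)] le]], assumption)
    fix st1
    assume "\<exists>al' cnt. gst n c k rs al' (if k \<le> cnt then 1 else y) st1 \<and> bounded_out rs (set al') (Suc s - 1) \<and>
       length al' = length al + Suc s * cnt \<and> cnt \<le> length rs \<and> (k \<le> cnt \<longrightarrow> above n rs k)"
    then obtain al1 cnt where 1: "gst n c k rs al1 (if k \<le> cnt then 1 else y) st1"
      "bounded_out rs (set al1) s" "length al1 = length al + Suc s * cnt" "cnt \<le> length rs"
      "k \<le> cnt \<longrightarrow> above n rs k" by auto
    have y1: "(if k \<le> cnt then 1 else y) \<in> {0, 1}" using Suc.prems(3) by simp
    have m1: "Suc s * cnt \<le> Suc s * (k - 1)" if "cnt < k" using that by (intro mult_left_mono) auto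
    have m2: "Suc s * cnt \<le> Suc s * length rs" using 1(4) by (intro mult_left_mono) auto
    show "runs (passes c s) st1 ((length rs + 1) * pass_time c s)
      (\<lambda>st'. \<exists>al' y'. gst n c k rs al' y' st' \<and> bounded_out rs (set al') 0 \<and> y' \<in> {0, 1} \<and>
       (y' = 1 \<longrightarrow> y = 1 \<or> above n rs k) \<and>
       (y' = 0 \<longrightarrow> y = 0 \<and> length al' \<le> length al + (\<Sum>{..Suc s}) * (k - 1)) \<and>
       length al' \<le> length al + (\<Sum>{..Suc s}) * length rs)"
    proof (rule runs_mono[OF Suc.IH[OF 1(2,1) y1] order_refl], elim exE conjE)
      fix st' al' y'
      assume 2: "gst n c k rs al' y' st'" "bounded_out rs (set al') 0" "y' \<in> {0, 1}"
        "y' = 1 \<longrightarrow> (if k \<le> cnt then 1 else y) = 1 \<or> above n rs k"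
        "y' = 0 \<longrightarrow> (if k \<le> cnt then 1 else y) = 0 \<and> length al' \<le> length al1 + (\<Sum>{..s}) * (k - 1)"
        "length al' \<le> length al1 + (\<Sum>{..s}) * length rs"
      show "\<exists>al' y'. gst n c k rs al' y' st' \<and> bounded_out rs (set al') 0 \<and> y' \<in> {0, 1} \<and>
       (y' = 1 \<longrightarrow> y = 1 \<or> above n rs k) \<and>
       (y' = 0 \<longrightarrow> y = 0 \<and> length al' \<le> length al + (\<Sum>{..Suc s}) * (k - 1)) \<and>
       length al' \<le> length al + (\<Sum>{..Suc s}) * length rs"
        by (rule exI[of _ al'], rule exI[of _ y'])
          (use 2 1(3,5) m1 m2 in \<open>auto simp: add_mult_distrib split: if_splits\<close>)
    qed
  qed
  then show ?case by (rule runs_mono) (simp_all add: algebra_simps)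
qed

section \<open>Exhaustive search\<close>

definition sign_slot :: com where
  "sign_slot = Op (OLoad rT1 aSLOT rQ) ;; Op (OLoad rT1 aVAL rT1) ;;
    IfPos rT1 (Op (OSub rT2 rZERO rT2)) Skip ;; Op (OAdd rQ rQ rONE)"

text \<open>Contributions are summed record by record, so equal sets need not be merged. Each
  product of signs is a sequence of negations of the contribution.\<close>

definition eval_body :: "nat \<Rightarrow> com" where
  "eval_body c = Op (OLoad rT2 aLC rR) ;; seq_list (replicate c sign_slot) ;; Op (OAdd rACC rACC rT2) ;;
    Op (OAdd rR rR rONE) ;; Op (OSub rJ rJ rONE)"

text \<open>The scan does not stop once the carry is absorbed. Since \<open>A\<close> is at most a
  constant times the number of records, the full scan costs no more than the evaluation, up to a
  constant.\<close>

definition incr_body :: com where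
  "incr_body = Op (OLoad rT1 aAL rR) ;;
    IfPos rGO (Op (OLoad rT2 aVAL rT1) ;;
      IfPos rT2 (Op (OStore aVAL rT1 rZERO)) (Op (OStore aVAL rT1 rONE) ;; Op (OConst rGO 0))) Skip ;;
    Op (OAdd rR rR rONE) ;; Op (OSub rJ rJ rONE)"

text \<open>The carry left at the end is 1 exactly on overflow; the last subtraction turns it into
  the loop condition of the search.\<close>

definition incr :: com where
  "incr = Op (OConst rGO 1) ;; Op (OConst rR 0) ;; Op (OAdd rJ rAN rZERO) ;; WhilePos rJ incr_body ;;
    Op (OSub rGO rONE rGO)"

definition brute_body :: "nat \<Rightarrow> com" where
  "brute_body c = Op (OConst rACC 0) ;; scan (eval_body c) ;;
    Op (OSub rT1 rACC rTGT) ;; IfPos rT1 (Op (OConst rYES 1)) Skip ;; incr"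

text \<open>The target is \<open>coef rs {} + k - 1\<close>, so that the strict positivity test in
  \<open>brute_body\<close> decides \<open>\<ge>\<close> for the threshold
  \<open>coef rs {} + k\<close>.\<close>

definition brute :: "nat \<Rightarrow> com" where
  "brute c = Op (OConst rT2 0) ;; Op (OLoad rTGT aCOEF rT2) ;; Op (OAdd rTGT rTGT rK) ;;
    Op (OSub rTGT rTGT rONE) ;; Op (OConst rGO 1) ;; WhilePos rGO (brute_body c)"

abbreviation valu :: "(nat \<Rightarrow> int) \<Rightarrow> nat \<Rightarrow> int" where
  "valu f \<equiv> \<lambda>u. if f u > 0 then -1 else 1"

lemma ev_sign_slots:
  assumes "ev (seq_list (replicate (length us) sign_slot)) (X, H, inp) = (X', H', inp')"
    and "X rONE = 1" "X rZERO = 0" "X rQ = int q" "\<And>j. j < length us \<Longrightarrow> H aSLOT (q + j) = int (us ! j)"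
  shows "inp' = inp \<and> H' = H \<and> X' rQ = int (q + length us) \<and>
    X' rT2 = X rT2 * (\<Prod>u\<leftarrow>us. valu (H aVAL) u) \<and> (\<forall>i. i \<notin> {rQ, rT1, rT2} \<longrightarrow> X' i = X i)"
  using assms
proof (induction us arbitrary: X q)
  case (Cons u us)
  obtain X1 H1 inp1 where s1: "ev sign_slot (X, H, inp) = (X1, H1, inp1)" by (metis prod_cases3)
  have u: "H aSLOT q = int u" using Cons.prems(5)[of 0] by simp
  have us: "H aSLOT (Suc q + j) = int (us ! j)" if "j < length us" for j
    using Cons.prems(5)[of "Suc j"] that by simp
  have st: "inp1 = inp" "H1 = H" "X1 rQ = int (Suc q)" "\<forall>i. i \<notin> {rQ, rT1, rT2} \<longrightarrow> X1 i = X i"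
    "X1 rT2 = X rT2 * valu (H aVAL) u"
    using s1 Cons.prems(2-4) u by (auto simp: sign_slot_def split: if_splits)
  have rest: "ev (seq_list (replicate (length us) sign_slot)) (X1, H, inp) = (X', H', inp')"
    using Cons.prems(1) s1 st by simp
  have "inp' = inp \<and> H' = H \<and> X' rQ = int (Suc q + length us) \<and>
    X' rT2 = X1 rT2 * (\<Prod>u\<leftarrow>us. valu (H aVAL) u) \<and> (\<forall>i. i \<notin> {rQ, rT1, rT2} \<longrightarrow> X' i = X1 i)"
    by (rule Cons.IH[OF rest]) (use st us Cons.prems(2,3) in simp_all)
  with st show ?case by (simp add: mult.assoc)
qed simp

lemma prod_list_slots:
  assumes "distinct (filter (\<lambda>u. u \<noteq> n) sl)" "y n = (1::int)"
  shows "(\<Prod>u\<leftarrow>sl. y u) = chi (set sl - {n}) y"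
proof -
  have "(\<Prod>u\<leftarrow>sl. y u) = (\<Prod>u\<leftarrow>filter (\<lambda>u. u \<noteq> n) sl. y u)"
    using assms(2) by (induction sl) auto
  also have "\<dots> = (\<Prod>u\<in>set (filter (\<lambda>u. u \<noteq> n) sl). y u)"
    by (rule prod.distinct_set_conv_list[OF assms(1), symmetric])
  also have "set (filter (\<lambda>u. u \<noteq> n) sl) = set sl - {n}" by auto
  finally show ?thesis by (simp add: chi_def)
qed

definition eval_inv :: "(nat set \<times> int) list \<Rightarrow> nat \<Rightarrow> (nat \<Rightarrow> int) \<Rightarrow> (nat \<Rightarrow> nat \<Rightarrow> int) \<Rightarrow> nat \<Rightarrow> st \<Rightarrow> bool" where
  "eval_inv rs c X0 H0 i = (\<lambda>(X, H, inp). H = H0 \<and> (\<forall>j. j \<notin> {rQ, rR, rJ, rT1, rT2, rACC} \<longrightarrow> X j = X0 j) \<and>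
     X rQ = int (c * i) \<and> X rR = int i \<and> X rJ = int (length rs) - int i \<and>
     X rACC = fpoly (take i rs) (valu (H0 aVAL)))"

lemma eval_inv_step:
  assumes r: "rdb n c rs X0 H0" and n: "\<not> H0 aVAL n > 0"
    and i: "i < length rs" and inv: "eval_inv rs c X0 H0 i (X, H, inp)"
  shows "X rJ > 0 \<and> eval_inv rs c X0 H0 (Suc i) (ev (eval_body c) (X, H, inp))"
proof -
  have X: "H = H0" "\<forall>j. j \<notin> {rQ, rR, rJ, rT1, rT2, rACC} \<longrightarrow> X j = X0 j" "X rQ = int (c * i)" "X rR = int i"
    "X rJ = int (length rs) - int i" "X rACC = fpoly (take i rs) (valu (H0 aVAL))"
    using inv by (auto simp: eval_inv_def)
  have X0: "X0 rONE = 1" "X0 rZERO = 0" using r by (auto simp: rdb_def)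
  have lc: "H0 aLC i = snd (rs ! i)" using r i by (simp add: rdb_def)
  from r i have "slots_ok n c (H0 aSLOT) (c * i) (fst (rs ! i))" by (simp add: rdb_def)
  then obtain sl where sl: "length sl = c" "\<And>j. j < c \<Longrightarrow> H0 aSLOT (c * i + j) = int (sl ! j)"
    "fst (rs ! i) = set sl - {n}" "distinct (filter (\<lambda>u. u \<noteq> n) sl)" unfolding slots_ok_def by auto
  obtain X1 H1 inp1 where e1: "ev (seq_list (replicate c sign_slot)) (X(rT2 := snd (rs ! i)), H0, inp) = (X1, H1, inp1)"
    by (metis prod_cases3)
  have "inp1 = inp \<and> H1 = H0 \<and> X1 rQ = int (c * i + length sl) \<and>
    X1 rT2 = (X(rT2 := snd (rs ! i))) rT2 * (\<Prod>u\<leftarrow>sl. valu (H0 aVAL) u) \<and>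
    (\<forall>j. j \<notin> {rQ, rT1, rT2} \<longrightarrow> X1 j = (X(rT2 := snd (rs ! i))) j)"
    by (rule ev_sign_slots[OF e1[folded sl(1)]]) (use sl X X0 in simp_all)
  moreover have "(\<Prod>u\<leftarrow>sl. valu (H0 aVAL) u) = chi (fst (rs ! i)) (valu (H0 aVAL))"
    unfolding sl(3) by (rule prod_list_slots[OF sl(4)]) (use n in simp)
  ultimately have c1: "inp1 = inp" "H1 = H0" "X1 rQ = int (c * i + c)"
    "X1 rT2 = snd (rs ! i) * chi (fst (rs ! i)) (valu (H0 aVAL))" "\<forall>j. j \<notin> {rQ, rT1, rT2} \<longrightarrow> X1 j = X j"
    by (simp_all add: sl(1))
  have "fpoly (take (Suc i) rs) y = fpoly (take i rs) y + snd (rs ! i) * chi (fst (rs ! i)) y" for y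
    using i by (simp add: take_Suc_conv_app_nth fpoly_def split_beta)
  moreover have "ev (eval_body c) (X, H, inp) = (X1(rACC := X1 rACC + X1 rT2, rR := X1 rR + X1 rONE, rJ := X1 rJ - X1 rONE), H0, inp)"
    using e1 c1(1,2) X(1,4) lc by (simp add: eval_body_def)
  ultimately show ?thesis using c1 X X0 i by (simp add: eval_inv_def)
qed

lemma runs_eval:
  assumes r: "rdb n c rs X H" and n: "\<not> H aVAL n > 0"
  shows "runs (scan (eval_body c)) (X(rACC := 0), H, inp) (length rs * (max_time (eval_body c) + 3) + 6)
    (eval_inv rs c X H (length rs))"
proof (rule runs_scan)
  show "straight (eval_body c)" by (simp add: eval_body_def sign_slot_def)
  show "Xa rJ > 0 \<and> eval_inv rs c X H (Suc i) (ev (eval_body c) (Xa, Ha, inp))"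
    if "i < length rs" "eval_inv rs c X H i (Xa, Ha, inp)" for i Xa Ha inp
    by (rule eval_inv_step[OF r n that])
  show "\<not> Xa rJ > 0" if "eval_inv rs c X H (length rs) (Xa, Ha, inp)" for Xa Ha inp
    using that by (simp add: eval_inv_def)
  have X: "X rONE = 1" "X rZERO = 0" "X rN = int (length rs)" using r by (auto simp: rdb_def)
  show "eval_inv rs c X H 0
    ((X(rACC := 0))(rQ := 0, rR := 0, rJ := (X(rACC := 0)) rN + (X(rACC := 0)) rZERO), H, inp)"
    using X by (simp add: eval_inv_def fpoly_def)
qed

section \<open>The binary counter over assignments of A\<close>

lemma set_encode_lessThan_Suc:
  "set_encode (B \<inter> {..<Suc i}) = set_encode (B \<inter> {..<i}) + (if i \<in> B then 2 ^ i else 0)"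
proof (cases "i \<in> B")
  case True
  then have "B \<inter> {..<Suc i} = insert i (B \<inter> {..<i})" by (auto simp: less_Suc_eq)
  with True show ?thesis by (simp add: set_encode_insert)
next
  case False
  then have "B \<inter> {..<Suc i} = B \<inter> {..<i}" by (auto simp: less_Suc_eq)
  with False show ?thesis by simp
qed

lemma set_encode_less: "B \<subseteq> {..<a} \<Longrightarrow> set_encode B < 2 ^ a"
proof (induction a arbitrary: B)
  case (Suc a)
  have "B \<inter> {..<Suc a} = B" using Suc.prems by auto
  then have "set_encode B = set_encode (B \<inter> {..<a}) + (if a \<in> B then 2 ^ a else 0)"
    using set_encode_lessThan_Suc[of B a] by simp
  moreover have "set_encode (B \<inter> {..<a}) < 2 ^ a" by (rule Suc.IH) simp
  ultimately show ?case by simp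
qed simp

lemma set_decode_lessThan: "b < 2 ^ a \<Longrightarrow> set_decode b \<subseteq> {..<a}"
proof
  fix i assume b: "b < 2 ^ a" "i \<in> set_decode b"
  show "i \<in> {..<a}"
  proof (rule ccontr)
    assume "i \<notin> {..<a}"
    then have "(2::nat) ^ a \<le> 2 ^ i" by (intro power_increasing) auto
    with b show False by (simp add: set_decode_def)
  qed
qed

text \<open>The elements of \<open>B\<close> are positions in \<open>al\<close>, which makes
  \<open>set_encode B\<close> the number held by the counter.\<close>

definition val_bits :: "nat list \<Rightarrow> nat set \<Rightarrow> (nat \<Rightarrow> nat \<Rightarrow> int) \<Rightarrow> bool" where
  "val_bits al B H \<longleftrightarrow> (\<forall>u. H aVAL u > 0 \<longleftrightarrow> u \<in> nth al ` B)"

text \<open>\<open>rGO\<close> holds the carry of the binary counter.\<close>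

definition incr_inv :: "nat list \<Rightarrow> nat set \<Rightarrow> (nat \<Rightarrow> int) \<Rightarrow> (nat \<Rightarrow> nat \<Rightarrow> int) \<Rightarrow> nat \<Rightarrow> st \<Rightarrow> bool" where
  "incr_inv al B0 X0 H0 i = (\<lambda>(X, H, inp). (\<forall>j. j \<notin> {rR, rJ, rT1, rT2, rGO} \<longrightarrow> X j = X0 j) \<and>
     (\<forall>a. a \<noteq> aVAL \<longrightarrow> H a = H0 a) \<and> X rR = int i \<and> X rJ = int (length al) - int i \<and>
     (\<exists>B g. X rGO = int g \<and> g \<in> {0, 1} \<and> B \<subseteq> {..<length al} \<and> val_bits al B H \<and>
       set_encode (B \<inter> {..<i}) + g * 2 ^ i = set_encode (B0 \<inter> {..<i}) + 1 \<and> B - {..<i} = B0 - {..<i}))"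

lemma incr_inv_step:
  assumes a: "ainv n al X0 H0" and X0: "X0 rONE = 1" "X0 rZERO = 0"
    and i: "i < length al" and inv: "incr_inv al B0 X0 H0 i (X, H, inp)"
  shows "X rJ > 0 \<and> incr_inv al B0 X0 H0 (Suc i) (ev incr_body (X, H, inp))"
proof -
  obtain B g where X: "\<forall>j. j \<notin> {rR, rJ, rT1, rT2, rGO} \<longrightarrow> X j = X0 j" "\<forall>a. a \<noteq> aVAL \<longrightarrow> H a = H0 a"
    "X rR = int i" "X rJ = int (length al) - int i" "X rGO = int g"
    and g: "g \<in> {0, 1}" and B: "B \<subseteq> {..<length al}" "val_bits al B H"
    "set_encode (B \<inter> {..<i}) + g * 2 ^ i = set_encode (B0 \<inter> {..<i}) + 1" "B - {..<i} = B0 - {..<i}"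
    using inv by (auto simp: incr_inv_def)
  have dist: "distinct al" using a by (simp add: ainv_def)
  have al: "H aAL i = int (al ! i)" using a i X(2) by (simp add: ainv_def)
  have one: "X rONE = 1" "X rZERO = 0" using X(1) X0 by simp_all
  have iB: "i \<in> B \<longleftrightarrow> i \<in> B0"
  proof -
    have "i \<in> B - {..<i} \<longleftrightarrow> i \<in> B0 - {..<i}" using B(4) by simp
    then show ?thesis by simp
  qed
  have inj: "al ! i = al ! j \<longleftrightarrow> i = j" if "j \<in> B" for j
    using dist i B(1) that by (auto simp: nth_eq_iff_index_eq)
  have v: "H aVAL (al ! i) > 0 \<longleftrightarrow> i \<in> B" using B(2) inj by (auto simp: val_bits_def)
  have rest: "B' - {..<Suc i} = B0 - {..<Suc i}" if "B' - {i} = B - {i}" for B'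
  proof -
    have "B' - {..<Suc i} = (B' - {i}) - {..<i}" by (auto simp: less_Suc_eq)
    also have "\<dots> = (B - {..<i}) - {i}" using that by auto
    also have "\<dots> = B0 - {..<Suc i}" unfolding B(4) by (auto simp: less_Suc_eq)
    finally show ?thesis .
  qed
  have low: "B' \<inter> {..<i} = B \<inter> {..<i}" if "B' - {i} = B - {i}" for B' using that by auto
  have "incr_inv al B0 X0 H0 (Suc i) (ev incr_body (X, H, inp))"
  proof (cases "g = 0")
    case True
    have "set_encode (B \<inter> {..<Suc i}) + 0 * 2 ^ Suc i = set_encode (B0 \<inter> {..<Suc i}) + 1"
      using B(3) True iB by (simp add: set_encode_lessThan_Suc)
    then have *: "\<exists>B' g'. int g = int g' \<and> g' \<in> {0, 1} \<and> B' \<subseteq> {..<length al} \<and> val_bits al B' H \<and>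
       set_encode (B' \<inter> {..<Suc i}) + g' * 2 ^ Suc i = set_encode (B0 \<inter> {..<Suc i}) + 1 \<and>
       B' - {..<Suc i} = B0 - {..<Suc i}"
      using True B rest[of B] by (intro exI[of _ B] exI[of _ 0]) simp
    have "ev incr_body (X, H, inp) = (X(rT1 := int (al ! i), rR := int i + 1, rJ := X rJ - 1), H, inp)"
      using X(3,5) True one al by (simp add: incr_body_def)
    then show ?thesis using X * by (simp add: incr_inv_def)
  next
    case False
    then have g1: "g = 1" using g by simp
    show ?thesis
    proof (cases "i \<in> B")
      case True
      let ?B = "B - {i}" and ?H = "H(aVAL := (H aVAL)(al ! i := 0))"
      have eB: "?B \<inter> {..<Suc i} = B \<inter> {..<i}" by (auto simp: less_Suc_eq)
      \<comment> \<open>The digit 1 and the incoming carry are worth \<open>2 ^ i\<close> each and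
        become a carry worth \<open>2 ^ Suc i\<close>.\<close>
      have "set_encode (?B \<inter> {..<Suc i}) + 1 * 2 ^ Suc i = set_encode (B0 \<inter> {..<Suc i}) + 1"
        unfolding eB using B(3) g1 True iB by (simp add: set_encode_lessThan_Suc)
      moreover have "val_bits al ?B ?H"
        unfolding val_bits_def
      proof
        fix u
        show "?H aVAL u > 0 \<longleftrightarrow> u \<in> nth al ` ?B"
          using B(2) inj by (cases "u = al ! i") (auto simp: val_bits_def)
      qed
      ultimately have *: "\<exists>B' g'. int g = int g' \<and> g' \<in> {0, 1} \<and> B' \<subseteq> {..<length al} \<and> val_bits al B' ?H \<and>
         set_encode (B' \<inter> {..<Suc i}) + g' * 2 ^ Suc i = set_encode (B0 \<inter> {..<Suc i}) + 1 \<and>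
         B' - {..<Suc i} = B0 - {..<Suc i}"
        using g1 B(1) rest[of ?B] by (intro exI[of _ ?B] exI[of _ 1]) auto
      have "H aVAL (al ! i) > 0" using v True by simp
      then have "ev incr_body (X, H, inp)
          = (X(rT1 := int (al ! i), rT2 := H aVAL (al ! i), rR := int i + 1, rJ := X rJ - 1), ?H, inp)"
        using X(3,5) g1 one al by (simp add: incr_body_def)
      then show ?thesis using X * by (simp add: incr_inv_def)
    next
      case False
      let ?B = "insert i B" and ?H = "H(aVAL := (H aVAL)(al ! i := 1))"
      have eB: "?B \<inter> {..<i} = B \<inter> {..<i}" by auto
      have "set_encode (?B \<inter> {..<Suc i}) + 0 * 2 ^ Suc i = set_encode (B0 \<inter> {..<Suc i}) + 1"
        unfolding set_encode_lessThan_Suc[of ?B] set_encode_lessThan_Suc[of B0] eB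
        using B(3) g1 False iB by simp
      moreover have "val_bits al ?B ?H"
        unfolding val_bits_def
      proof
        fix u
        show "?H aVAL u > 0 \<longleftrightarrow> u \<in> nth al ` ?B"
          using B(2) by (cases "u = al ! i") (auto simp: val_bits_def)
      qed
      ultimately have *: "\<exists>B' g'. 0 = int g' \<and> g' \<in> {0, 1} \<and> B' \<subseteq> {..<length al} \<and> val_bits al B' ?H \<and>
         set_encode (B' \<inter> {..<Suc i}) + g' * 2 ^ Suc i = set_encode (B0 \<inter> {..<Suc i}) + 1 \<and>
         B' - {..<Suc i} = B0 - {..<Suc i}"
        using B(1) i rest[of ?B] False by (intro exI[of _ ?B] exI[of _ 0]) auto
      have "\<not> H aVAL (al ! i) > 0" using v False by simp
      then have "ev incr_body (X, H, inp)
          = (X(rT1 := int (al ! i), rT2 := H aVAL (al ! i), rGO := 0, rR := int i + 1, rJ := X rJ - 1), ?H, inp)"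
        using X(3,5) g1 one al by (simp add: incr_body_def)
      then show ?thesis using X * by (simp add: incr_inv_def)
    qed
  qed
  then show ?thesis using X(4) i by simp
qed

lemma runs_incr:
  assumes a: "ainv n al X H" and X: "X rONE = 1" "X rZERO = 0"
    and b: "b < 2 ^ length al" "val_bits al (set_decode b) H"
  shows "runs incr (X, H, inp) (length al * (max_time incr_body + 3) + 7)
    (\<lambda>(X', H', inp'). (\<forall>j. j \<notin> {rR, rJ, rT1, rT2, rGO} \<longrightarrow> X' j = X j) \<and> (\<forall>a. a \<noteq> aVAL \<longrightarrow> H' a = H a) \<and>
      (if Suc b < 2 ^ length al then X' rGO = 1 \<and> val_bits al (set_decode (Suc b)) H' else X' rGO = 0))"
    (is "runs _ _ _ ?G")
proof -
  let ?B0 = "set_decode b" and ?m = "length al" and ?X = "X(rGO := 1, rR := 0, rJ := X rAN + X rZERO)"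
  have B0: "?B0 \<subseteq> {..<?m}" by (rule set_decode_lessThan[OF b(1)])
  have 0: "incr_inv al ?B0 X H 0 (?X, H, inp)"
    unfolding incr_inv_def using a X b B0
    by (auto simp: ainv_def intro!: exI[of _ ?B0] exI[of _ 1])
  have st: "straight incr_body" by (simp add: incr_body_def)
  have loop: "runs (WhilePos rJ incr_body) (?X, H, inp) (?m * (max_time incr_body + 3) + 3) (incr_inv al ?B0 X H ?m)"
  proof (rule runs_WhilePos)
    show "incr_inv al ?B0 X H 0 (?X, H, inp)" by (rule 0)
    show "fst s rJ > 0 \<and> runs incr_body s (max_time incr_body) (incr_inv al ?B0 X H (Suc i))"
      if "i < ?m" "incr_inv al ?B0 X H i s" for i s
      using incr_inv_step[OF a X that(1), of ?B0 "fst s" "fst (snd s)" "snd (snd s)"] that(2)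
        runs_straight[OF st] by simp
    show "\<not> fst s rJ > 0" if "incr_inv al ?B0 X H ?m s" for s
      using that by (auto simp: incr_inv_def)
  qed
  have fin: "runs (Op (OSub rGO rONE rGO)) s 1 ?G" if inv: "incr_inv al ?B0 X H ?m s" for s
  proof -
    obtain X' H' inp' where s: "s = (X', H', inp')" by (metis prod_cases3)
    from inv obtain B g where X': "\<forall>j. j \<notin> {rR, rJ, rT1, rT2, rGO} \<longrightarrow> X' j = X j" "\<forall>a. a \<noteq> aVAL \<longrightarrow> H' a = H a"
      "X' rGO = int g" "g \<in> {0, 1}" and B: "B \<subseteq> {..<?m}" "val_bits al B H'"
      "set_encode (B \<inter> {..<?m}) + g * 2 ^ ?m = set_encode (?B0 \<inter> {..<?m}) + 1"
      unfolding incr_inv_def s by auto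
    have "B \<inter> {..<?m} = B" "?B0 \<inter> {..<?m} = ?B0" using B(1) B0 by auto
    \<comment> \<open>As \<open>set_encode B < 2 ^ length al\<close>, a carry is left exactly when
      \<open>Suc b\<close> reaches \<open>2 ^ length al\<close>.\<close>
    with B(3) have eq: "set_encode B + g * 2 ^ ?m = Suc b" by simp
    have lt: "set_encode B < 2 ^ ?m" by (rule set_encode_less[OF B(1)])
    have one: "X' rONE = 1" using X' X by simp
    have "?G (X'(rGO := 1 - int g), H', inp')"
    proof (cases "Suc b < 2 ^ ?m")
      case True
      then have "g = 0" using eq X'(4) by auto
      then have "set_encode B = Suc b" using eq by simp
      then have "B = set_decode (Suc b)"
        using set_encode_inverse[of B] finite_subset[OF B(1)] by simp
      with B(2) \<open>g = 0\<close> True X' show ?thesis by simp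
    next
      case False
      then have "g = 1" using eq lt X'(4) by (cases "g = 0") auto
      with False X' show ?thesis by simp
    qed
    moreover have "ev (Op (OSub rGO rONE rGO)) s = (X'(rGO := 1 - int g), H', inp')"
      using one X'(3) by (simp add: s)
    ultimately have "?G (ev (Op (OSub rGO rONE rGO)) s)" by (simp only:)
    then show ?thesis by (intro runs_straight) simp_all
  qed
  have "runs (WhilePos rJ incr_body ;; Op (OSub rGO rONE rGO)) (?X, H, inp)
      ((?m * (max_time incr_body + 3) + 3) + 1) ?G"
    by (rule runs_Seq[OF loop fin])
  then have "runs incr (X, H, inp) (max_time (Op (OConst rGO 1)) + (max_time (Op (OConst rR 0)) +
      (max_time (Op (OAdd rJ rAN rZERO)) + ((?m * (max_time incr_body + 3) + 3) + 1)))) ?G"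
    unfolding incr_def by (intro runs_Seq_straight) simp_all
  then show ?thesis by (rule runs_mono) simp_all
qed

section \<open>Trying all assignments of A\<close>

definition assign :: "nat list \<Rightarrow> nat \<Rightarrow> nat \<Rightarrow> int" where
  "assign al b u = (if u \<in> nth al ` set_decode b then -1 else 1)"

definition good :: "(nat set \<times> int) list \<Rightarrow> nat list \<Rightarrow> nat \<Rightarrow> nat \<Rightarrow> bool" where
  "good rs al k b \<longleftrightarrow> fpoly rs (assign al b) \<ge> coef rs {} + int k"

definition brute_inv :: "nat \<Rightarrow> nat \<Rightarrow> nat \<Rightarrow> (nat set \<times> int) list \<Rightarrow> nat list \<Rightarrow> nat \<Rightarrow> st \<Rightarrow> bool" where
  "brute_inv n c k rs al b = (\<lambda>(X, H, inp). rdb n c rs X H \<and> ainv n al X H \<and>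
     X rTGT = coef rs {} + int k - 1 \<and> X rYES = (if \<exists>b'<b. good rs al k b' then 1 else 0) \<and>
     (if b < 2 ^ length al then X rGO = 1 \<and> val_bits al (set_decode b) H else X rGO = 0))"

definition brute_time :: "nat \<Rightarrow> nat" where
  "brute_time c = max_time (eval_body c) + max_time incr_body + 20"

lemma runs_brute_body:
  assumes b: "b < 2 ^ length al" and inv: "brute_inv n c k rs al b (X, H, inp)"
  shows "runs (brute_body c) (X, H, inp) ((length rs + length al + 1) * brute_time c)
    (brute_inv n c k rs al (Suc b))"
proof -
  have r: "rdb n c rs X H" and a: "ainv n al X H" and X: "X rTGT = coef rs {} + int k - 1"
    "X rYES = (if \<exists>b'<b. good rs al k b' then 1 else 0)" and v: "val_bits al (set_decode b) H"
    using inv b by (auto simp: brute_inv_def)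
  have dec: "nth al ` set_decode b \<subseteq> set al" using set_decode_lessThan[OF b] by auto
  \<comment> \<open>The dummy is not in \<open>al\<close>, so the counter never changes its sign,
    which is 1.\<close>
  have n: "\<not> H aVAL n > 0" using v dec a by (auto simp: val_bits_def ainv_def)
  have val: "valu (H aVAL) = assign al b" using v by (auto simp: val_bits_def assign_def)
  have test: "runs (Op (OSub rT1 rACC rTGT) ;; IfPos rT1 (Op (OConst rYES 1)) Skip ;; incr) s
      (max_time (Op (OSub rT1 rACC rTGT)) + (max_time (IfPos rT1 (Op (OConst rYES 1)) Skip) +
        (length al * (max_time incr_body + 3) + 7))) (brute_inv n c k rs al (Suc b))"
    if e: "eval_inv rs c X H (length rs) s" for s
  proof -
    obtain X1 H1 inp1 where s: "s = (X1, H1, inp1)" by (metis prod_cases3)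
    from e have X1: "H1 = H" "\<forall>j. j \<notin> {rQ, rR, rJ, rT1, rT2, rACC} \<longrightarrow> X1 j = X j"
      "X1 rACC = fpoly rs (assign al b)"
      unfolding s eval_inv_def by (auto simp: val[symmetric])
    obtain X2 H2 inp2 where s2: "ev (IfPos rT1 (Op (OConst rYES 1)) Skip) (ev (Op (OSub rT1 rACC rTGT)) s)
        = (X2, H2, inp2)" by (metis prod_cases3)
    have X2: "H2 = H" "\<forall>j. j \<notin> {rQ, rR, rJ, rT1, rT2, rACC, rYES} \<longrightarrow> X2 j = X j"
      "X2 rYES = (if \<exists>b'<Suc b. good rs al k b' then 1 else 0)"
      using s2 X1 X by (auto simp: s good_def less_Suc_eq split: if_splits)
    have r2: "rdb n c rs X2 H" by (rule rdb_cong[OF r]) (use X2 in simp_all)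
    have a2: "ainv n al X2 H" using a X2 by (simp add: ainv_def)
    have one: "X2 rONE = 1" "X2 rZERO = 0" using r2 by (auto simp: rdb_def)
    have "runs incr (X2, H2, inp2) (length al * (max_time incr_body + 3) + 7) (brute_inv n c k rs al (Suc b))"
      unfolding X2(1)
    proof (rule runs_mono[OF runs_incr[OF a2 one b v] order_refl])
      fix s' :: st
      obtain X3 H3 inp3 where s': "s' = (X3, H3, inp3)" by (metis prod_cases3)
      assume "case s' of (X', H', inp') \<Rightarrow> (\<forall>j. j \<notin> {rR, rJ, rT1, rT2, rGO} \<longrightarrow> X' j = X2 j) \<and>
        (\<forall>a. a \<noteq> aVAL \<longrightarrow> H' a = H a) \<and>
        (if Suc b < 2 ^ length al then X' rGO = 1 \<and> val_bits al (set_decode (Suc b)) H' else X' rGO = 0)"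
      then have X3: "\<forall>j. j \<notin> {rR, rJ, rT1, rT2, rGO} \<longrightarrow> X3 j = X2 j" "\<forall>a. a \<noteq> aVAL \<longrightarrow> H3 a = H a"
        "if Suc b < 2 ^ length al then X3 rGO = 1 \<and> val_bits al (set_decode (Suc b)) H3 else X3 rGO = 0"
        by (simp_all add: s')
      have "rdb n c rs X3 H3" by (rule rdb_cong[OF r2]) (use X3 in simp_all)
      moreover have "ainv n al X3 H3" using a2 X3 by (simp add: ainv_def)
      moreover have "X3 rTGT = coef rs {} + int k - 1" "X3 rYES = X2 rYES" using X3 X2 X by simp_all
      ultimately show "brute_inv n c k rs al (Suc b) s'"
        unfolding brute_inv_def s' using X3(3) X2(3) by simp
    qed
    then show ?thesis
      by (intro runs_Seq_straight) (simp_all only: s2 straight.simps)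
  qed
  note seq = runs_Seq[OF runs_eval[OF r n] test]
  have "runs (brute_body c) (X, H, inp) (max_time (Op (OConst rACC 0)) +
      ((length rs * (max_time (eval_body c) + 3) + 6) +
       (max_time (Op (OSub rT1 rACC rTGT)) + (max_time (IfPos rT1 (Op (OConst rYES 1)) Skip) +
        (length al * (max_time incr_body + 3) + 7))))) (brute_inv n c k rs al (Suc b))"
    unfolding brute_body_def
    by (rule runs_Seq_straight) (simp_all only: straight.simps ev.simps op_ev.simps seq)
  then show ?thesis
    by (rule runs_mono) (simp_all add: brute_time_def algebra_simps)
qed

lemma runs_brute:
  assumes g: "gst n c k rs al 0 st"
  shows "runs (brute c) st (2 ^ length al * ((length rs + length al + 1) * brute_time c + 3) + 18)
    (\<lambda>s. fst s rYES = (if \<exists>b<2 ^ length al. good rs al k b then 1 else 0))"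
proof -
  obtain X H inp where st: "st = (X, H, inp)" by (metis prod_cases3)
  have r: "rdb n c rs X H" and a: "ainv n al X H" and X: "X rK = int k" "X rYES = 0" "H aVAL = (\<lambda>_. 0)"
    using g by (auto simp: st gst_def)
  let ?X = "X(rT2 := 0, rTGT := coef rs {} + int k - 1, rGO := 1)"
  have 0: "brute_inv n c k rs al 0 (?X, H, inp)"
    using a X rdb_cong[OF r, of ?X H] by (simp add: brute_inv_def ainv_def val_bits_def)
  have "runs (WhilePos rGO (brute_body c)) (?X, H, inp)
    (2 ^ length al * ((length rs + length al + 1) * brute_time c + 3) + 3) (brute_inv n c k rs al (2 ^ length al))"
  proof (rule runs_WhilePos)
    show "brute_inv n c k rs al 0 (?X, H, inp)" by (rule 0)
    show "fst s rGO > 0 \<and> runs (brute_body c) s ((length rs + length al + 1) * brute_time c)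
        (brute_inv n c k rs al (Suc b))" if "b < 2 ^ length al" "brute_inv n c k rs al b s" for b s
      using runs_brute_body[OF that(1), of n c k rs "fst s" "fst (snd s)" "snd (snd s)"] that
      by (auto simp: brute_inv_def)
    show "\<not> fst s rGO > 0" if "brute_inv n c k rs al (2 ^ length al) s" for s
      using that by (auto simp: brute_inv_def)
  qed
  then have loop: "runs (WhilePos rGO (brute_body c)) (?X, H, inp)
    (2 ^ length al * ((length rs + length al + 1) * brute_time c + 3) + 3)
    (\<lambda>s. fst s rYES = (if \<exists>b<2 ^ length al. good rs al k b then 1 else 0))"
    by (rule runs_mono) (auto simp: brute_inv_def)
  have prep: "ev (Op (OConst rGO 1)) (ev (Op (OSub rTGT rTGT rONE)) (ev (Op (OAdd rTGT rTGT rK))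
      (ev (Op (OLoad rTGT aCOEF rT2)) (ev (Op (OConst rT2 0)) st)))) = (?X, H, inp)"
    using r X by (simp add: st rdb_def)
  have "runs (brute c) st (max_time (Op (OConst rT2 0)) + (max_time (Op (OLoad rTGT aCOEF rT2)) +
      (max_time (Op (OAdd rTGT rTGT rK)) + (max_time (Op (OSub rTGT rTGT rONE)) + (max_time (Op (OConst rGO 1)) +
      (2 ^ length al * ((length rs + length al + 1) * brute_time c + 3) + 3))))))
    (\<lambda>s. fst s rYES = (if \<exists>b<2 ^ length al. good rs al k b then 1 else 0))"
    unfolding brute_def
    by (intro runs_Seq_straight straight.simps(5)[THEN iffD2] TrueI, unfold prep, rule loop)
  then show ?thesis by (rule runs_mono) simp_all
qed

text \<open>Sets with nonzero coefficient lie inside \<open>A\<close>, so values elsewhere do not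
  matter. Records of a set with coefficient 0 may reach outside \<open>A\<close>, but they cancel in
  total; hence both directions pass through \<open>fpoly_eq_sum\<close>.\<close>

lemma good_iff_above:
  assumes V: "\<forall>p\<in>set rs. fst p \<subseteq> {..<n}" and b: "bounded_out rs (set al) 0"
  shows "(\<exists>b<2 ^ length al. good rs al k b) \<longleftrightarrow> above n rs k"
proof
  assume "\<exists>b<2 ^ length al. good rs al k b"
  then obtain b where gd: "good rs al k b" by blast
  \<comment> \<open>\<open>assign\<close> is defined on all numbers, whereas the cube consists of
    extensional functions.\<close>
  let ?\<phi> = "restrict (assign al b) {..<n}"
  have "?\<phi> \<in> cube {..<n}" by (auto simp: assign_def)
  moreover have "fpoly rs ?\<phi> = fpoly rs (assign al b)"
    unfolding fpoly_eq_sum using V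
    by (intro sum.cong refl arg_cong2[of _ _ _ _ "(*)"] chi_depends) auto
  ultimately show "above n rs k" using gd unfolding above_def good_def by (metis (no_types, lifting))
next
  assume "above n rs k"
  then obtain \<phi> where \<phi>: "\<phi> \<in> cube {..<n}" "fpoly rs \<phi> \<ge> coef rs {} + int k" by (auto simp: above_def)
  let ?B = "{i. i < length al \<and> \<phi> (al ! i) = -1}"
  have B: "?B \<subseteq> {..<length al}" by auto
  then have fin: "finite ?B" by (rule finite_subset) simp
  have "fpoly rs (assign al (set_encode ?B)) = fpoly rs \<phi>"
    unfolding fpoly_eq_sum
  proof (rule sum.cong[OF refl])
    fix S assume S: "S \<in> fst ` set rs"
    show "coef rs S * chi S (assign al (set_encode ?B)) = coef rs S * chi S \<phi>"
    proof (cases "coef rs S = 0")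
      case False
      have "S \<subseteq> {..<n}" using S V by auto
      then have "finite S" by (rule finite_subset) simp
      moreover have "card (S - set al) = 0" using b S False by (auto simp: bounded_out_def)
      ultimately have sub: "S \<subseteq> set al" by simp
      have "chi S (assign al (set_encode ?B)) = chi S \<phi>"
      proof (rule chi_depends)
        fix u assume u: "u \<in> S"
        then obtain i where i: "i < length al" "u = al ! i" using sub by (metis in_set_conv_nth subsetD)
        have "u \<in> {..<n}" using u \<open>S \<subseteq> {..<n}\<close> by auto
        with \<phi>(1) have pm: "\<phi> u = -1 \<or> \<phi> u = 1" by (rule cubeD)
        have "u \<in> nth al ` ?B \<longleftrightarrow> \<phi> u = -1" using i by auto
        with pm show "assign al (set_encode ?B) u = \<phi> u"
          by (auto simp: assign_def set_encode_inverse[OF fin])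
      qed
      then show ?thesis by simp
    qed simp
  qed
  with \<phi>(2) have "good rs al k (set_encode ?B)" by (simp add: good_def)
  with set_encode_less[OF B] show "\<exists>b<2 ^ length al. good rs al k b" by blast
qed

section \<open>The complete program and its running time\<close>

definition main :: "nat \<Rightarrow> com" where
  "main c = Op (ORead rNV) ;; Op (ORead rK) ;; Op (ORead rM) ;; Op (OConst rONE 1) ;;
    IfPos rK (Op (OConst rNEXT 1) ;; Op (OStore aINA rNV rONE) ;; WhilePos rM (read_con c) ;;
      passes c c ;; IfPos rYES Skip (brute c)) (Op (OConst rYES 1))"

lemma straight_read_con: "straight (read_con c)"
proof -
  have "straight (con_prog c r)" for r
    by (auto simp: con_prog_def read_var_def read_entry_def emit_def add_coef_def put_slot_def
        fix_slot_def finish_rec_def split: option.splits)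
  then have "straight (dispatch c d)" for d by (induction d) auto
  then show ?thesis by (simp add: read_con_def)
qed

lemma com_wf_main: "com_wf (main c)"
proof -
  have "com_wf (con_prog c r)" for r
    by (auto simp: con_prog_def read_var_def read_entry_def emit_def add_coef_def put_slot_def
        fix_slot_def finish_rec_def split: option.splits)
  then have "com_wf (dispatch c d)" for d by (induction d) auto
  moreover have "com_wf (passes c s)" for s
    by (induction s) (auto simp: pass_def scan_def pass_body_def count_slot_def mark_slot_def)
  ultimately show ?thesis
    by (auto simp: main_def read_con_def brute_def brute_body_def scan_def eval_body_def sign_slot_def
        incr_def incr_body_def)
qed

text \<open>The indicator \<open>aINA\<close> starts with the dummy alone, which is the state that
  \<open>ainv\<close> describes for an empty \<open>A\<close>; reading leaves it untouched.\<close>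

definition read_inv :: "nat \<Rightarrow> csp \<Rightarrow> nat \<Rightarrow> nat \<Rightarrow> st \<Rightarrow> bool" where
  "read_inv c I k i = (\<lambda>(X, H, inp).
     db (num_vars I) c (concat (map (con_recs (num_vars I) c) (take i (constraints I)))) X H \<and>
     inp = concat (map encode_constraint (drop i (constraints I))) \<and>
     X rM = int (num_constraints I) - int i \<and> X rK = int k \<and> X rYES = 0 \<and> X rAN = 0 \<and>
     H aINA = (\<lambda>_. 0)(num_vars I := 1) \<and> H aVAL = (\<lambda>_. 0))"

lemma read_inv_step:
  assumes I: "csp_instance c I" and i: "i < num_constraints I" and inv: "read_inv c I k i (X, H, inp)"
  shows "X rM > 0 \<and> read_inv c I k (Suc i) (ev (read_con c) (X, H, inp))"
proof -
  let ?C = "constraints I ! i" and ?rest = "concat (map encode_constraint (drop (Suc i) (constraints I)))"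
  have i': "i < length (constraints I)" using i by (simp add: num_constraints_def)
  have inp: "inp = encode_constraint ?C @ ?rest"
    using inv Cons_nth_drop_Suc[OF i', symmetric] by (simp add: read_inv_def)
  obtain X1 H1 inp1 where s1: "ev (read_con c) (X, H, encode_constraint ?C @ ?rest) = (X1, H1, inp1)"
    by (metis prod_cases3)
  have v: "valid_constraint c (num_vars I) ?C" using I i' by (simp add: csp_instance_def)
  have db: "db (num_vars I) c (concat (map (con_recs (num_vars I) c) (take i (constraints I)))) X H"
    using inv by (simp add: read_inv_def)
  note st = read_con_db[OF s1 db v]
  show ?thesis using inv st s1 i unfolding inp
    by (simp add: read_inv_def take_Suc_conv_app_nth[OF i'])
qed

text \<open>Provides the hypothesis of the first round, where \<open>A\<close> is empty: a record
  has only \<open>c\<close> slots.\<close>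

lemma rdb_bounded_out: "rdb n c rs X H \<Longrightarrow> bounded_out rs {} c"
proof -
  assume r: "rdb n c rs X H"
  have "card (fst (rs ! i)) \<le> c" if "i < length rs" for i
  proof -
    from r that have "slots_ok n c (H aSLOT) (c * i) (fst (rs ! i))" by (simp add: rdb_def)
    then obtain sl where sl: "length sl = c" "fst (rs ! i) = set sl - {n}" unfolding slots_ok_def by auto
    have "card (set sl - {n}) \<le> card (set sl)" by (rule card_mono) auto
    with card_length[of sl] sl show ?thesis by simp
  qed
  then show ?thesis unfolding bounded_out_def by (metis Diff_empty in_set_conv_nth)
qed

lemma length_recs: "csp_instance c I \<Longrightarrow> length (recs c I) \<le> 2 ^ c * num_constraints I"
proof -
  assume I: "csp_instance c I"
  have "length (concat (map (con_recs n c) Cs)) \<le> 2 ^ c * length Cs"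
    if "\<forall>C\<in>set Cs. valid_constraint c n C" for n Cs
    using that
  proof (induction Cs)
    case (Cons C Cs)
    have "length (con_recs n c C) \<le> 2 ^ c"
      using Cons.prems by (auto simp: con_recs_def Let_def valid_constraint_def intro!: power_increasing)
    with Cons show ?case by simp
  qed simp
  with I show ?thesis by (simp add: recs_def csp_instance_def num_constraints_def)
qed

lemma runs_main_pos:
  assumes I: "csp_instance c I" and k: "k > 0" and inv: "read_inv c I k 0 s"
  defines "d \<equiv> \<Sum>{..c}" and "l \<equiv> length (recs c I)"
  shows "runs (WhilePos rM (read_con c) ;; passes c c ;; IfPos rYES Skip (brute c)) s
    ((num_constraints I * (max_time (read_con c) + 3) + 3) + ((l + 1) * pass_time c c +
      ((2 ^ (d * k) * ((l + d * l + 1) * brute_time c + 3) + 18) + 3)))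
    (\<lambda>s. fst s rYES = (if above_average c I k then 1 else 0))"
proof -
  let ?n = "num_vars I" and ?m = "num_constraints I" and ?rs = "recs c I"
  have V: "\<forall>p\<in>set ?rs. fst p \<subseteq> {..<?n}" using recs_subset[OF I] by (metis prod.collapse)
  have above: "above ?n ?rs k \<longleftrightarrow> above_average c I k"
    using above_average_iff[OF I] by (simp add: above_def assignments_def)
  have read: "runs (WhilePos rM (read_con c)) s (?m * (max_time (read_con c) + 3) + 3) (read_inv c I k ?m)"
  proof (rule runs_WhilePos)
    show "fst s rM > 0 \<and> runs (read_con c) s (max_time (read_con c)) (read_inv c I k (Suc i))"
      if "i < ?m" "read_inv c I k i s" for i s
      using read_inv_step[OF I that(1), of k "fst s" "fst (snd s)" "snd (snd s)"] that(2)
        runs_straight[OF straight_read_con] by simp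
    show "\<not> fst s rM > 0" if "read_inv c I k ?m s" for s using that by (auto simp: read_inv_def)
  qed (rule inv)
  show ?thesis
  proof (rule runs_Seq[OF read])
    fix s1 assume "read_inv c I k ?m s1"
    then have g: "gst ?n c k ?rs [] 0 s1"
      by (auto simp: read_inv_def gst_def ainv_def num_constraints_def recs_def
          intro: db_imp_rdb split: if_splits)
    then have bd: "bounded_out ?rs (set []) c"
      using rdb_bounded_out[of ?n c ?rs "fst s1" "fst (snd s1)"] by (auto simp: gst_def)
    show "runs (passes c c ;; IfPos rYES Skip (brute c)) s1 ((l + 1) * pass_time c c +
      ((2 ^ (d * k) * ((l + d * l + 1) * brute_time c + 3) + 18) + 3))
      (\<lambda>s. fst s rYES = (if above_average c I k then 1 else 0))"
      unfolding l_def
    proof (rule runs_Seq[OF runs_passes[OF V k bd g]], simp, elim exE conjE)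
      fix s2 al y
      assume g2: "gst ?n c k ?rs al y s2" and bd2: "bounded_out ?rs (set al) 0" and y: "y \<in> {0, 1}"
        and y1: "y = 1 \<longrightarrow> (0::int) = 1 \<or> above ?n ?rs k"
        and y0: "y = 0 \<longrightarrow> (0::int) = 0 \<and> length al \<le> length ([]::nat list) + (\<Sum>{..c}) * (k - 1)"
        and len: "length al \<le> length ([]::nat list) + (\<Sum>{..c}) * length ?rs"
      have yes: "fst s2 rYES = y" using g2 by (auto simp: gst_def)
      show "runs (IfPos rYES Skip (brute c)) s2
        ((2 ^ (d * k) * ((length ?rs + d * length ?rs + 1) * brute_time c + 3) + 18) + 3)
        (\<lambda>s. fst s rYES = (if above_average c I k then 1 else 0))"
      proof (rule runs_IfPos)
        assume "fst s2 rYES > 0"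
        then have "y = 1" using yes y by auto
        then show "runs Skip s2 (2 ^ (d * k) * ((length ?rs + d * length ?rs + 1) * brute_time c + 3) + 18)
          (\<lambda>s. fst s rYES = (if above_average c I k then 1 else 0))"
          using y1 above yes by (intro runs_straight) simp_all
      next
        assume "\<not> fst s2 rYES > 0"
        then have "y = 0" using yes y by auto
        \<comment> \<open>The first bound controls the number of assignments, the second the cost of
          each; using the first for both would leave a factor \<open>k\<close>.\<close>
        have al: "length al \<le> d * (k - 1)" "length al \<le> d * length ?rs"
          using y0 len \<open>y = 0\<close> by (simp_all add: d_def)
        have e1: "(2::nat) ^ length al \<le> 2 ^ (d * k)"
          using al(1) by (intro power_increasing) (auto intro: order_trans)
        have e2: "(length ?rs + length al + 1) * brute_time c + 3
            \<le> (length ?rs + d * length ?rs + 1) * brute_time c + 3"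
          using al(2) by (intro add_mono mult_right_mono) simp_all
        have t: "2 ^ length al * ((length ?rs + length al + 1) * brute_time c + 3) + 18
          \<le> 2 ^ (d * k) * ((length ?rs + d * length ?rs + 1) * brute_time c + 3) + 18"
          by (intro add_mono mult_mono order_refl e1 e2) simp_all
        show "runs (brute c) s2 (2 ^ (d * k) * ((length ?rs + d * length ?rs + 1) * brute_time c + 3) + 18)
          (\<lambda>s. fst s rYES = (if above_average c I k then 1 else 0))"
          using runs_mono[OF runs_brute t] g2 \<open>y = 0\<close> good_iff_above[OF V bd2, of k] above by simp
      qed
    qed
  qed
qed

text \<open>The summands belong to reading, to the rounds and to the search. A constraint yields at
  most \<open>2 ^ c\<close> records, the elements of \<open>A\<close> number at most
  \<open>c * (c + 1) div 2\<close> per record, and 60 is a generous allowance for additive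
  constants.\<close>

definition const_factor :: "nat \<Rightarrow> nat" where
  "const_factor c = max_time (read_con c) + 2 ^ c * pass_time c c +
     (1 + c * (c + 1) div 2) * 2 ^ c * brute_time c + 60"

text \<open>The bound uses \<open>num_constraints I + 1\<close> so as to include the empty instance,
  which the program must also answer correctly.\<close>

lemma runs_main:
  assumes I: "csp_instance c I"
  shows "runs (main c) (init_st (encode_instance I k))
    (const_factor c * (2 ^ ((c * (c + 1) div 2) * k) * (num_constraints I + 1)))
    (\<lambda>s. fst s rYES = (if above_average c I k then 1 else 0))"
proof -
  let ?n = "num_vars I" and ?m = "num_constraints I" and ?d = "\<Sum>{..c}" and ?l = "length (recs c I)"
  let ?inp = "concat (map encode_constraint (constraints I))"
  let ?X = "(\<lambda>_. 0 :: int)(rNV := int ?n, rK := int k, rM := int ?m, rONE := 1)"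
  let ?E = "2 ^ (?d * k) :: nat"
  let ?T = "(?m * (max_time (read_con c) + 3) + 3) + ((?l + 1) * pass_time c c +
      ((?E * ((?l + ?d * ?l + 1) * brute_time c + 3) + 18) + 3))"
  let ?G = "\<lambda>s. fst s rYES = (if above_average c I k then 1 else 0)"
  define body where "body = Op (OConst rNEXT 1) ;; Op (OStore aINA rNV rONE) ;; WhilePos rM (read_con c) ;;
      passes c c ;; IfPos rYES Skip (brute c)"
  have d: "?d = c * (c + 1) div 2"
    using gauss_sum_nat[of c] by (simp add: atMost_atLeast0)
  have "runs (IfPos rK body (Op (OConst rYES 1))) (?X, \<lambda>_ _. 0, ?inp) ((12 + ?T) + 3) ?G"
  proof (rule runs_IfPos)
    assume "fst (?X, \<lambda>_ _. 0 :: int, ?inp) rK > 0"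
    then have k: "k > 0" by simp
    have "good_codes ?n (\<lambda>_. 0) 1"
      unfolding good_codes_def by (intro exI[of _ id] exI[of _ 0]) simp
    then have inv: "read_inv c I k 0 (ev (Op (OStore aINA rNV rONE)) (ev (Op (OConst rNEXT 1)) (?X, \<lambda>_ _. 0, ?inp)))"
      by (simp add: read_inv_def db_def)
    have "runs body (?X, \<lambda>_ _. 0, ?inp) (max_time (Op (OConst rNEXT 1)) + (max_time (Op (OStore aINA rNV rONE)) + ?T)) ?G"
      unfolding body_def
      by (intro runs_Seq_straight straight.simps(5)[THEN iffD2] TrueI) (rule runs_main_pos[OF I k inv])
    then show "runs body (?X, \<lambda>_ _. 0, ?inp) (12 + ?T) ?G" by (rule runs_mono) simp_all
  next
    assume "\<not> fst (?X, \<lambda>_ _. 0 :: int, ?inp) rK > 0"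
    then have k: "k = 0" by simp
    \<comment> \<open>Not all values can lie strictly below their mean, so for \<open>k = 0\<close>
      the answer is always positive.\<close>
    have "above_average c I 0"
    proof (rule ccontr)
      assume "\<not> above_average c I 0"
      then have lt: "fpoly (recs c I) \<phi> < coef (recs c I) {}" if "\<phi> \<in> cube {..<?n}" for \<phi>
        using that above_average_iff[OF I, of 0] by (force simp: assignments_def)
      have "(\<Sum>\<phi>\<in>cube {..<?n}. fpoly (recs c I) \<phi>) < (\<Sum>\<phi>\<in>cube {..<?n}. coef (recs c I) {})"
        using lt cube_nonempty by (intro sum_strict_mono) auto
      moreover have "(\<Sum>\<phi>\<in>cube {..<?n}. fpoly (recs c I) \<phi>) = 2 ^ card {..<?n} * coef (recs c I) {}"
        by (rule sum_fpoly) (use recs_subset[OF I] in force)+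
      ultimately show False by (simp add: card_cube)
    qed
    then show "runs (Op (OConst rYES 1)) (?X, \<lambda>_ _. 0, ?inp) (12 + ?T) ?G"
      using k by (intro runs_straight) simp_all
  qed
  moreover have "ev (Op (OConst rONE 1)) (ev (Op (ORead rM)) (ev (Op (ORead rK)) (ev (Op (ORead rNV))
      (init_st (encode_instance I k))))) = (?X, \<lambda>_ _. 0, ?inp)"
    by (simp add: init_st_def encode_instance_def)
  ultimately have "runs (main c) (init_st (encode_instance I k)) (max_time (Op (ORead rNV)) +
      (max_time (Op (ORead rK)) + (max_time (Op (ORead rM)) + (max_time (Op (OConst rONE 1)) + ((12 + ?T) + 3))))) ?G"
    unfolding main_def body_def[symmetric]
    by (intro runs_Seq_straight straight.simps(4,5)[THEN iffD2] TrueI) simp_all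
  moreover have "max_time (Op (ORead rNV)) + (max_time (Op (ORead rK)) + (max_time (Op (ORead rM)) +
      (max_time (Op (OConst rONE 1)) + ((12 + ?T) + 3)))) \<le> const_factor c * (?E * (?m + 1))"
  proof -
    define F where "F = ?E * (?m + 1)"
    have E: "1 \<le> ?E" by simp
    have mF: "?m + 1 \<le> F" using mult_right_mono[OF E, of "?m + 1"] by (simp add: F_def)
    have EF: "?E \<le> F" by (simp add: F_def)
    have one: "1 \<le> F" using mF by simp
    have l: "?l + 1 \<le> 2 ^ c * (?m + 1)"
    proof -
      have "(1::nat) \<le> 2 ^ c" by simp
      with length_recs[OF I] show ?thesis unfolding distrib_left by linarith
    qed
    have 1: "?m * (max_time (read_con c) + 3) \<le> (max_time (read_con c) + 3) * F"
      using mF by (subst mult.commute) (intro mult_left_mono; simp)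
    have "?l + 1 \<le> 2 ^ c * F" using l mult_left_mono[OF mF, of "2 ^ c"] by simp
    from mult_right_mono[OF this, of "pass_time c c"]
    have 2: "(?l + 1) * pass_time c c \<le> 2 ^ c * pass_time c c * F" by (simp add: mult_ac)
    have "?l + ?d * ?l + 1 \<le> (1 + ?d) * (?l + 1)" by simp
    also have "\<dots> \<le> (1 + ?d) * (2 ^ c * (?m + 1))" using l by (intro mult_left_mono) simp_all
    finally have "(?l + ?d * ?l + 1) * brute_time c \<le> (1 + ?d) * (2 ^ c * (?m + 1)) * brute_time c"
      by (rule mult_right_mono) simp
    then have "?E * ((?l + ?d * ?l + 1) * brute_time c)
        \<le> ?E * ((1 + ?d) * (2 ^ c * (?m + 1)) * brute_time c)"
      by (rule mult_left_mono) simp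
    also have "\<dots> = (1 + ?d) * 2 ^ c * brute_time c * F" unfolding F_def by (simp only: mult_ac)
    finally have 3: "?E * ((?l + ?d * ?l + 1) * brute_time c) \<le> (1 + ?d) * 2 ^ c * brute_time c * F" .
    have "4 + 12 + 3 + 3 + 18 + 3 + ?E * 3 \<le> 46 * F" using one EF by linarith
    with 1 2 3 have "4 + ((12 + ?T) + 3) \<le> (max_time (read_con c) + 3) * F + 2 ^ c * pass_time c c * F +
        (1 + ?d) * 2 ^ c * brute_time c * F + 46 * F"
      unfolding distrib_left[of ?E] by linarith
    also have "\<dots> \<le> const_factor c * F"
      unfolding const_factor_def d by (simp add: algebra_simps)
    finally show ?thesis by (simp add: F_def)
  qed
  ultimately show ?thesis unfolding d[symmetric] by (rule runs_mono)
qed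

theorem theorem5:
  fixes c :: nat
  assumes "c \<ge> 2"
  shows "\<exists>P. solves_above_average c P \<and>
           (\<exists>K::nat. \<forall>I k. csp_instance c I \<and> num_constraints I \<ge> 1 \<longrightarrow>
              ram_time P (encode_instance I k)
                \<le> K * (2 ^ ((c * (c + 1) div 2) * k) * num_constraints I))"
proof (intro exI conjI allI impI)
  let ?P = "comp_com 0 (main c)" and ?e = "\<lambda>k. 2 ^ ((c * (c + 1) div 2) * k) :: nat"
  have run: "ram_terminates ?P (encode_instance I k) \<and>
      ram_result ?P (encode_instance I k) = (if above_average c I k then 1 else 0) \<and>
      ram_time ?P (encode_instance I k) \<le> const_factor c * (?e k * (num_constraints I + 1))"
    if "csp_instance c I" for I k
  proof -
    from runs_main[OF that, of k] obtain t s where ts: "big_step (main c) (init_st (encode_instance I k)) t s"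
      "t \<le> const_factor c * (?e k * (num_constraints I + 1))"
      "fst s 0 = (if above_average c I k then 1 else 0)"
      unfolding runs_def by blast
    from ram_of_big_step[OF ts(1) com_wf_main] ts(2,3) show ?thesis by simp
  qed
  then show "solves_above_average c ?P" unfolding solves_above_average_def by blast
  fix I k assume I: "csp_instance c I \<and> 1 \<le> num_constraints I"
  have "ram_time ?P (encode_instance I k) \<le> const_factor c * (?e k * (num_constraints I + 1))"
    using run I by blast
  \<comment> \<open>With at least one constraint, \<open>m + 1 \<le> 2 * m\<close>; this accounts
    for the factor 2 in the final constant.\<close>
  also have "\<dots> \<le> const_factor c * (?e k * (2 * num_constraints I))"
    using I by (intro mult_left_mono) simp_all
  finally show "ram_time ?P (encode_instance I k) \<le> 2 * const_factor c * (?e k * num_constraints I)"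
    by (simp add: mult_ac)
qed

end
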